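(* Let $\Sigma\subseteq\mathrm{PG}(4,q^5)$ be a canonical $\mathbb F_q$-subgeometry and $\Gamma$ a plane with $\Gamma\cap\Sigma=\emptyset$ such that $\mathbb L=\wp_\Gamma(\Sigma)$ is a maximum scattered linear set which is neither of pseudoregulus type nor of LP type. Let $\sigma$ be a generator of $\mathbb G$ whose underlying semilinear map has companion automorphism $x\mapsto x^{q^s}$, $1\le s\le4$, and suppose the point $A=\Gamma\cap\Gamma^{\sigma^4}$ has rank 5. Then, up to projectivities, $$\mathbb L=\{\langle(x-k^{-1}x^{q^{2s}},\ x^{q^s}-\delta k^{q^{4s}+q^{2s}}x^{q^{2s}})\rangle_{\mathbb F_{q^5}}: x\in\mathbb F_{q^5}^*\}$$ for some $k\in\mathbb F_{q^5}^*$ and $\delta\in\mathbb F_q$. Furthermore, setting $\varepsilon=\mathrm N_{q^5/q}(k)$, one has $\delta^2\varepsilon\neq1$, $\delta^3\varepsilon^2+(1-3\delta)\varepsilon+1\neq0$, and there is no $x\in\mathbb F_{q^5}$ satisfying simultaneously $\varepsilon\,\mathrm N_{q^5/q}(x)=-1$ and $\delta^2\varepsilon x^{q^s}-\delta\varepsilon x^{q^{2s}+q^s+1}(1-x)^{q^{3s}}+(1-x)^{q^s+1}=0$.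
   Context: $q$ is a prime power; $\mathrm N_{q^5/q}(x)=x^{1+q+q^2+q^3+q^4}$. An $\mathbb F_q$-linear set of rank 5 in $\mathrm{PG}(1,q^5)$ is $L_U=\{\langle v\rangle_{\mathbb F_{q^5}}:v\in U\setminus\{0\}\}$ for a 5-dimensional $\mathbb F_q$-subspace $U\subseteq\mathbb F_{q^5}^2$; it is maximum scattered if it has $(q^5-1)/(q-1)$ points. It is of pseudoregulus type if it is $\mathrm{P\Gamma L}(2,q^5)$-equivalent to $\{\langle(x,x^{q^t})\rangle_{\mathbb F_{q^5}}:x\in\mathbb F_{q^5}^*\}$ with $\gcd(t,5)=1$, and of LP type if equivalent to $\{\langle(x,x^{q^t}+\delta' x^{q^{5-t}})\rangle_{\mathbb F_{q^5}}:x\in\mathbb F_{q^5}^*\}$ with $\gcd(t,5)=1$, $\mathrm N_{q^5/q}(\delta')\notin\{0,1\}$. A canonical $\mathbb F_q$-subgeometry of $\mathrm{PG}(4,q^5)$ is the image under a projectivity of the set of points having coordinates in $\mathbb F_q$. $\wp_\Gamma(\Sigma)$ is the projection of $\Sigma$ from $\Gamma$ onto a line disjoint from $\Gamma$. $\mathbb G$ is the subgroup of $\mathrm{P\Gamma L}(5,q^5)$ fixing $\Sigma$ pointwise (cyclic of order 5). The rank of a point $X$ is $1+\dim\langle X,X^\sigma,\dots,X^{\sigma^4}\rangle$ (projective dimension). *)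

theory Defs
  imports
    "HOL-Analysis.Analysis"
    "HOL-Algebra.Bij"
    "HOL-Algebra.Generated_Groups"
    "HOL-Number_Theory.Prime_Powers"
begin

text \<open>
  The type \<open>'a\<close> plays the role of the field of order \<open>q ^ 5\<close>. Its subfield of order \<open>q\<close> is the
  set \<open>Fq q\<close> of fixed points of \<open>x \<mapsto> x ^ q\<close>.
\<close>

definition Fq :: "nat \<Rightarrow> 'a::field set" where
  "Fq q = {x. x ^ q = x}"

definition norm5 :: "nat \<Rightarrow> 'a::field \<Rightarrow> 'a" where
  "norm5 q x = x ^ (1 + q + q ^ 2 + q ^ 3 + q ^ 4)"

text \<open>
  A point of the projective space of \<open>'a ^ 'n\<close> is a one-dimensional subspace, represented as a set
  of vectors. Projective subspaces are sets of points.
\<close>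

definition pg_points :: "('a::field ^ 'n) set set" where
  "pg_points = {vec.span {v} | v. v \<noteq> 0}"

definition pg_subspace :: "nat \<Rightarrow> ('a::field ^ 'n) set set \<Rightarrow> bool" where
  "pg_subspace d \<Gamma> \<longleftrightarrow>
     (\<exists>W. vec.subspace W \<and> vec.dim W = d + 1 \<and> \<Gamma> = {P \<in> pg_points. P \<subseteq> W})"

definition pg_span :: "('a::field ^ 'n) set set \<Rightarrow> ('a ^ 'n) set set" where
  "pg_span S = {P \<in> pg_points. P \<subseteq> vec.span (\<Union>S)}"

definition field_automorphism :: "('a::field \<Rightarrow> 'a) \<Rightarrow> bool" where
  "field_automorphism \<theta> \<longleftrightarrow> bij \<theta> \<and> \<theta> 1 = 1 \<and>
     (\<forall>x y. \<theta> (x + y) = \<theta> x + \<theta> y) \<and> (\<forall>x y. \<theta> (x * y) = \<theta> x * \<theta> y)"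

definition semilinear :: "('a::field \<Rightarrow> 'a) \<Rightarrow> ('a ^ 'n \<Rightarrow> 'a ^ 'n) \<Rightarrow> bool" where
  "semilinear \<theta> f \<longleftrightarrow> field_automorphism \<theta> \<and>
     (\<forall>x y. f (x + y) = f x + f y) \<and> (\<forall>c x. f (c *s x) = \<theta> c *s f x)"

text \<open>
  Collineations are extensional functions on \<open>pg_points\<close>, i.e. elements of the carrier of
  \<open>BijGroup pg_points\<close>, so that semilinear maps differing by a scalar induce the same collineation.
\<close>

definition induced :: "('a::field ^ 'n \<Rightarrow> 'a ^ 'n) \<Rightarrow> ('a ^ 'n) set \<Rightarrow> ('a ^ 'n) set" where
  "induced f = restrict (image f) pg_points"

definition has_companion ::
    "(('a::field ^ 'n) set \<Rightarrow> ('a ^ 'n) set) \<Rightarrow> ('a \<Rightarrow> 'a) \<Rightarrow> bool" where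
  "has_companion g \<theta> \<longleftrightarrow> (\<exists>f. semilinear \<theta> f \<and> bij f \<and> g = induced f)"

definition PGammaL :: "(('a::field ^ 'n) set \<Rightarrow> ('a ^ 'n) set) set" where
  "PGammaL = {g. \<exists>\<theta>. has_companion g \<theta>}"

definition PGL :: "(('a::field ^ 'n) set \<Rightarrow> ('a ^ 'n) set) set" where
  "PGL = {induced f | f. Vector_Spaces.linear (*s) (*s) f \<and> bij f}"

definition PGammaL_equivalent :: "('a::field ^ 'n) set set \<Rightarrow> ('a ^ 'n) set set \<Rightarrow> bool" where
  "PGammaL_equivalent L M \<longleftrightarrow> (\<exists>g \<in> PGammaL. M = g ` L)"

definition PGL_equivalent :: "('a::field ^ 'n) set set \<Rightarrow> ('a ^ 'n) set set \<Rightarrow> bool" where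
  "PGL_equivalent L M \<longleftrightarrow> (\<exists>g \<in> PGL. M = g ` L)"

definition canonical_subgeometry :: "nat \<Rightarrow> ('a::field ^ 'n) set set \<Rightarrow> bool" where
  "canonical_subgeometry q \<Sigma> \<longleftrightarrow>
     (\<exists>g \<in> PGL. \<Sigma> = g ` {vec.span {v} | v. v \<noteq> 0 \<and> (\<forall>i. v $ i \<in> Fq q)})"

definition pointwise_stabilizer ::
    "('a::field ^ 'n) set set \<Rightarrow> (('a ^ 'n) set \<Rightarrow> ('a ^ 'n) set) set" where
  "pointwise_stabilizer \<Sigma> = {g \<in> PGammaL. \<forall>P \<in> \<Sigma>. g P = P}"

text \<open>The vector space dimension used here is one more than the projective dimension.\<close>

definition point_rank ::
    "(('a::field ^ 'n) set \<Rightarrow> ('a ^ 'n) set) \<Rightarrow> ('a ^ 'n) set \<Rightarrow> nat" where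
  "point_rank \<sigma> X = vec.dim (\<Union>i\<in>{0..4}. (\<sigma> ^^ i) X)"

definition projection ::
    "('a::field ^ 'n) set set \<Rightarrow> ('a ^ 'n) set set \<Rightarrow> ('a ^ 'n) set set \<Rightarrow> ('a ^ 'n) set set" where
  "projection \<Gamma> \<Lambda> \<Sigma> = {Q. \<exists>P \<in> \<Sigma>. pg_span (insert P \<Gamma>) \<inter> \<Lambda> = {Q}}"

text \<open>
  A projective frame identifying the line \<open>\<Lambda>\<close> with the projective line over \<open>'a\<close>, through an
  injective linear map \<open>e\<close>. All notions below for sets of points of the projective line are
  invariant under the choice of \<open>e\<close>.
\<close>

definition line_coordinates :: "('a::field ^ 2 \<Rightarrow> 'a ^ 'n) \<Rightarrow> ('a ^ 'n) set set \<Rightarrow> bool" where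
  "line_coordinates e \<Lambda> \<longleftrightarrow>
     Vector_Spaces.linear (*s) (*s) e \<and> inj e \<and> \<Lambda> = image e ` pg_points"

definition Fq_subspace_of_dim :: "nat \<Rightarrow> nat \<Rightarrow> ('a::field ^ 'n) set \<Rightarrow> bool" where
  "Fq_subspace_of_dim q d U \<longleftrightarrow> (\<exists>b :: nat \<Rightarrow> 'a ^ 'n.
     (\<forall>c. (\<forall>i<d. c i \<in> Fq q) \<and> (\<Sum>i<d. c i *s b i) = 0 \<longrightarrow> (\<forall>i<d. c i = 0)) \<and>
     U = {\<Sum>i<d. c i *s b i | c. \<forall>i<d. c i \<in> Fq q})"

definition linear_set_of :: "('a::field ^ 2) set \<Rightarrow> ('a ^ 2) set set" where
  "linear_set_of U = {vec.span {v} | v. v \<in> U - {0}}"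

definition maximum_scattered :: "nat \<Rightarrow> ('a::field ^ 2) set set \<Rightarrow> bool" where
  "maximum_scattered q L \<longleftrightarrow>
     (\<exists>U. Fq_subspace_of_dim q 5 U \<and> L = linear_set_of U) \<and>
     card L = (q ^ 5 - 1) div (q - 1)"

definition pseudoregulus_type :: "nat \<Rightarrow> ('a::field ^ 2) set set \<Rightarrow> bool" where
  "pseudoregulus_type q L \<longleftrightarrow> (\<exists>t::nat. gcd t 5 = 1 \<and>
     PGammaL_equivalent L {vec.span {vector [x, x ^ (q ^ t)]} | x. x \<noteq> 0})"

text \<open>The bound \<open>t < 5\<close> keeps the natural number subtraction in \<open>q ^ (5 - t)\<close> exact.\<close>

definition LP_type :: "nat \<Rightarrow> ('a::field ^ 2) set set \<Rightarrow> bool" where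
  "LP_type q L \<longleftrightarrow> (\<exists>(t::nat) \<delta>'. t < 5 \<and> gcd t 5 = 1 \<and> norm5 q \<delta>' \<notin> {0, 1} \<and>
     PGammaL_equivalent L
       {vec.span {vector [x, x ^ (q ^ t) + \<delta>' * x ^ (q ^ (5 - t))]} | x. x \<noteq> 0})"

end

theory Submission
  imports Defs "HOL-Algebra.Algebraic_Closure_Type" "HOL-Number_Theory.Residues"
begin

text \<open>
  Write \<open>sg i x\<close> for \<open>x ^ (q ^ (s * i))\<close>. As the point \<open>A\<close> has rank 5, its orbit is a basis; in it
  \<open>\<Sigma>\<close> consists of the points \<open>(x, sg 1 x, \<dots>, sg 4 x)\<close> and \<open>\<Gamma>\<close> is spanned by the first two
  basis points and one point \<open>(0, 0, b2, b3, b4)\<close>. Hence \<open>L\<close> is obtained from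
  \<open>(y, sg 1 y, sg 2 y)\<close> by applying two functionals with common kernel \<open>(b2, b3, b4)\<close>, and it is
  scattered iff a form in the 2 by 2 minors of \<open>x, y\<close> vanishes only for proportional \<open>x, y\<close>.

  A zero of that form with \<open>x, y\<close> independent amounts to a solution of a single Pluecker equation.
  By Hilbert 90 this turns into an equation together with a norm condition. Solutions are found on
  a curve of bidegree (2, 2) over the algebraic closure: counting its points \<open>(z, z ^ q)\<close>
  shows that one of them also satisfies the residual equation that forces the norm
  condition, and the norm condition places \<open>z\<close> in the field of order \<open>q ^ 5\<close>. This excludes the
  degenerate kernels with exactly two nonzero coordinates (up to the LP case) and, through trace
  duality, all kernels \<open>(a, b, 1)\<close> for which \<open>\<delta> = b * sg 2 a * sg 4 a\<close> is not in the subfield. In the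
  remaining cases \<open>\<delta>\<^sup>2 \<epsilon> = 1\<close> and the vanishing of the cubic give explicit functionals exhibiting
  \<open>L\<close> as of pseudoregulus or LP type, and the third excluded equation is the Pluecker equation itself.
\<close>

text \<open>Small \<open>q\<close> are the obstacle: an asymptotic estimate of the number of
  solutions says nothing there, whereas the count of points \<open>(z, z ^ q)\<close>, where
  \<open>2 * q + 1\<close> meets the bound \<open>2 * q\<close>, is exact. It takes place in the
  algebraic closure because membership in the field of order \<open>q ^ 5\<close> is a consequence
  of the norm condition and cannot be imposed beforehand. Duality enters because the curve is tied
  to \<open>x \<mapsto> x ^ q\<close>, while \<open>sg 1\<close> may be any of four generators. For
  \<open>s = 3\<close> the Pluecker equation itself has the shape of the curve; for
  \<open>s = 1\<close> it is the Pfaffian of the trace-dual alternating form, whose vanishing makes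
  a kernel too large. The values \<open>s = 2\<close> and \<open>s = 4\<close> follow from these by
  passing to the inverse generator. The parameters are invariants of the kernel
  \<open>(a, b, 1)\<close>: rescaling the basis point changes \<open>a\<close> and \<open>b\<close>,
  but neither \<open>norm5 q a\<close> nor \<open>b * sg 2 a * sg 4 a\<close>. They enter the
  statement through \<open>k = inverse a\<close>, so that its norm is the inverse of that of
  \<open>a\<close>.\<close>

hide_const (open) Polynomials.degree Polynomials.lead_coeff up_ring.coeff up_ring.monom module.smult Divisibility.prime

section \<open>Frobenius points of biquadratic curves\<close>

lemma card_roots_of_separable:
  fixes p :: "'a::alg_closed_field poly"
  assumes "p \<noteq> 0" and sep: "\<And>x. poly p x = 0 \<Longrightarrow> poly (pderiv p) x \<noteq> 0"
  shows "card {x. poly p x = 0} = degree p"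
proof -
  obtain M where M: "size M = degree p" "p = smult (lead_coeff p) (\<Prod>x\<in>#M. [:-x, 1:])"
    using alg_closed_imp_factorization[OF assms(1)] by blast
  have roots: "poly p x = 0 \<longleftrightarrow> x \<in># M" for x
    using \<open>p \<noteq> 0\<close> by (subst M(2)) (auto simp: poly_prod_mset prod_mset_zero_iff)
  have "count M x \<le> 1" for x
  proof (rule ccontr)
    assume "\<not> count M x \<le> 1"
    then have "replicate_mset 2 x \<subseteq># M" by (simp add: count_le_replicate_mset_subset_eq[symmetric])
    then obtain N where N: "M = replicate_mset 2 x + N" by (metis subset_mset.add_diff_inverse)
    define r where "r = smult (lead_coeff p) (\<Prod>x\<in>#N. [:-x, 1:])"
    have p: "p = [:-x, 1:] * ([:-x, 1:] * r)"
      by (subst M(2)) (simp add: N r_def numeral_2_eq_2 mult_ac)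
    have "poly p x = 0" "poly (pderiv p) x = 0"
      unfolding p by (simp_all only: pderiv_mult poly_add poly_mult) simp_all
    then show False using sep by blast
  qed
  then have "size M = card (set_mset M)"
    by (metis count_greater_eq_one_iff count_mset_set(1) count_mset_set(3) finite_set_mset le_antisym
        mset_set_set_mset_msubset multiset_eqI not_in_iff size_mset_set)
  then show ?thesis using M(1) roots by simp
qed

text \<open>
  A curve of bidegree (2, 2) given by \<open>F x y = A1 + A2 y + A3 x + x y M x y\<close> carries the function
  \<open>M\<close> of degree 2. If a point \<open>(z, z ^ q)\<close> of the curve never satisfies \<open>K\<close>, then the
  \<open>2 q + 1\<close> or more such points have at most \<open>q\<close> different values of \<open>M\<close>, each taken at
  most twice.
\<close>

lemma biquadratic_frobenius_point:
  fixes A1 A2 A3 A4 A5 A6 A7 \<beta> :: "'a::alg_closed_field" and q :: nat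
  defines "M \<equiv> \<lambda>x y. A7 + A4 * x + A5 * y + A6 * x * y"
  defines "F \<equiv> \<lambda>x y. A1 + A2 * y + A3 * x + x * y * M x y"
  defines "Fx \<equiv> \<lambda>x y. A3 + A7 * y + A5 * y ^ 2 + 2 * x * y * (A4 + A6 * y)"
  assumes q: "2 \<le> q" "of_nat q = (0 :: 'a)"
    and lead: "A6 \<noteq> 0 \<or> A5 \<noteq> 0"
    and fibre: "\<And>m. A3 * A6 = A4 * m \<Longrightarrow> A1 * A5 + A2 * (m - A7) = 0 \<Longrightarrow>
                  A1 * A6 + A3 * A5 - A2 * A4 + m * (m - A7) \<noteq> 0"
    and val: "\<And>z. F z (z ^ q) = 0 \<Longrightarrow> \<not> K z \<Longrightarrow> M z (z ^ q) ^ q = M z (z ^ q) + \<beta>"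
    and ramified: "\<And>z. F z (z ^ q) = 0 \<Longrightarrow> Fx z (z ^ q) = 0 \<Longrightarrow> K z"
  shows "\<exists>z. F z (z ^ q) = 0 \<and> K z"
proof (rule ccontr)
  assume "\<not> ?thesis"
  then have noK: "F z (z ^ q) = 0 \<Longrightarrow> \<not> K z" for z by blast
  \<comment> \<open>\<open>G\<close> is \<open>F z (z ^ q)\<close> as a polynomial in
    \<open>z\<close>. Since \<open>q\<close> is zero in the field, its derivative sees the first
    argument of \<open>F\<close> only; so if \<open>K\<close> never holds, \<open>ramified\<close>
    says that all roots of \<open>G\<close> are simple.\<close>
  define G where "G = monom A1 0 + monom A2 q + monom A3 1 + monom A4 (q + 2) + monom A5 (2 * q + 1)
    + monom A6 (2 * q + 2) + monom A7 (q + 1)"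
  have zq2: "z ^ (q * 2) = z ^ q * z ^ q" for z :: 'a
    by (metis mult_2_right power_add)
  have polyG: "poly G z = F z (z ^ q)" for z
    by (simp add: G_def F_def M_def poly_monom power_add algebra_simps power2_eq_square zq2)
  have polyG': "poly (pderiv G) z = Fx z (z ^ q)" for z
    using q by (simp add: G_def Fx_def pderiv_add pderiv_monom poly_monom power_add algebra_simps
        power2_eq_square zq2)
  have deg: "2 * q + 1 \<le> degree G" and "G \<noteq> 0"
  proof -
    have c6: "coeff G (2 * q + 2) = A6" and c5: "coeff G (2 * q + 1) = A5"
      using q(1) by (simp_all add: G_def)
    show "2 * q + 1 \<le> degree G"
    proof (cases "A6 = 0")
      case True
      then show ?thesis using lead c5 by (intro le_degree) simp
    next
      case False
      then have "2 * q + 2 \<le> degree G" using c6 by (intro le_degree) simp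
      then show ?thesis by simp
    qed
    show "G \<noteq> 0" using c5 c6 lead by auto
  qed
  define R where "R = {z. F z (z ^ q) = 0}"
  have cardR: "card R = degree G"
    using card_roots_of_separable[OF \<open>G \<noteq> 0\<close>] noK ramified polyG polyG' by (auto simp: R_def)
  have finR: "finite R" using poly_roots_finite[OF \<open>G \<noteq> 0\<close>] by (simp add: R_def polyG)
  define V where "V = {m. m ^ q = m + \<beta>}"
  define P where "P = monom 1 q - [:\<beta>, 1:]"
  have P: "poly P m = 0 \<longleftrightarrow> m \<in> V" for m
    by (auto simp: P_def V_def poly_monom algebra_simps)
  have "coeff P q = 1" using q(1) by (simp add: P_def coeff_pCons split: nat.splits)
  then have "P \<noteq> 0" by auto
  have "degree P \<le> q" unfolding P_def using q(1) by (intro degree_diff_le) (auto simp: degree_monom_le)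
  then have V: "card V \<le> q" "finite V"
    using card_poly_roots_bound[OF \<open>P \<noteq> 0\<close>] poly_roots_finite[OF \<open>P \<noteq> 0\<close>] by (simp_all add: P)
  let ?M = "\<lambda>z. M z (z ^ q)"
  have img: "?M ` R \<subseteq> V" using val noK by (auto simp: R_def V_def)
  have fib: "card {z \<in> R. ?M z = m} \<le> 2" for m
  proof -
    \<comment> \<open>For fixed \<open>m\<close> both \<open>M = m\<close> and \<open>F = 0\<close>
      are linear in \<open>y\<close>. \<open>Q\<close> results from eliminating \<open>y\<close>,
      and \<open>fibre\<close> says exactly that its coefficients do not all vanish.\<close>
    define Q where "Q = [:A1 * A5 + A2 * (m - A7), A1 * A6 + A3 * A5 - A2 * A4 + m * (m - A7),
                          A3 * A6 - A4 * m:]"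
    have "Q \<noteq> 0" using fibre[of m] by (auto simp: Q_def)
    have "poly Q z = 0" if "z \<in> R" "?M z = m" for z
    proof -
      have 1: "(z ^ q) * (A5 + A6 * z) = m - A7 - A4 * z"
        using that(2) by (simp add: M_def algebra_simps)
      have 2: "(z ^ q) * (A2 + z * m) = - (A1 + A3 * z)"
      proof -
        have "A1 + A2 * (z ^ q) + A3 * z + z * (z ^ q) * m = 0"
          using that by (simp add: R_def F_def)
        then show ?thesis by (simp add: algebra_simps eq_neg_iff_add_eq_0)
      qed
      have "poly Q z = (A1 + A3 * z) * (A5 + A6 * z) + (m - A7 - A4 * z) * (A2 + z * m)"
        by (simp add: Q_def algebra_simps power2_eq_square)
      also have "\<dots> = (A5 + A6 * z) * (A1 + A3 * z + (z ^ q) * (A2 + z * m))"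
        unfolding 1[symmetric] by (simp add: algebra_simps)
      also have "\<dots> = 0" unfolding 2 by simp
      finally show ?thesis .
    qed
    then have "{z \<in> R. ?M z = m} \<subseteq> {z. poly Q z = 0}" by auto
    then have "card {z \<in> R. ?M z = m} \<le> card {z. poly Q z = 0}"
      by (rule card_mono[OF poly_roots_finite[OF \<open>Q \<noteq> 0\<close>]])
    also have "\<dots> \<le> degree Q" by (rule card_poly_roots_bound[OF \<open>Q \<noteq> 0\<close>])
    also have "\<dots> \<le> 2" by (simp add: Q_def)
    finally show ?thesis .
  qed
  have "(\<Sum>z\<in>R. 1 :: nat) = (\<Sum>m\<in>?M ` R. \<Sum>z\<in>{z \<in> R. ?M z = m}. 1)"
    by (rule sum.image_gen[OF finR])
  then have "card R = (\<Sum>m\<in>?M ` R. card {z \<in> R. ?M z = m})" by simp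
  also have "\<dots> \<le> (\<Sum>m\<in>?M ` R. 2)" by (intro sum_mono fib)
  also have "\<dots> \<le> 2 * q" using card_mono[OF V(2) img] V(1) by simp
  finally show False using cardR deg by simp
qed

text \<open>\<open>d0\<close> to \<open>d4\<close> stand for the conjugates of an element under
  \<open>x \<mapsto> x ^ q\<close>, but are kept as independent variables: the identities then hold
  over every field, and Frobenius enters only with the interpretation.\<close>

locale curve_coeffs =
  fixes n d0 d1 d2 d3 d4 c0 c1 c2 c3 c4 :: "'a::field"
  assumes n: "n \<noteq> 0"
    and c: "n * c0 = d0 * d1" "n * c1 = d1 * d2" "n * c2 = d2 * d3" "n * c3 = d3 * d4" "n * c4 = d4 * d0"
begin

definition "A1 = (1 - c0) * (1 - c4)"
definition "A2 = (1 - d3) * (1 - c4)"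
definition "A3 = (1 - d4) * (1 - c0)"
definition "A4 = (n - d3) * (1 - c1)"
definition "A5 = (n - d4) * (1 - c2)"
definition "A6 = n * (1 - c1) * (1 - c2)"
definition "A7 = 1 + n - 2 * d3 - 2 * d4 - c0 * d2 + c1 * d3 + c0 * d4 + c3 * d0 + c2 * d4 - c1 * c3 * d0"

text \<open>Origin of \<open>F\<close> and \<open>K\<close>: let \<open>x, y, w, v\<close> be
  \<open>z\<close> and its next three conjugates. The wanted equation is
  \<open>(1 + x) * (1 + w) + d4 * x * w * v * (1 + y) = c1 * x\<close>. Its inverse Frobenius image,
  with the fifth conjugate removed by the norm condition, is \<open>(1 + n * x * y * w * v) * (1 +
  y) + d3 * y * w * (1 + x) = c0\<close>. Eliminating \<open>v\<close> from the two gives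
  \<open>K\<close>. Removing \<open>v\<close> from the first by means of the shifted
  \<open>K\<close>, and then \<open>w\<close> by means of \<open>K\<close>, leaves
  \<open>F\<close>.\<close>

definition "F x y = A1 + A2 * y + A3 * x + x * y * (A7 + A4 * x + A5 * y + A6 * x * y)"
definition "K x y w = n * (1 - c3) * y * w * (1 + x) + (n - d4) * y + n * (1 - c1) * x * y - d4 * (1 - c0)"

lemmas A_defs = A1_def A2_def A3_def A4_def A5_def A6_def A7_def

lemma cc: "c0 = d0 * d1 / n" "c1 = d1 * d2 / n" "c2 = d2 * d3 / n" "c3 = d3 * d4 / n" "c4 = d4 * d0 / n"
  using c n by (auto simp: field_simps)

end

text \<open>\<open>sh\<close> is the Frobenius twist of the curve: every index moves on by one, as
  \<open>z\<close> becomes \<open>z ^ q\<close>.\<close>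

locale curve_shift = curve_coeffs +
  sh: curve_coeffs n d1 d2 d3 d4 d0 c1 c2 c3 c4 c0
begin

definition "S x y w = (A4 + A6 * y) * x - (sh.A5 + sh.A6 * y) * w - (1 - c1) * (d3 - d0)"

text \<open>Over the curve \<open>F x y = 0\<close>, the two roots \<open>w\<close> of \<open>sh.F y w = 0\<close> are
  those of \<open>K x y w = 0\<close> and of \<open>S x y w = 0\<close>.\<close>

lemma K_S: "K x y w * S x y w + n * (1 - c3) * (1 + x) * sh.F y w
    = n * ((1 - c3) * w + (1 - c1)) * F x y"
  unfolding K_def S_def F_def sh.F_def A_defs sh.A_defs unfolding cc using n
  by (simp add: divide_simps) Groebner_Basis.algebra

text \<open>This is \<open>K_S\<close> differentiated in \<open>x\<close>. Where \<open>S\<close>,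
  the twisted \<open>F\<close> and the \<open>x\<close>-derivative of \<open>F\<close> vanish, it
  leaves \<open>K x y w * (A4 + A6 * y) = 0\<close>.\<close>

lemma K_S_deriv:
  "(n * (1 - c3) * y * w + n * (1 - c1) * y) * S x y w + K x y w * (A4 + A6 * y) + n * (1 - c3) * sh.F y w
    = n * ((1 - c3) * w + (1 - c1)) * (A3 + A7 * y + A5 * y ^ 2 + 2 * x * y * (A4 + A6 * y))"
  unfolding K_def S_def F_def sh.F_def A_defs sh.A_defs unfolding cc using n
  by (simp add: divide_simps) Groebner_Basis.algebra

text \<open>The large bracket is the wanted equation after the shifted \<open>K\<close> has removed
  the fourth variable; so \<open>F = K = 0\<close> and the vanishing of the shifted \<open>K\<close>
  bring that equation back, up to nonzero factors.\<close>

lemma F_eq: "n * d4 * F x y = n * (1 - c3) * y * (1 + x)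
      * (n * (1 - c4) * ((1 + x) * (1 + w) - c1 * x) + d4 * x * (d0 * (1 - c1) - (n - d0) * w - n * (1 - c2) * y * w))
    - (n * (1 - c4) * (1 + x) - d4 * x * (n - d0) - d4 * x * n * (1 - c2) * y) * K x y w"
  unfolding K_def F_def A_defs unfolding cc using n
  by (simp add: divide_simps) Groebner_Basis.algebra

text \<open>The three equations for \<open>y\<close> say that \<open>F\<close> vanishes identically
  in \<open>x\<close>, so the curve contains a line of constant \<open>y\<close>. Probing
  \<open>K_S\<close> at \<open>w = 0\<close> then forces a coincidence that distinct conjugates
  exclude.\<close>

lemma vertical_component:
  assumes ne: "1 - c0 \<noteq> 0" "1 - c1 \<noteq> 0" "1 - c3 \<noteq> 0" "1 - c4 \<noteq> 0" "1 - d3 \<noteq> 0"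
    and y: "A1 + A2 * y = 0" "A4 + A6 * y = 0" "A3 + A7 * y + A5 * y ^ 2 = 0"
  shows "d0 = d3 \<or> c1 = c3"
proof (rule ccontr)
  assume *: "\<not> ?thesis"
  \<comment> \<open>Chosen so that \<open>K x y 0\<close> becomes a multiple of
    \<open>(1 - d3) * y + (1 - c0)\<close>, which is zero by \<open>A1 + A2 * y = 0\<close>.\<close>
  define x where "x = - (1 - c3) / (1 - c1)"
  have x: "(1 - c1) * x = - (1 - c3)" "1 + x \<noteq> 0" using * ne by (auto simp: x_def field_simps)
  have yy: "(1 - d3) * y = - (1 - c0)"
    using y(1) ne unfolding A_defs by Groebner_Basis.algebra
  have "F x y = 0" using y unfolding F_def by Groebner_Basis.algebra
  moreover have "K x y 0 = 0"
  proof -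
    have "K x y 0 = (n - d4) * y + n * y * ((1 - c1) * x) - d4 * (1 - c0)" by (simp add: K_def)
    also have "\<dots> = - d4 * ((1 - d3) * y + (1 - c0))" unfolding x(1) using c by Groebner_Basis.algebra
    finally show ?thesis using yy by simp
  qed
  ultimately have "sh.F y 0 = 0" using K_S[of x y 0] n ne x by simp
  then have "(1 - c1) * ((1 - c0) + (1 - d0) * y) = 0" unfolding sh.F_def sh.A_defs by (simp add: algebra_simps)
  then have "(1 - c0) + (1 - d0) * y = 0" using ne by simp
  then have "(d0 - d3) * y = 0" using yy by Groebner_Basis.algebra
  then show False using * yy ne by auto
qed

text \<open>The conditions on \<open>m\<close> make \<open>F\<close> split as
  \<open>(x * y - e) * (M - m)\<close>, where \<open>M\<close> is the bilinear factor in
  \<open>F\<close>: the second way in which \<open>M\<close> can be constant on a component.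
  Evaluating \<open>K_S\<close> on the other component \<open>x * y = e\<close> gives relations that
  Frobenius later refutes.\<close>

lemma hyperbola_component:
  assumes ne: "1 - c0 \<noteq> 0" "1 - c1 \<noteq> 0" "1 - c2 \<noteq> 0" "1 - c3 \<noteq> 0" "1 - c4 \<noteq> 0" "1 - d3 \<noteq> 0" "1 - d4 \<noteq> 0"
      "n - d3 \<noteq> 0" "n - d4 \<noteq> 0"
    and m: "A3 * A6 = A4 * m" "A1 * A5 + A2 * (m - A7) = 0" "A2 * A4 = A3 * A5"
  shows "(n - d4) * (1 - d4) = n * (1 - c1) * (1 - c3) \<or>
    ((n - d4) * (n - d3) = - n * (1 - c3) * (1 - d0) \<and> (n - d0) * (n - d4) = - n * (1 - d3) * (1 - c4))"
proof -
  have A: "A2 \<noteq> 0" "A3 \<noteq> 0" "A4 \<noteq> 0" "A5 \<noteq> 0" using ne by (simp_all add: A_defs)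
  define e where "e = - A3 / A4"
  have e1: "e * A4 = - A3" using A by (simp add: e_def)
  have e2: "e * A5 = - A2" using A m(3) by (simp add: e_def field_simps)
  have "e \<noteq> 0" using A by (simp add: e_def)
  have m': "m = - e * A6" using m(1) A by (simp add: e_def field_simps)
  have "A2 * (A1 + e * A7 + A6 * e ^ 2) = 0"
    using m(2) e2 unfolding m' by Groebner_Basis.algebra
  then have e3: "A1 + e * A7 + A6 * e ^ 2 = 0" using A by simp
  have F0: "F x y = 0" if "x * y = e" for x y
  proof -
    have "F x y = (A1 + e * A7 + A6 * e ^ 2) + (A2 + e * A5) * y + (A3 + e * A4) * x"
      unfolding F_def using that[symmetric] by Groebner_Basis.algebra
    then show ?thesis using e1 e2 e3 by simp
  qed
  define r where "r = n * (1 - c1) * e - d4 * (1 - c0)"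
  have e1': "e * ((n - d3) * (1 - c1)) = - (1 - d4) * (1 - c0)" using e1 unfolding A_defs by Groebner_Basis.algebra
  have e2': "e * ((n - d4) * (1 - c2)) = - (1 - d3) * (1 - c4)" using e2 unfolding A_defs by Groebner_Basis.algebra
  have r: "(1 - d4) * r = n * (1 - c3) * e * (1 - c1)"
    unfolding r_def using e1' c(4) by Groebner_Basis.algebra
  have r0: "r \<noteq> 0" using r ne n \<open>e \<noteq> 0\<close> by auto
  show ?thesis
  proof (cases "r = (n - d4) * e")
    case True
    then have "e * ((n - d4) * (1 - d4) - n * (1 - c1) * (1 - c3)) = 0" using r by Groebner_Basis.algebra
    then show ?thesis using \<open>e \<noteq> 0\<close> by simp
  next
    case False
    \<comment> \<open>At \<open>x = -1\<close> the term of \<open>K_S\<close> with the twisted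
      \<open>F\<close> drops out and \<open>K\<close> does not depend on \<open>w\<close>; hence
      \<open>S\<close> vanishes for every \<open>w\<close>.\<close>
    have "K (-1) (- e) w = r - (n - d4) * e" for w by (simp add: K_def r_def algebra_simps)
    then have S0: "S (-1) (- e) w = 0" for w
      using K_S[of "-1" "-e" w] F0[of "-1" "-e"] False by simp
    have "S (-1) (- e) 0 - S (-1) (- e) 1 = sh.A5 - sh.A6 * e" by (simp add: S_def algebra_simps)
    then have "sh.A5 = sh.A6 * e" by (simp add: S0)
    then have "(1 - c3) * ((n - d0) - n * (1 - c2) * e) = 0" unfolding sh.A_defs by Groebner_Basis.algebra
    then have "n - d0 = n * (1 - c2) * e" using ne by simp
    then have *: "(n - d0) * (n - d4) = - n * (1 - d3) * (1 - c4)" using e2' by Groebner_Basis.algebra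
    \<comment> \<open>This is the point of the hyperbola with \<open>K x y 0 = 0\<close>, so the
      twisted curve must pass through \<open>(y, 0)\<close>.\<close>
    define x where "x = - (n - d4) * e / r"
    have x: "x * r = - (n - d4) * e" "x \<noteq> 0" using r0 ne \<open>e \<noteq> 0\<close> by (auto simp: x_def)
    have "x \<noteq> -1" using x(1) False by (auto simp: algebra_simps)
    then have x1: "1 + x \<noteq> 0" by (metis add.inverse_unique minus_equation_iff)
    define y where "y = e / x"
    have xy: "x * y = e" using x by (simp add: y_def)
    have "x * K x y 0 = (n - d4) * (x * y) + x * (n * (1 - c1) * (x * y) - d4 * (1 - c0))"
      by (simp add: K_def algebra_simps)
    also have "\<dots> = 0" using x(1) unfolding xy r_def by Groebner_Basis.algebra
    finally have "K x y 0 = 0" using x by simp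
    then have "sh.F y 0 = 0" using K_S[of x y 0] F0[OF xy] n ne x1 by simp
    then have "(1 - c1) * ((1 - c0) + (1 - d0) * y) = 0" unfolding sh.F_def sh.A_defs by (simp add: algebra_simps)
    then have "(1 - c0) + (1 - d0) * y = 0" using ne by simp
    then have "(1 - c0) * x + (1 - d0) * e = 0" using xy by Groebner_Basis.algebra
    then have "e * (- (1 - c0) * (n - d4) + (1 - d0) * r) = 0" using x(1) by Groebner_Basis.algebra
    then have "- (1 - c0) * (n - d4) + (1 - d0) * r = 0" using \<open>e \<noteq> 0\<close> by simp
    then have "(1 - d0) * r = (1 - c0) * (n - d4)" by Groebner_Basis.algebra
    then have "(1 - d0) * (n * (1 - c3) * e * (1 - c1)) = (1 - d4) * ((1 - c0) * (n - d4))"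
      unfolding r[symmetric] by Groebner_Basis.algebra
    then have "(1 - d4) * (1 - c0) * ((1 - d0) * n * (1 - c3) + (n - d4) * (n - d3)) = 0"
      using e1' by Groebner_Basis.algebra
    then show ?thesis using * ne by (simp add: eq_neg_iff_add_eq_0 mult.commute add.commute mult.left_commute)
  qed
qed

end

section \<open>Frobenius points of the curve attached to an element outside the subfield\<close>

lemma power_frob_pow: "(x ^ (q ^ i)) ^ (q ^ j) = (x::'a::monoid_mult) ^ (q ^ (i + j))"
  by (simp add: power_add flip: power_mult)

text \<open>The period 5 is prime, so an equality of conjugates at distance \<open>k\<close>
  propagates in steps of \<open>k\<close> until it reaches neighbours.\<close>

lemma frob_orbit_distinct:
  fixes \<delta> :: "'a::field" and q :: nat
  assumes per: "\<delta> ^ (q ^ 5) = \<delta>" and nfix: "\<delta> ^ q \<noteq> \<delta>" and k: "0 < k" "k < 5"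
  shows "\<delta> ^ (q ^ i) \<noteq> \<delta> ^ (q ^ (i + k))"
proof
  define d where "d i = \<delta> ^ (q ^ i)" for i
  assume eq: "\<delta> ^ (q ^ i) = \<delta> ^ (q ^ (i + k))"
  have dd: "d j ^ (q ^ l) = d (j + l)" for j l
    by (simp add: d_def power_frob_pow)
  have d5: "d (j + 5) = d j" for j
    using dd[of 5 j] dd[of 0 j] per by (simp add: d_def add.commute)
  have d5k: "d (j + 5 * l) = d j" for j l
    by (induction l) (simp, metis add.assoc d5 mult_Suc_right add.commute)
  have "d i = d (i + k)" using eq by (simp add: d_def)
  then have "d (i + (4 * i + j)) = d (i + k + (4 * i + j))" for j using dd by metis
  then have step: "d j = d (j + k)" for j
    using d5k[of j i] d5k[of "j + k" i] by (simp add: algebra_simps)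
  have "d 0 = d k" "d k = d (k + k)" "d (k + k) = d (k + k + k)" "d (k + k + k) = d (k + k + k + k)"
    using step[of 0] step[of k] step[of "k + k"] step[of "k + k + k"] by simp_all
  moreover have "k = 1 \<or> k = 2 \<or> k = 3 \<or> k = 4" using k by arith
  ultimately have "d 0 = d 1" using d5[of 1] d5[of 3] d5k[of 1 3] d5k[of 1 1] d5k[of 2 2] d5[of 3]
    by (elim disjE) (auto simp: numeral_eq_Suc)
  then show False using nfix by (simp add: d_def)
qed

text \<open>For \<open>\<delta>\<close> outside the subfield the conjugates are distinct and factors
  such as \<open>1 - c0\<close> or \<open>n - d3\<close> are nonzero. This excludes components with
  constant \<open>M\<close>, so \<open>biquadratic_frobenius_point\<close> applies.\<close>

lemma curve_frobenius_point:
  fixes \<delta> n :: "'a::alg_closed_field" and q :: nat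
  assumes q: "2 \<le> q" "of_nat q = (0 :: 'a)" and fadd: "\<And>x y :: 'a. (x + y) ^ q = x ^ q + y ^ q"
    and per: "\<delta> ^ (q ^ 5) = \<delta>" and nfix: "\<delta> ^ q \<noteq> \<delta>" and nn: "n ^ q = n" "n \<noteq> 0"
  shows "\<exists>z. n * (z * z ^ q * z ^ (q ^ 2) * z ^ (q ^ 3) * z ^ (q ^ 4)) = 1 \<and>
    (1 + z) * (1 + z ^ (q ^ 2)) + \<delta> ^ (q ^ 4) * z * z ^ (q ^ 2) * z ^ (q ^ 3) * (1 + z ^ q)
      = \<delta> ^ q * \<delta> ^ (q ^ 2) / n * z"
proof -
  have fsub: "(x - y) ^ q = x ^ q - y ^ q" for x y :: 'a
    using fadd[of "x - y" y] by (simp add: algebra_simps)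
  have f2: "(2 :: 'a) ^ q = 2" using fadd[of 1 1] by simp
  have fz: "(0 :: 'a) ^ q = 0" using q by simp
  note fr = fadd fsub f2 power_mult_distrib power_divide
  have dist: "\<delta> ^ (q ^ i) \<noteq> \<delta> ^ (q ^ (i + k))" if "0 < k" "k < 5" for i k
    using frob_orbit_distinct[OF per nfix that] .
  define d0 d1 d2 d3 d4 where d: "d0 = \<delta>" "d1 = \<delta> ^ q" "d2 = \<delta> ^ (q ^ 2)" "d3 = \<delta> ^ (q ^ 3)" "d4 = \<delta> ^ (q ^ 4)"
  have df: "d0 ^ q = d1" "d1 ^ q = d2" "d2 ^ q = d3" "d3 ^ q = d4" "d4 ^ q = d0"
    using per by (simp_all add: d numeral_eq_Suc mult.commute flip: power_mult)
  have dne: "d0 \<noteq> d1" "d0 \<noteq> d2" "d0 \<noteq> d3" "d0 \<noteq> d4" "d1 \<noteq> d3"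
    using dist[of 1 0] dist[of 2 0] dist[of 3 0] dist[of 4 0] dist[of 2 1] by (simp_all add: d numeral_eq_Suc)
  define c0 c1 c2 c3 c4 where cd: "c0 = d0 * d1 / n" "c1 = d1 * d2 / n" "c2 = d2 * d3 / n" "c3 = d3 * d4 / n" "c4 = d4 * d0 / n"
  have cf: "c0 ^ q = c1" "c1 ^ q = c2" "c2 ^ q = c3" "c3 ^ q = c4" "c4 ^ q = c0"
    by (simp_all add: cd fr df nn)
  have d00: "d0 \<noteq> 0" using nfix q by (auto simp: d)
  have dz: "d1 \<noteq> 0" "d2 \<noteq> 0" "d3 \<noteq> 0" "d4 \<noteq> 0" using d00 by (simp_all add: d)
  have cne1: "c0 \<noteq> c1"
    using dne(2) dz nn by (auto simp: cd)
  have cne2: "c1 \<noteq> c3"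
  proof
    assume "c1 = c3"
    then have "c2 = c4" "c3 = c0" using cf by metis+
    then show False using \<open>c1 = c3\<close> cne1 by simp
  qed
  have c1s: "1 - c0 \<noteq> 0" "1 - c1 \<noteq> 0" "1 - c2 \<noteq> 0" "1 - c3 \<noteq> 0" "1 - c4 \<noteq> 0"
    using cne1 cf by (metis eq_iff_diff_eq_0 power_one)+
  have d1s: "1 - d0 \<noteq> 0" "1 - d3 \<noteq> 0" "1 - d4 \<noteq> 0"
    using dne(1) df by (metis eq_iff_diff_eq_0 power_one)+
  have dns: "n - d3 \<noteq> 0" "n - d4 \<noteq> 0" "n - d0 \<noteq> 0"
    using dne(1) df nn(1) by (metis eq_iff_diff_eq_0)+
  interpret curve_shift n d0 d1 d2 d3 d4 c0 c1 c2 c3 c4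
    by unfold_locales (use nn in \<open>auto simp: cd\<close>)
  note nz = nn(2) c1s d1s dns d00 dz
  have Af: "A1 ^ q = sh.A1" "A2 ^ q = sh.A2" "A3 ^ q = sh.A3" "A4 ^ q = sh.A4" "A5 ^ q = sh.A5" "A6 ^ q = sh.A6"
      "A7 ^ q = sh.A7"
    by (simp_all add: A_defs sh.A_defs fr df cf nn)
  have Ff: "F x y ^ q = sh.F (x ^ q) (y ^ q)" for x y
    by (simp add: F_def sh.F_def fr Af)
  let ?K = "\<lambda>z. K z (z ^ q) (z ^ (q ^ 2)) = 0"
  have zq: "(z ^ q) ^ q = z ^ (q ^ 2)" "(z ^ (q ^ 2)) ^ q = z ^ (q ^ 3)" "(z ^ (q ^ 3)) ^ q = z ^ (q ^ 4)" for z :: 'a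
    by (simp_all add: numeral_eq_Suc mult.commute flip: power_mult)
  have shF: "sh.F (z ^ q) (z ^ (q ^ 2)) = 0" if "F z (z ^ q) = 0" for z
    using Ff[of z "z ^ q"] that fz zq by simp
  have novert: False if "A1 + A2 * y = 0" "A4 + A6 * y = 0" "A3 + A7 * y + A5 * y ^ 2 = 0" for y
    using vertical_component[OF _ _ _ _ _ that] nz cne2 dne by blast
  have "\<exists>z. A1 + A2 * z ^ q + A3 * z + z * z ^ q * (A7 + A4 * z + A5 * z ^ q + A6 * z * z ^ q) = 0 \<and> ?K z"
  \<comment> \<open>The constant comes from rewriting \<open>S = 0\<close>: by exactly this amount
    the \<open>q\<close>-th power of \<open>M\<close> at \<open>(z, z ^ q)\<close> then differs from
    \<open>M\<close>.\<close>
  proof (rule biquadratic_frobenius_point[where \<beta> = "sh.A7 - A7 - (1 - c1) * (d3 - d0)"])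
    show "2 \<le> q" "of_nat q = (0 :: 'a)" by fact+
    show "A6 \<noteq> 0 \<or> A5 \<noteq> 0" using nz by (simp add: A_defs)
  next
    fix m assume m: "A3 * A6 = A4 * m" "A1 * A5 + A2 * (m - A7) = 0"
    show "A1 * A6 + A3 * A5 - A2 * A4 + m * (m - A7) \<noteq> 0"
    proof
      assume m3: "A1 * A6 + A3 * A5 - A2 * A4 + m * (m - A7) = 0"
      have novert': "A2 * A4 \<noteq> A1 * A6"
      proof
        assume A: "A2 * A4 = A1 * A6"
        define y where "y = - A1 / A2"
        have A0: "A1 \<noteq> 0" "A2 \<noteq> 0" "A4 \<noteq> 0" "A6 \<noteq> 0" using nz by (simp_all add: A_defs)
        have y: "A2 * y = - A1" "y \<noteq> 0" using A0 by (simp_all add: y_def)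
        have 1: "A1 + A2 * y = 0" using y by simp
        have "A2 * (A4 + A6 * y) = A2 * A4 + A6 * (A2 * y)" by (simp add: algebra_simps)
        then have "A2 * (A4 + A6 * y) = 0" by (simp add: A y)
        then have 2: "A4 + A6 * y = 0" using A0 by simp
        have "A6 * (A3 + m * y) = A3 * A6 - A4 * m + m * (A4 + A6 * y)" by (simp add: algebra_simps)
        then have "A6 * (A3 + m * y) = 0" using m(1) 2 by simp
        then have 3: "A3 + m * y = 0" using A0 by simp
        have "A2 * (- A5 * y + (m - A7)) = A2 * (m - A7) - A5 * (A2 * y)" by (simp add: algebra_simps)
        also have "\<dots> = A1 * A5 + A2 * (m - A7)" unfolding y(1) by (simp add: algebra_simps)
        finally have "A2 * (- A5 * y + (m - A7)) = 0" using m(2) by simp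
        then have "- A5 * y + (m - A7) = 0" using A0 by simp
        then have "A7 + A5 * y = m" by (simp add: algebra_simps)
        moreover have "A3 + A7 * y + A5 * y ^ 2 = A3 + (A7 + A5 * y) * y"
          by (simp add: algebra_simps power2_eq_square)
        ultimately have "A3 + A7 * y + A5 * y ^ 2 = 0" using 3 by simp
        then show False using novert 1 2 by blast
      qed
      \<comment> \<open>In plain variables: if all three coefficients of the fibre equation vanish,
        the common component of \<open>M = m\<close> and the curve is a line of constant
        \<open>y\<close> (first factor) or all of \<open>M = m\<close> (second factor).\<close>
      have "(x2 * x4 - x1 * x6) * (x2 * x4 - x3 * x5) = 0"
        if "x3 * x6 = x4 * m" "x1 * x5 + x2 * (m - x7) = 0" "x1 * x6 + x3 * x5 - x2 * x4 + m * (m - x7) = 0"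
        for x1 x2 x3 x4 x5 x6 x7 :: 'a using that by Groebner_Basis.algebra
      from this[OF m m3] have "(A2 * A4 - A1 * A6) * (A2 * A4 - A3 * A5) = 0" .
      then have A: "A2 * A4 = A3 * A5" using novert' by simp
      from hyperbola_component[OF _ _ _ _ _ _ _ _ _ m A] nz
      have "(n - d4) * (1 - d4) = n * (1 - c1) * (1 - c3) \<or>
        ((n - d4) * (n - d3) = - n * (1 - c3) * (1 - d0) \<and> (n - d0) * (n - d4) = - n * (1 - d3) * (1 - c4))"
        by blast
      then show False
      proof
        assume "(n - d4) * (1 - d4) = n * (1 - c1) * (1 - c3)"
        \<comment> \<open>Four Frobenius steps carry \<open>d4\<close> to \<open>d3\<close>; the
          equation reached is \<open>A2 * A4 = A1 * A6\<close> with its common factors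
          removed.\<close>
        then have "((n - d4) * (1 - d4)) ^ q = (n * (1 - c1) * (1 - c3)) ^ q" by simp
        then have 0: "(n - d0) * (1 - d0) = n * (1 - c2) * (1 - c4)" by (simp add: fr df cf nn)
        then have "((n - d0) * (1 - d0)) ^ q = (n * (1 - c2) * (1 - c4)) ^ q" by simp
        then have "(n - d1) * (1 - d1) = n * (1 - c3) * (1 - c0)" by (simp add: fr df cf nn)
        then have "((n - d1) * (1 - d1)) ^ q = (n * (1 - c3) * (1 - c0)) ^ q" by simp
        then have "(n - d2) * (1 - d2) = n * (1 - c4) * (1 - c1)" by (simp add: fr df cf nn)
        then have "((n - d2) * (1 - d2)) ^ q = (n * (1 - c4) * (1 - c1)) ^ q" by simp
        then have "(n - d3) * (1 - d3) = n * (1 - c0) * (1 - c2)" by (simp add: fr df cf nn)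
        then have "A2 * A4 = A1 * A6" unfolding A_defs by Groebner_Basis.algebra
        then show False using novert' by blast
      next
        assume *: "(n - d4) * (n - d3) = - n * (1 - c3) * (1 - d0) \<and> (n - d0) * (n - d4) = - n * (1 - d3) * (1 - c4)"
        then have "(n - d4) * (n - d3) = n * (1 - c3) * (d0 - 1)" by Groebner_Basis.algebra
        then have "((n - d4) * (n - d3)) ^ q = (n * (1 - c3) * (d0 - 1)) ^ q" by simp
        then have "(n - d0) * (n - d4) = n * (1 - c4) * (d1 - 1)" by (simp add: fr df cf nn)
        then have "n * (1 - c4) * (d1 - d3) = 0" using * by Groebner_Basis.algebra
        then show False using nz dne by simp
      qed
    qed
  next
    fix z assume "A1 + A2 * z ^ q + A3 * z + z * z ^ q * (A7 + A4 * z + A5 * z ^ q + A6 * z * z ^ q) = 0"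
    then have F0: "F z (z ^ q) = 0" by (simp add: F_def)
    assume "\<not> ?K z"
    then have S0: "S z (z ^ q) (z ^ (q ^ 2)) = 0"
      using K_S[of z "z ^ q" "z ^ (q ^ 2)"] F0 shF[OF F0] by simp
    have B4: "sh.A4 = A5" by (simp add: A_defs sh.A_defs)
    have "(A7 + A4 * z + A5 * z ^ q + A6 * z * z ^ q) ^ q =
      sh.A7 + sh.A4 * z ^ q + (sh.A5 + sh.A6 * z ^ q) * z ^ (q ^ 2)"
      by (simp add: fr Af zq algebra_simps)
    also have "\<dots> = A7 + A4 * z + A5 * z ^ q + A6 * z * z ^ q + (sh.A7 - A7 - (1 - c1) * (d3 - d0)) - S z (z ^ q) (z ^ (q ^ 2))"
      unfolding S_def B4 by (simp add: algebra_simps)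
    finally show "(A7 + A4 * z + A5 * z ^ q + A6 * z * z ^ q) ^ q =
        A7 + A4 * z + A5 * z ^ q + A6 * z * z ^ q + (sh.A7 - A7 - (1 - c1) * (d3 - d0))"
      by (simp add: S0)
  next
    fix z assume "A1 + A2 * z ^ q + A3 * z + z * z ^ q * (A7 + A4 * z + A5 * z ^ q + A6 * z * z ^ q) = 0"
    then have F0: "F z (z ^ q) = 0" by (simp add: F_def)
    assume Fx: "A3 + A7 * z ^ q + A5 * (z ^ q) ^ 2 + 2 * z * z ^ q * (A4 + A6 * z ^ q) = 0"
    show "?K z"
    proof (rule ccontr)
      assume K: "\<not> ?K z"
      then have S0: "S z (z ^ q) (z ^ (q ^ 2)) = 0"
        using K_S[of z "z ^ q" "z ^ (q ^ 2)"] F0 shF[OF F0] by simp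
      have 2: "A4 + A6 * z ^ q = 0"
        using K_S_deriv[of "z ^ q" "z ^ (q ^ 2)" z] S0 K shF[OF F0] Fx by simp
      then have 3: "A3 + A7 * z ^ q + A5 * (z ^ q) ^ 2 = 0" using Fx by simp
      have "F z (z ^ q) = A1 + A2 * z ^ q + z * (A3 + A7 * z ^ q + A5 * (z ^ q) ^ 2) + z * z ^ q * z * (A4 + A6 * z ^ q)"
        by (simp add: F_def algebra_simps power2_eq_square)
      then have "A1 + A2 * z ^ q = 0" using F0 2 3 by simp
      then show False using novert 2 3 by blast
    qed
  qed
  then obtain z where F0: "F z (z ^ q) = 0" and K0: "?K z" by (auto simp: F_def)
  define z1 z2 z3 z4 where z: "z1 = z ^ q" "z2 = z ^ (q ^ 2)" "z3 = z ^ (q ^ 3)" "z4 = z ^ (q ^ 4)"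
  have zf: "z1 ^ q = z2" "z2 ^ q = z3" "z3 ^ q = z4" by (simp_all add: z zq)
  have zfold: "z ^ q = z1" by (simp add: z)
  have "z \<noteq> 0"
  proof
    assume "z = 0"
    then have "A1 = 0" using F0 fz by (simp add: F_def)
    then show False using nz by (simp add: A_defs)
  qed
  then have z0: "z1 \<noteq> 0" "z2 \<noteq> 0" "z3 \<noteq> 0" "z4 \<noteq> 0" by (simp_all add: z)
  have K0': "K z z1 z2 = 0" using K0 by (simp add: z)
  have K1: "sh.K z1 z2 z3 = 0"
  proof -
    have "K z z1 z2 ^ q = sh.K (z ^ q) z2 z3" by (simp add: K_def sh.K_def fr df cf nn zf)
    then show ?thesis using K0' fz zfold by simp
  qed
  \<comment> \<open>\<open>F_eq\<close> yields the wanted equation only after division by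
    \<open>1 + z\<close>.\<close>
  have zm1: "1 + z \<noteq> 0"
  proof
    assume "1 + z = 0"
    then have zz: "z = -1" by (simp add: eq_neg_iff_add_eq_0 add.commute)
    have "(-1) ^ q = (-1 :: 'a)" using fsub[of 0 1] fz by simp
    then have "z1 = -1" "z2 = -1" using zf zfold zz by auto
    then have "d4 * c0 = n * c1" using K0' zz by (simp add: K_def algebra_simps)
    then have e1: "n * d2 = d4 * d0" using nz by (simp add: cd field_simps)
    then have "(n * d2) ^ q = (d4 * d0) ^ q" by simp
    then have e2: "n * d3 = d0 * d1" by (simp add: fr df nn)
    then have "(n * d3) ^ q = (d0 * d1) ^ q" by simp
    then have e3: "n * d4 = d1 * d2" by (simp add: fr df nn)
    then have "(n * d4) ^ q = (d1 * d2) ^ q" by simp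
    then have e4: "n * d0 = d2 * d3" by (simp add: fr df nn)
    have "n * (n * d0) = d4 * d0 * d3" using e4 e1 by Groebner_Basis.algebra
    then have "n * n = d3 * d4" using d00 by (simp add: field_simps)
    then have "(n * n) ^ q = (d3 * d4) ^ q" by simp
    then have "n * n = d4 * d0" by (simp add: fr df nn)
    then have "n = d2" using e1 nn by (metis mult_left_cancel)
    then show False using nn df dne by metis
  qed
  have z1m1: "1 + z1 \<noteq> 0" "1 + z2 \<noteq> 0"
  proof -
    have "(1 + z) ^ q \<noteq> 0" "((1 + z) ^ q) ^ q \<noteq> 0" using zm1 by simp_all
    then show "1 + z1 \<noteq> 0" "1 + z2 \<noteq> 0" by (simp_all add: fr zfold zf)
  qed
  have Q1: "(1 + z) * (1 + z2) + d4 * z * z2 * z3 * (1 + z1) = c1 * z"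
  proof -
    have K1': "n * (1 - c4) * (z2 * z3 * (1 + z1)) = d0 * (1 - c1) - (n - d0) * z2 - n * (1 - c2) * z1 * z2"
      using K1 unfolding sh.K_def by Groebner_Basis.algebra
    have "n * (1 - c3) * z1 * (1 + z) * (n * (1 - c4) * ((1 + z) * (1 + z2) - c1 * z)
        + d4 * z * (n * (1 - c4) * (z2 * z3 * (1 + z1)))) = 0"
      using F_eq[of z z1 z2] F0 K0' unfolding K1' zfold by simp
    then have "n * (1 - c4) * ((1 + z) * (1 + z2) - c1 * z) + d4 * z * (n * (1 - c4) * (z2 * z3 * (1 + z1))) = 0"
      using nz z0 zm1 by simp
    then have "n * (1 - c4) * ((1 + z) * (1 + z2) + d4 * z * z2 * z3 * (1 + z1) - c1 * z) = 0"
      by (simp add: algebra_simps)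
    then show ?thesis using nz by simp
  qed
  \<comment> \<open>This is the inverse Frobenius image of \<open>Q1\<close> with the norm condition
    built in. Its own Frobenius image \<open>Q0'\<close>, multiplied by \<open>z\<close> and
    compared with \<open>Q1\<close>, releases the norm condition.\<close>
  have Q0: "(1 + n * z * z1 * z2 * z3) * (1 + z1) + d3 * z1 * z2 * (1 + z) = c0"
  proof -
    have "d4 * ((1 + n * z * z1 * z2 * z3) * (1 + z1) + d3 * z1 * z2 * (1 + z) - c0) = 0"
      using Q1 K0' c(4) unfolding K_def by Groebner_Basis.algebra
    then show ?thesis using nz by simp
  qed
  then have "((1 + n * z * z1 * z2 * z3) * (1 + z1) + d3 * z1 * z2 * (1 + z)) ^ q = c0 ^ q" by simp
  then have Q0': "(1 + n * z1 * z2 * z3 * z4) * (1 + z2) + d4 * z2 * z3 * (1 + z1) = c1"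
    by (simp add: fr df cf nn zf zfold)
  have "(n * z * z1 * z2 * z3 * z4 - 1) * (1 + z2) = 0"
    using Q1 Q0' by Groebner_Basis.algebra
  then have "n * z * z1 * z2 * z3 * z4 = 1" using z1m1 by simp
  then have "n * (z * z1 * z2 * z3 * z4) = 1" by (simp add: mult_ac)
  then show ?thesis using Q1 unfolding z d cd by blast
qed

text \<open>Serves kernels with a zero coordinate. The coefficients lie in the subfield and
  \<open>F\<close> is symmetric, so the curve is its own Frobenius twist and the root not belonging
  to \<open>K\<close> is simply \<open>w = x\<close>: such a \<open>z\<close> is fixed by the square
  of Frobenius, and its value of \<open>M\<close> by Frobenius itself.\<close>

lemma pentagon_frobenius_point:
  fixes \<beta> :: "'a::alg_closed_field" and q :: nat
  assumes q: "2 \<le> q" "of_nat q = (0 :: 'a)" and fadd: "\<And>x y :: 'a. (x + y) ^ q = x ^ q + y ^ q"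
    and b: "\<beta> ^ q = \<beta>" "\<beta> \<noteq> 0"
  shows "\<exists>z. \<beta> ^ 2 * (z * z ^ q * z ^ (q ^ 2) * z ^ (q ^ 3) * z ^ (q ^ 4)) = 1 \<and>
    z ^ q * (1 + \<beta> * z * z ^ (q ^ 2)) = 1"
proof -
  have fsub: "(x - y) ^ q = x ^ q - y ^ q" for x y :: 'a
    using fadd[of "x - y" y] by (simp add: algebra_simps)
  have fz: "(0 :: 'a) ^ q = 0" using q by simp
  note fr = fadd fsub power_mult_distrib b
  define F where "F x y = 1 - y - x + x * y * (1 - \<beta> + \<beta> * x + \<beta> * y)" for x y
  define K where "K x y w = y * (1 + \<beta> * x * w) - 1" for x y w
  have Ff: "F x y ^ q = F (x ^ q) (y ^ q)" for x y by (simp add: F_def fr)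
  have Kf: "K x y w ^ q = K (x ^ q) (y ^ q) (w ^ q)" for x y w by (simp add: K_def fr)
  have zq: "(z ^ q) ^ q = z ^ (q ^ 2)" "(z ^ (q ^ 2)) ^ q = z ^ (q ^ 3)" "(z ^ (q ^ 3)) ^ q = z ^ (q ^ 4)" for z :: 'a
    by (simp_all add: numeral_eq_Suc mult.commute flip: power_mult)
  have KS: "K x y w * (x - w) + x * F y w = w * F x y" for x y w
    unfolding K_def F_def by Groebner_Basis.algebra
  have F1: "F (z ^ q) (z ^ (q ^ 2)) = 0" if "F z (z ^ q) = 0" for z
    using Ff[of z "z ^ q"] that fz zq by simp
  have xw: "z = z ^ (q ^ 2)" if "F z (z ^ q) = 0" "K z (z ^ q) (z ^ (q ^ 2)) \<noteq> 0" for z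
    using KS[of z "z ^ q" "z ^ (q ^ 2)"] that F1[OF that(1)] by simp
  have "\<exists>z. 1 + (-1) * z ^ q + (-1) * z + z * z ^ q * (1 - \<beta> + \<beta> * z + \<beta> * z ^ q + 0 * z * z ^ q) = 0
      \<and> K z (z ^ q) (z ^ (q ^ 2)) = 0"
  proof (rule biquadratic_frobenius_point[where \<beta> = 0])
    show "2 \<le> q" "of_nat q = (0 :: 'a)" by fact+
    show "0 \<noteq> (0 :: 'a) \<or> \<beta> \<noteq> 0" using b by simp
    show "1 * 0 + -1 * \<beta> - -1 * \<beta> + m * (m - (1 - \<beta>)) \<noteq> 0"
      if "- 1 * 0 = \<beta> * m" "1 * \<beta> + - 1 * (m - (1 - \<beta>)) = 0" for m
      using that b by simp
  next
    fix z assume "1 + (-1) * z ^ q + (-1) * z + z * z ^ q * (1 - \<beta> + \<beta> * z + \<beta> * z ^ q + 0 * z * z ^ q) = 0"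
    then have F0: "F z (z ^ q) = 0" by (simp add: F_def)
    assume "K z (z ^ q) (z ^ (q ^ 2)) \<noteq> 0"
    from xw[OF F0 this] show "(1 - \<beta> + \<beta> * z + \<beta> * z ^ q + 0 * z * z ^ q) ^ q
       = 1 - \<beta> + \<beta> * z + \<beta> * z ^ q + 0 * z * z ^ q + 0"
      by (simp add: fr zq algebra_simps)
  next
    fix z assume "1 + (-1) * z ^ q + (-1) * z + z * z ^ q * (1 - \<beta> + \<beta> * z + \<beta> * z ^ q + 0 * z * z ^ q) = 0"
    then have F0: "F z (z ^ q) = 0" by (simp add: F_def)
    assume Fx: "-1 + (1 - \<beta>) * z ^ q + \<beta> * (z ^ q) ^ 2 + 2 * z * z ^ q * (\<beta> + 0 * z ^ q) = 0"
    \<comment> \<open>The derivative of \<open>KS\<close> in \<open>x\<close>.\<close>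
    have D: "\<beta> * y * w * (x - w) + K x y w + F y w = w * (-1 + (1 - \<beta>) * y + \<beta> * y ^ 2 + 2 * x * y * (\<beta> + 0 * y))"
      for x y w unfolding K_def F_def by Groebner_Basis.algebra
    show "K z (z ^ q) (z ^ (q ^ 2)) = 0"
    proof (rule ccontr)
      assume K: "K z (z ^ q) (z ^ (q ^ 2)) \<noteq> 0"
      from D[of "z ^ q" "z ^ (q ^ 2)" z] show False
        unfolding Fx F1[OF F0] using K xw[OF F0 K] by simp
    qed
  qed
  then obtain z where F0: "F z (z ^ q) = 0" and K0: "K z (z ^ q) (z ^ (q ^ 2)) = 0"
    by (auto simp: F_def)
  define z1 z2 z3 z4 where z: "z1 = z ^ q" "z2 = z ^ (q ^ 2)" "z3 = z ^ (q ^ 3)" "z4 = z ^ (q ^ 4)"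
  have zf: "z ^ q = z1" "z1 ^ q = z2" "z2 ^ q = z3" "z3 ^ q = z4" by (simp_all add: z zq)
  have "z \<noteq> 0" using F0 q(1) by (auto simp: F_def power_0_left)
  then have z0: "z1 \<noteq> 0" "z2 \<noteq> 0" by (simp_all add: z)
  have k0: "z1 * (1 + \<beta> * z * z2) = 1" using K0 by (simp add: z K_def)
  then have "(z1 * (1 + \<beta> * z * z2)) ^ q = 1 ^ q" by simp
  then have k1: "z2 * (1 + \<beta> * z1 * z3) = 1" by (simp add: fr zf)
  have f0: "1 - z1 - z + z * z1 * (1 - \<beta> + \<beta> * z + \<beta> * z1) = 0" using F0 by (simp add: z F_def)
  have "\<beta> * z * z1 * ((1 - z) * (1 - z2) - z1) = 0" using f0 k0 by Groebner_Basis.algebra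
  then have p0: "(1 - z) * (1 - z2) = z1" using b z0 \<open>z \<noteq> 0\<close> by simp
  have "1 - z2 = \<beta> * z1 * z2 * z3" using k1 by Groebner_Basis.algebra
  then have "(1 - z) * (\<beta> * z1 * z2 * z3) = z1" using p0 by simp
  then have "z1 * (\<beta> * z2 * z3 * (1 - z) - 1) = 0" by (simp add: algebra_simps)
  then have "\<beta> * z2 * z3 * (1 - z) = 1" using z0 by simp
  then have "(\<beta> * z2 * z3 * (1 - z)) ^ q = 1 ^ q" by simp
  then have "\<beta> * z3 * z4 * (1 - z1) = 1" by (simp add: fr zf)
  then have "\<beta> ^ 2 * (z * z1 * z2 * z3 * z4) = 1" using k0 by Groebner_Basis.algebra
  then show ?thesis using k0 unfolding z by blast
qed

text \<open>The pentagon equation for the other pair of generators, in a variable for which the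
  curve is again symmetric: under the norm condition,
  \<open>x = \<beta> ^ 2 * z * z ^ q * z ^ (q ^ 2)\<close> turns
  \<open>x ^ (q ^ 3) * (1 + \<beta> * x * x ^ q) = 1\<close> into the second equation here.\<close>

lemma pentagram_frobenius_point:
  fixes \<beta> :: "'a::alg_closed_field" and q :: nat
  assumes q: "2 \<le> q" "of_nat q = (0 :: 'a)" and fadd: "\<And>x y :: 'a. (x + y) ^ q = x ^ q + y ^ q"
    and b: "\<beta> ^ q = \<beta>" "\<beta> \<noteq> 0"
  shows "\<exists>z. \<beta> ^ 4 * (z * z ^ q * z ^ (q ^ 2) * z ^ (q ^ 3) * z ^ (q ^ 4)) = 1 \<and>
    1 + \<beta> ^ 5 * z * (z ^ q) ^ 2 * (z ^ (q ^ 2)) ^ 2 * z ^ (q ^ 3) = \<beta> ^ 2 * z ^ q * z ^ (q ^ 2)"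
proof -
  have fsub: "(x - y) ^ q = x ^ q - y ^ q" for x y :: 'a
    using fadd[of "x - y" y] by (simp add: algebra_simps)
  have fz: "(0 :: 'a) ^ q = 0" using q by simp
  have fpow: "(x ^ k) ^ q = (x ^ q) ^ k" for x :: 'a and k by (simp add: mult.commute flip: power_mult)
  note fr = fadd fsub power_mult_distrib b
  define F where "F x y = - 1 + \<beta> * y + \<beta> * x + x * y * (- (\<beta> ^ 2 + \<beta>) + \<beta> ^ 3 * x * y)" for x y
  define K where "K x y w = \<beta> ^ 3 * x * y ^ 2 * w + 1 - \<beta> * y" for x y w
  have fbeta: "(\<beta> ^ k) ^ q = \<beta> ^ k" for k by (simp add: fpow b)
  have fminus: "(- x) ^ q = - (x ^ q)" for x :: 'a using fsub[of 0 x] fz by simp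
  have Ff: "F x y ^ q = F (x ^ q) (y ^ q)" for x y
    by (simp add: F_def fr fbeta fminus)
  have Kf: "K x y w ^ q = K (x ^ q) (y ^ q) (w ^ q)" for x y w
    by (simp add: K_def fr fbeta fpow[of y])
  have zq: "(z ^ q) ^ q = z ^ (q ^ 2)" "(z ^ (q ^ 2)) ^ q = z ^ (q ^ 3)" "(z ^ (q ^ 3)) ^ q = z ^ (q ^ 4)" for z :: 'a
    by (simp_all add: numeral_eq_Suc mult.commute flip: power_mult)
  have KS: "K x y w * (x - w) + x * F y w = w * F x y" for x y w
    unfolding K_def F_def by Groebner_Basis.algebra
  have F1: "F (z ^ q) (z ^ (q ^ 2)) = 0" if "F z (z ^ q) = 0" for z
    using Ff[of z "z ^ q"] that fz zq by simp
  have xw: "z = z ^ (q ^ 2)" if "F z (z ^ q) = 0" "K z (z ^ q) (z ^ (q ^ 2)) \<noteq> 0" for z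
    using KS[of z "z ^ q" "z ^ (q ^ 2)"] that F1[OF that(1)] by simp
  have "\<exists>z. -1 + \<beta> * z ^ q + \<beta> * z + z * z ^ q * (- (\<beta> ^ 2 + \<beta>) + 0 * z + 0 * z ^ q + \<beta> ^ 3 * z * z ^ q) = 0
      \<and> K z (z ^ q) (z ^ (q ^ 2)) = 0"
  proof (rule biquadratic_frobenius_point[where \<beta> = 0])
    show "2 \<le> q" "of_nat q = (0 :: 'a)" by fact+
    show "\<beta> ^ 3 \<noteq> 0 \<or> 0 \<noteq> (0 :: 'a)" using b by simp
    show "-1 * \<beta> ^ 3 + \<beta> * 0 - \<beta> * 0 + m * (m - - (\<beta> ^ 2 + \<beta>)) \<noteq> 0"
      if "\<beta> * \<beta> ^ 3 = 0 * m" "-1 * 0 + \<beta> * (m - - (\<beta> ^ 2 + \<beta>)) = 0" for m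
      using that b by simp
  next
    fix z assume "-1 + \<beta> * z ^ q + \<beta> * z + z * z ^ q * (- (\<beta> ^ 2 + \<beta>) + 0 * z + 0 * z ^ q + \<beta> ^ 3 * z * z ^ q) = 0"
    then have F0: "F z (z ^ q) = 0" by (simp add: F_def)
    assume "K z (z ^ q) (z ^ (q ^ 2)) \<noteq> 0"
    from xw[OF F0 this] show "(- (\<beta> ^ 2 + \<beta>) + 0 * z + 0 * z ^ q + \<beta> ^ 3 * z * z ^ q) ^ q
       = - (\<beta> ^ 2 + \<beta>) + 0 * z + 0 * z ^ q + \<beta> ^ 3 * z * z ^ q + 0"
      by (simp add: fr fbeta fminus zq mult_ac)
  next
    fix z assume "-1 + \<beta> * z ^ q + \<beta> * z + z * z ^ q * (- (\<beta> ^ 2 + \<beta>) + 0 * z + 0 * z ^ q + \<beta> ^ 3 * z * z ^ q) = 0"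
    then have F0: "F z (z ^ q) = 0" by (simp add: F_def)
    assume Fx: "\<beta> + - (\<beta> ^ 2 + \<beta>) * z ^ q + 0 * (z ^ q) ^ 2 + 2 * z * z ^ q * (0 + \<beta> ^ 3 * z ^ q) = 0"
    have D: "\<beta> ^ 3 * y ^ 2 * w * (x - w) + K x y w + F y w
        = w * (\<beta> + - (\<beta> ^ 2 + \<beta>) * y + 0 * y ^ 2 + 2 * x * y * (0 + \<beta> ^ 3 * y))"
      for x y w unfolding K_def F_def by Groebner_Basis.algebra
    show "K z (z ^ q) (z ^ (q ^ 2)) = 0"
    proof (rule ccontr)
      assume K: "K z (z ^ q) (z ^ (q ^ 2)) \<noteq> 0"
      from D[of "z ^ q" "z ^ (q ^ 2)" z] show False
        unfolding Fx F1[OF F0] using K xw[OF F0 K] by simp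
    qed
  qed
  then obtain z where F0: "F z (z ^ q) = 0" and K0: "K z (z ^ q) (z ^ (q ^ 2)) = 0"
    by (auto simp: F_def)
  define z1 z2 z3 z4 where z: "z1 = z ^ q" "z2 = z ^ (q ^ 2)" "z3 = z ^ (q ^ 3)" "z4 = z ^ (q ^ 4)"
  have zf: "z ^ q = z1" "z1 ^ q = z2" "z2 ^ q = z3" "z3 ^ q = z4" by (simp_all add: z zq)
  have "z \<noteq> 0" using F0 q(1) by (auto simp: F_def power_0_left)
  then have z0: "z1 \<noteq> 0" "z2 \<noteq> 0" by (simp_all add: z)
  have k0: "\<beta> ^ 3 * z * z1 ^ 2 * z2 = \<beta> * z1 - 1" using K0 unfolding K_def z[symmetric] by Groebner_Basis.algebra
  then have "(\<beta> ^ 3 * z * z1 ^ 2 * z2) ^ q = (\<beta> * z1 - 1) ^ q" by simp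
  then have k1: "\<beta> ^ 3 * z1 * z2 ^ 2 * z3 = \<beta> * z2 - 1" by (simp add: fr fbeta fpow[of z1] zf)
  have f0: "- 1 + \<beta> * z1 + \<beta> * z + z * z1 * (- (\<beta> ^ 2 + \<beta>) + \<beta> ^ 3 * z * z1) = 0"
    using F0 by (simp add: z F_def)
  have "\<beta> * z * (\<beta> ^ 2 * z1 ^ 2 * (z + z2) - ((1 + \<beta>) * z1 - 1)) = 0" using f0 k0 by Groebner_Basis.algebra
  then have l0: "\<beta> ^ 2 * z1 ^ 2 * (z + z2) = (1 + \<beta>) * z1 - 1" using b \<open>z \<noteq> 0\<close> by simp
  then have "(\<beta> ^ 2 * z1 ^ 2 * (z + z2)) ^ q = ((1 + \<beta>) * z1 - 1) ^ q" by simp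
  then have l1: "\<beta> ^ 2 * z2 ^ 2 * (z1 + z3) = (1 + \<beta>) * z2 - 1" by (simp add: fr fbeta fpow[of z1] zf)
  have "\<beta> * z1 ^ 2 * ((\<beta> * z - 1) * (\<beta> * z2 - 1) - \<beta> ^ 2 * z * z1 * z2) = 0" using k0 l0 by Groebner_Basis.algebra
  then have p0: "(\<beta> * z - 1) * (\<beta> * z2 - 1) = \<beta> ^ 2 * z * z1 * z2" using b z0 by simp
  have "\<beta> ^ 2 * z1 * z2 * (\<beta> * z2 * z3 * (\<beta> * z - 1) - z) = 0" using p0 k1 by Groebner_Basis.algebra
  then have "\<beta> * z2 * z3 * (\<beta> * z - 1) = z" using b z0 by simp
  then have "(\<beta> * z2 * z3 * (\<beta> * z - 1)) ^ q = z ^ q" by simp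
  then have "\<beta> * z3 * z4 * (\<beta> * z1 - 1) = z1" by (simp add: fr zf)
  then have "\<beta> * z3 * z4 * (\<beta> ^ 3 * z * z1 ^ 2 * z2) = z1" unfolding k0 .
  then have "z1 * (\<beta> ^ 4 * (z * z1 * z2 * z3 * z4) - 1) = 0"
    by (simp add: algebra_simps power2_eq_square numeral_eq_Suc)
  then have n0: "\<beta> ^ 4 * (z * z1 * z2 * z3 * z4) = 1" using z0 by simp
  have "z2 * (1 + \<beta> ^ 3 * z1 * z2 * z3 - \<beta> ^ 2 * z2 * z3 - \<beta> ^ 2 * z1 * z2) = 0" using l1 k1 by Groebner_Basis.algebra
  then have "1 + \<beta> ^ 3 * z1 * z2 * z3 - \<beta> ^ 2 * z2 * z3 - \<beta> ^ 2 * z1 * z2 = 0" using z0 by simp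
  then have "1 + \<beta> ^ 5 * z * z1 ^ 2 * z2 ^ 2 * z3 = \<beta> ^ 2 * z1 * z2" using k0 by Groebner_Basis.algebra
  then show ?thesis using n0 unfolding z by blast
qed

section \<open>The field of order $q^5$\<close>

locale quintic_field =
  fixes q :: nat and TYPE_a :: "'a::{field,finite} itself"
  assumes primepow_q: "primepow q" and card_field: "CARD('a) = q ^ 5"
begin

lemma q_char: "prime CHAR('a)" "\<exists>k. q = CHAR('a) ^ k"
proof -
  show 1: "prime CHAR('a)"
    using prime_CHAR_semidom[where 'a = 'a] finite_imp_CHAR_pos[where 'a = 'a] by simp
  obtain p k where pk: "prime p" "q = p ^ k" "k > 0" using primepow_q by (auto simp: primepow_def)
  have "CHAR('a) dvd p ^ (k * 5)" using CHAR_dvd_CARD[where 'a = 'a] card_field pk by (simp add: power_mult)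
  then have "CHAR('a) = p" using 1 pk by (meson prime_dvd_power primes_dvd_imp_eq)
  then show "\<exists>k. q = CHAR('a) ^ k" using pk by blast
qed

lemma q_ge_2: "2 \<le> q"
  using primepow_gt_Suc_0[OF primepow_q] by simp

lemma q_gt_0: "0 < q" using q_ge_2 by simp

lemma power_field: "(x :: 'a) ^ (q ^ 5) = x"
proof (cases "x = 0")
  case True
  then show ?thesis using q_gt_0 by simp
next
  case False
  have "(\<Prod>y\<in>UNIV - {0}. x * y) = (\<Prod>y\<in>UNIV - {0}. y)"
    by (rule prod.reindex_bij_witness[of _ "\<lambda>y. y / x" "\<lambda>y. x * y"]) (use False in auto)
  then have "x ^ card (UNIV - {0 :: 'a}) = 1" by (simp add: prod.distrib)
  then have "x ^ (q ^ 5 - 1) = 1" by (simp add: card_field card_Diff_singleton)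
  then have "x ^ (q ^ 5 - 1) * x = x" by simp
  then show ?thesis using q_gt_0 by (metis power_minus_mult zero_less_power)
qed

lemma frob_add: "(x + y :: 'a) ^ (q ^ m) = x ^ (q ^ m) + y ^ (q ^ m)"
proof -
  obtain k where "q = CHAR('a) ^ k" using q_char by blast
  then have "q ^ m = CHAR('a) ^ (k * m)" by (simp add: power_mult)
  then show ?thesis using freshmans_dream'[OF q_char(1)] by blast
qed

lemma frob_add_ac: "(x + y :: 'a alg_closure) ^ q = x ^ q + y ^ q"
proof -
  obtain k where "q = CHAR('a alg_closure) ^ k" using q_char by auto
  then show ?thesis using freshmans_dream'[where ?'a = "'a alg_closure"] q_char(1) by simp
qed

lemma of_nat_q_ac: "of_nat q = (0 :: 'a alg_closure)"
proof -
  obtain k where k: "q = CHAR('a) ^ k" using q_char by blast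
  then have "k \<noteq> 0" using q_ge_2 by (intro notI) simp
  then have "CHAR('a) dvd q" using k by simp
  then show ?thesis by (simp add: of_nat_eq_0_iff_char_dvd)
qed

lemma frob_diff: "(x - y :: 'a) ^ (q ^ m) = x ^ (q ^ m) - y ^ (q ^ m)"
  using frob_add[of "x - y" y m] by (simp add: algebra_simps)

lemma frob_minus: "(- y :: 'a) ^ (q ^ m) = - (y ^ (q ^ m))"
  using frob_diff[of 0 y m] q_gt_0 by simp

lemma frob_inj: "(x :: 'a) ^ (q ^ m) = y ^ (q ^ m) \<longleftrightarrow> x = y"
  using frob_diff[of x y m] by (metis eq_iff_diff_eq_0 power_eq_0_iff q_gt_0 zero_less_power)

lemma frob_period: "(x :: 'a) ^ (q ^ (m + 5)) = x ^ (q ^ m)"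
  using power_field[of "x ^ (q ^ m)"] by (simp only: power_frob_pow)

lemma Fq_iff: "x \<in> Fq q \<longleftrightarrow> (x :: 'a) ^ q = x"
  by (simp add: Fq_def)

lemma Fq_frob: "(x :: 'a) \<in> Fq q \<Longrightarrow> x ^ (q ^ m) = x"
  by (induction m) (simp_all add: Fq_iff power_mult)

lemma card_root_of_unity: "card {x :: 'a. x ^ m = 1} \<le> m" if "m > 0"
proof -
  let ?p = "Polynomial.monom 1 m - 1 :: 'a poly"
  have "coeff ?p m = 1" using that by (simp add: coeff_1)
  then have "?p \<noteq> 0" by (metis coeff_0 zero_neq_one)
  have "degree ?p \<le> m" by (intro degree_diff_le) (auto simp: degree_monom_le)
  moreover have "{x :: 'a. x ^ m = 1} = {x. poly ?p x = 0}" by (simp add: poly_monom)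
  ultimately show ?thesis using card_poly_roots_bound[OF \<open>?p \<noteq> 0\<close>] by simp
qed

definition "nq = 1 + q + q ^ 2 + q ^ 3 + q ^ 4"

lemma norm5_nq: "norm5 q (x :: 'a) = x ^ nq"
  by (simp add: norm5_def nq_def)

lemma nq_mult: "nq * (q - 1) = q ^ 5 - 1"
proof -
  have "int (q - 1) = int q - 1" "int nq = 1 + int q + int q ^ 2 + int q ^ 3 + int q ^ 4"
    using q_gt_0 by (simp_all add: nq_def of_nat_diff)
  then have "int (nq * (q - 1)) = (1 + int q + int q ^ 2 + int q ^ 3 + int q ^ 4) * (int q - 1)"
    by (simp only: of_nat_mult)
  also have "\<dots> = int q ^ 5 - 1" by Groebner_Basis.algebra
  also have "\<dots> = int (q ^ 5 - 1)" using q_gt_0 by (simp add: of_nat_diff)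
  finally show ?thesis by (simp only: of_nat_eq_iff)
qed

lemma card_units: "card (UNIV - {0 :: 'a}) = nq * (q - 1)"
  unfolding nq_mult by (simp add: card_field card_Diff_singleton)

lemma power_card_units: "(x :: 'a) \<noteq> 0 \<Longrightarrow> x ^ (nq * (q - 1)) = 1"
  using power_field[of x] q_gt_0 unfolding nq_mult
  by (metis mult_cancel_right1 power_minus_mult zero_less_power)

text \<open>The fibres of \<open>x \<mapsto> x ^ d\<close> have at most \<open>d\<close> elements
  and there are at most \<open>e\<close> roots of unity of order dividing \<open>e\<close>. As
  \<open>d * e\<close> is the number of units, both bounds are attained.\<close>

lemma card_image_power:
  assumes "d * e = nq * (q - 1)" "d > 0" "e > 0"
  shows "(\<lambda>x :: 'a. x ^ d) ` (UNIV - {0}) = {x. x ^ e = 1}" "card {x :: 'a. x ^ e = 1} = e"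
proof -
  let ?f = "\<lambda>x :: 'a. x ^ d" let ?U = "UNIV - {0 :: 'a}"
  have sub: "?f ` ?U \<subseteq> {x. x ^ e = 1}"
    using power_card_units assms by (auto simp flip: power_mult)
  have fib: "card {x \<in> ?U. ?f x = y} \<le> d" if y: "y \<in> ?f ` ?U" for y
  proof -
    obtain x0 where x0: "x0 \<noteq> 0" "y = x0 ^ d" using y by blast
    have "{x \<in> ?U. ?f x = y} \<subseteq> (\<lambda>t. t * x0) ` {t. t ^ d = 1}"
    proof
      fix x assume "x \<in> {x \<in> ?U. ?f x = y}"
      then have "(x / x0) ^ d = 1" "x = x / x0 * x0" using x0 by (simp_all add: power_divide)
      then show "x \<in> (\<lambda>t. t * x0) ` {t. t ^ d = 1}" by blast
    qed
    then have "card {x \<in> ?U. ?f x = y} \<le> card {t :: 'a. t ^ d = 1}"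
      by (meson card_image_le card_mono finite finite_imageI le_trans)
    then show ?thesis using card_root_of_unity[OF assms(2)] by simp
  qed
  have "(\<Sum>x\<in>?U. 1 :: nat) = (\<Sum>y\<in>?f ` ?U. \<Sum>x\<in>{x \<in> ?U. ?f x = y}. 1)"
    by (rule sum.image_gen) simp
  then have "d * e = (\<Sum>y\<in>?f ` ?U. card {x \<in> ?U. ?f x = y})"
    using card_units assms by simp
  also have "\<dots> \<le> (\<Sum>y\<in>?f ` ?U. d)" by (intro sum_mono fib)
  finally have "d * e \<le> d * card (?f ` ?U)" by (simp add: mult.commute)
  then have le: "e \<le> card (?f ` ?U)" using assms(2) by simp
  have "card (?f ` ?U) \<le> card {x :: 'a. x ^ e = 1}" by (intro card_mono sub) simp
  with le card_root_of_unity[OF assms(3)] have eq: "card (?f ` ?U) = e" "card {x :: 'a. x ^ e = 1} = e" by auto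
  show "?f ` ?U = {x. x ^ e = 1}" by (rule card_subset_eq) (use sub eq in auto)
  show "card {x :: 'a. x ^ e = 1} = e" by (rule eq)
qed

lemma nq_pos: "nq > 0" by (simp add: nq_def)

lemma card_Fq_units: "card (Fq q - {0 :: 'a}) = q - 1"
proof -
  have "Fq q - {0 :: 'a} = {x. x ^ (q - 1) = 1}"
  proof -
    have "x ^ q = x \<and> x \<noteq> 0 \<longleftrightarrow> x ^ (q - 1) = 1" for x :: 'a
    proof -
      have "x ^ q = x ^ (q - 1) * x" using q_gt_0 by (metis power_minus_mult)
      then show ?thesis using q_ge_2 by (cases "x = 0") (auto simp: power_0_left)
    qed
    then show ?thesis by (auto simp: Fq_def)
  qed
  then show ?thesis using card_image_power(2)[of nq "q - 1"] nq_pos q_ge_2 by simp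
qed

lemma norm_Fq: "norm5 q (x :: 'a) \<in> Fq q"
proof (cases "x = 0")
  case True
  then show ?thesis using q_gt_0 by (simp add: norm5_def Fq_def)
next
  case False
  then have "(x ^ nq) ^ (q - 1) = 1" using power_card_units by (simp flip: power_mult)
  then show ?thesis using q_gt_0 unfolding Fq_def norm5_nq
    by (metis (mono_tags) mem_Collect_eq mult_1 power_minus_mult)
qed

lemma norm_expand: "norm5 q (x :: 'a) = x * x ^ q * x ^ (q ^ 2) * x ^ (q ^ 3) * x ^ (q ^ 4)"
  by (simp add: norm5_def power_add)

section \<open>Kernels of linearised polynomials and descent from the algebraic closure\<close>

lemma additive_kernel_bound:
  fixes b0 b1 b2 b3 b4 :: 'a
  assumes "\<not> (b0 = 0 \<and> b1 = 0 \<and> b2 = 0 \<and> b3 = 0 \<and> b4 = 0)"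
  shows "card {x. b0 * x + b1 * x ^ q + b2 * x ^ (q ^ 2) + b3 * x ^ (q ^ 3) + b4 * x ^ (q ^ 4) = 0} \<le> q ^ 4"
    and "b4 = 0 \<Longrightarrow> card {x. b0 * x + b1 * x ^ q + b2 * x ^ (q ^ 2) + b3 * x ^ (q ^ 3) = 0} \<le> q ^ 3"
    and "b3 = 0 \<Longrightarrow> b4 = 0 \<Longrightarrow> card {x. b0 * x + b1 * x ^ q + b2 * x ^ (q ^ 2) = 0} \<le> q ^ 2"
proof -
  define p where "p = Polynomial.monom b0 1 + Polynomial.monom b1 q + Polynomial.monom b2 (q ^ 2)
    + Polynomial.monom b3 (q ^ 3) + Polynomial.monom b4 (q ^ 4)"
  have lt: "1 < q" "q < q ^ 2" "q ^ 2 < q ^ 3" "q ^ 3 < q ^ 4"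
    using q_ge_2 by (simp_all add: power_strict_increasing_iff numeral_eq_Suc)
  then have ne: "q \<noteq> 1" "q ^ 2 \<noteq> 1" "q ^ 3 \<noteq> 1" "q ^ 4 \<noteq> 1" "q ^ 2 \<noteq> q" "q ^ 3 \<noteq> q" "q ^ 4 \<noteq> q"
      "q ^ 3 \<noteq> q ^ 2" "q ^ 4 \<noteq> q ^ 2" "q ^ 4 \<noteq> q ^ 3" by linarith+
  have "coeff p 1 = b0" "coeff p q = b1" "coeff p (q ^ 2) = b2" "coeff p (q ^ 3) = b3" "coeff p (q ^ 4) = b4"
    unfolding p_def coeff_add coeff_monom using ne ne[symmetric] by (simp_all only: if_False simp_thms) simp_all
  then have p0: "p \<noteq> 0" using assms by auto
  have poly: "poly p x = b0 * x + b1 * x ^ q + b2 * x ^ (q ^ 2) + b3 * x ^ (q ^ 3) + b4 * x ^ (q ^ 4)" for x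
    by (simp add: p_def poly_monom)
  have "degree p \<le> q ^ 4" unfolding p_def
    by (intro degree_add_le) (insert lt, (rule order.trans[OF degree_monom_le], linarith) | simp)+
  then show "card {x. b0 * x + b1 * x ^ q + b2 * x ^ (q ^ 2) + b3 * x ^ (q ^ 3) + b4 * x ^ (q ^ 4) = 0} \<le> q ^ 4"
    using card_poly_roots_bound[OF p0] by (simp add: poly)
  show "card {x. b0 * x + b1 * x ^ q + b2 * x ^ (q ^ 2) + b3 * x ^ (q ^ 3) = 0} \<le> q ^ 3" if "b4 = 0"
  proof -
    have "degree p \<le> q ^ 3" unfolding p_def that
      by (intro degree_add_le) (insert lt, (rule order.trans[OF degree_monom_le], linarith) | simp)+
    then show ?thesis using card_poly_roots_bound[OF p0] by (simp add: poly that)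
  qed
  show "card {x. b0 * x + b1 * x ^ q + b2 * x ^ (q ^ 2) = 0} \<le> q ^ 2" if "b3 = 0" "b4 = 0"
  proof -
    have "degree p \<le> q ^ 2" unfolding p_def that
      by (intro degree_add_le) (insert lt, (rule order.trans[OF degree_monom_le], linarith) | simp)+
    then show ?thesis using card_poly_roots_bound[OF p0] by (simp add: poly that)
  qed
qed

lemma ac_fixed_imp_field:
  fixes z :: "'a alg_closure"
  assumes "z ^ (q ^ 5) = z"
  shows "\<exists>x. z = to_ac x"
proof -
  let ?p = "Polynomial.monom 1 (q ^ 5) - Polynomial.monom 1 1 :: 'a alg_closure poly"
  have "1 < q ^ 5" using q_ge_2 one_less_power[of q 5] by simp
  then have "coeff ?p (q ^ 5) = 1" by simp
  then have p0: "?p \<noteq> 0" by (metis coeff_0 zero_neq_one)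
  have "degree ?p \<le> q ^ 5" using \<open>1 < q ^ 5\<close>
    by (intro degree_diff_le order.trans[OF degree_monom_le]) auto
  then have le: "card {x. poly ?p x = 0} \<le> q ^ 5" using card_poly_roots_bound[OF p0] by simp
  have "range (to_ac :: 'a \<Rightarrow> _) \<subseteq> {x. poly ?p x = 0}"
    using power_field by (auto simp: poly_monom simp flip: to_ac_power)
  moreover have "card (range (to_ac :: 'a \<Rightarrow> _)) = q ^ 5"
    using card_image[OF inj_to_ac] card_field by metis
  ultimately have "range (to_ac :: 'a \<Rightarrow> _) = {x. poly ?p x = 0}"
    using le poly_roots_finite[OF p0] by (metis card_seteq)
  moreover have "z \<in> {x. poly ?p x = 0}" using assms by (simp add: poly_monom)
  ultimately show ?thesis by blast
qed

text \<open>Raising the norm to the \<open>q\<close>-th power trades its factor \<open>z\<close> for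
  \<open>z ^ (q ^ 5)\<close>; a norm fixed by Frobenius makes the two equal.\<close>

lemma ac_norm_imp_field:
  fixes z n :: "'a alg_closure"
  assumes "n ^ q = n" and N: "n * (z * z ^ q * z ^ (q ^ 2) * z ^ (q ^ 3) * z ^ (q ^ 4)) = 1"
  shows "\<exists>x. z = to_ac x"
proof (rule ac_fixed_imp_field)
  have nz: "n \<noteq> 0" "z \<noteq> 0" using N q_gt_0 by auto
  have "(n * (z * z ^ q * z ^ (q ^ 2) * z ^ (q ^ 3) * z ^ (q ^ 4))) ^ q = 1" using N by simp
  then have "n * (z ^ q * z ^ (q ^ 2) * z ^ (q ^ 3) * z ^ (q ^ 4) * z ^ (q ^ 5)) = 1"
    by (simp add: power_mult_distrib assms(1) numeral_eq_Suc mult.commute flip: power_mult)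
  then have "z ^ (q ^ 5) * (n * (z ^ q * z ^ (q ^ 2) * z ^ (q ^ 3) * z ^ (q ^ 4)))
      = z * (n * (z ^ q * z ^ (q ^ 2) * z ^ (q ^ 3) * z ^ (q ^ 4)))"
    using N by (simp add: mult_ac)
  then show "z ^ (q ^ 5) = z" using nz by simp
qed

lemma curve_point:
  fixes \<delta> n :: 'a
  assumes "\<delta> \<notin> Fq q" "n \<in> Fq q" "n \<noteq> 0"
  shows "\<exists>z. n * norm5 q z = 1 \<and>
    (1 + z) * (1 + z ^ (q ^ 2)) + \<delta> ^ (q ^ 4) * z * z ^ (q ^ 2) * z ^ (q ^ 3) * (1 + z ^ q)
      = \<delta> ^ q * \<delta> ^ (q ^ 2) / n * z"
proof -
  have *: "to_ac x ^ k = to_ac y \<longleftrightarrow> x ^ k = y" for x y :: 'a and k by (simp flip: to_ac_power)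
  obtain z where z: "to_ac n * (z * z ^ q * z ^ (q ^ 2) * z ^ (q ^ 3) * z ^ (q ^ 4)) = 1"
    "(1 + z) * (1 + z ^ (q ^ 2)) + to_ac \<delta> ^ (q ^ 4) * z * z ^ (q ^ 2) * z ^ (q ^ 3) * (1 + z ^ q)
      = to_ac \<delta> ^ q * to_ac \<delta> ^ (q ^ 2) / to_ac n * z"
    using curve_frobenius_point[OF q_ge_2 of_nat_q_ac frob_add_ac, of "to_ac \<delta>" "to_ac n"]
      assms power_field by (auto simp: * Fq_def)
  obtain x where x: "z = to_ac x" using ac_norm_imp_field[OF _ z(1)] assms by (auto simp: * Fq_def)
  have "to_ac (n * norm5 q x) = to_ac 1" using z(1) by (simp add: norm_expand x)
  then have 1: "n * norm5 q x = 1" using to_ac_eq_iff by blast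
  have "to_ac ((1 + x) * (1 + x ^ (q ^ 2)) + \<delta> ^ (q ^ 4) * x * x ^ (q ^ 2) * x ^ (q ^ 3) * (1 + x ^ q))
      = to_ac (\<delta> ^ q * \<delta> ^ (q ^ 2) / n * x)" using z(2) by (simp add: x)
  then show ?thesis using 1 to_ac_eq_iff by blast
qed

lemma pentagon_point:
  fixes \<beta> :: 'a
  assumes "\<beta> \<in> Fq q" "\<beta> \<noteq> 0"
  shows "\<exists>z. \<beta> ^ 2 * norm5 q z = 1 \<and> z ^ q * (1 + \<beta> * z * z ^ (q ^ 2)) = 1"
proof -
  have *: "to_ac x ^ k = to_ac y \<longleftrightarrow> x ^ k = y" for x y :: 'a and k by (simp flip: to_ac_power)
  have b: "(\<beta> ^ 2) ^ q = \<beta> ^ 2" using assms by (simp add: Fq_def power_mult_distrib power2_eq_square)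
  obtain z where z: "to_ac \<beta> ^ 2 * (z * z ^ q * z ^ (q ^ 2) * z ^ (q ^ 3) * z ^ (q ^ 4)) = 1"
    "z ^ q * (1 + to_ac \<beta> * z * z ^ (q ^ 2)) = 1"
    using pentagon_frobenius_point[OF q_ge_2 of_nat_q_ac frob_add_ac, of "to_ac \<beta>"]
      assms by (auto simp: * Fq_def)
  obtain x where x: "z = to_ac x" using ac_norm_imp_field[OF _ z(1)] b
    by (auto simp flip: to_ac_power)
  have "to_ac (\<beta> ^ 2 * norm5 q x) = to_ac 1" using z(1) by (simp add: norm_expand x)
  moreover have "to_ac (x ^ q * (1 + \<beta> * x * x ^ (q ^ 2))) = to_ac 1" using z(2) by (simp add: x)
  ultimately show ?thesis using to_ac_eq_iff by blast
qed

lemma pentagram_point: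
  fixes \<beta> :: 'a
  assumes "\<beta> \<in> Fq q" "\<beta> \<noteq> 0"
  shows "\<exists>z. \<beta> ^ 4 * norm5 q z = 1 \<and>
    1 + \<beta> ^ 5 * z * (z ^ q) ^ 2 * (z ^ (q ^ 2)) ^ 2 * z ^ (q ^ 3) = \<beta> ^ 2 * z ^ q * z ^ (q ^ 2)"
proof -
  have *: "to_ac x ^ k = to_ac y \<longleftrightarrow> x ^ k = y" for x y :: 'a and k by (simp flip: to_ac_power)
  have b: "(\<beta> ^ 4) ^ q = \<beta> ^ 4" using assms by (simp add: Fq_def power_mult_distrib numeral_eq_Suc)
  obtain z where z: "to_ac \<beta> ^ 4 * (z * z ^ q * z ^ (q ^ 2) * z ^ (q ^ 3) * z ^ (q ^ 4)) = 1"
    "1 + to_ac \<beta> ^ 5 * z * (z ^ q) ^ 2 * (z ^ (q ^ 2)) ^ 2 * z ^ (q ^ 3) = to_ac \<beta> ^ 2 * z ^ q * z ^ (q ^ 2)"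
    using pentagram_frobenius_point[OF q_ge_2 of_nat_q_ac frob_add_ac, of "to_ac \<beta>"]
      assms by (auto simp: * Fq_def)
  obtain x where x: "z = to_ac x" using ac_norm_imp_field[OF _ z(1)] b
    by (auto simp flip: to_ac_power)
  have "to_ac (\<beta> ^ 4 * norm5 q x) = to_ac 1" using z(1) by (simp add: norm_expand x)
  moreover have "to_ac (1 + \<beta> ^ 5 * x * (x ^ q) ^ 2 * (x ^ (q ^ 2)) ^ 2 * x ^ (q ^ 3)) = to_ac (\<beta> ^ 2 * x ^ q * x ^ (q ^ 2))"
    using z(2) by (simp add: x)
  ultimately show ?thesis using to_ac_eq_iff by blast
qed

end

section \<open>The powers of the generator, Hilbert 90 and kernel sizes\<close>

locale quintic_sigma = quintic_field +
  fixes s :: nat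
  assumes s_ge: "1 \<le> s" and s_le: "s \<le> 4"
begin

definition sg :: "nat \<Rightarrow> 'a \<Rightarrow> 'a" where "sg i x = x ^ (q ^ (s * i))"

lemma sg_add [simp]: "sg i (x + y) = sg i x + sg i y" by (simp add: sg_def frob_add)
lemma sg_diff [simp]: "sg i (x - y) = sg i x - sg i y" by (simp add: sg_def frob_diff)
lemma sg_minus [simp]: "sg i (- x) = - sg i x" by (simp add: sg_def frob_minus)
lemma sg_mult [simp]: "sg i (x * y) = sg i x * sg i y" by (simp add: sg_def power_mult_distrib)
lemma sg_div [simp]: "sg i (x / y) = sg i x / sg i y" by (simp add: sg_def power_divide)
lemma sg_inverse [simp]: "sg i (inverse x) = inverse (sg i x)" by (simp add: sg_def power_inverse)
lemma sg_power [simp]: "sg i (x ^ k) = sg i x ^ k" by (simp add: sg_def mult.commute flip: power_mult)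
lemma sg_const [simp]: "sg i 0 = 0" "sg i 1 = 1" using q_gt_0 by (simp_all add: sg_def)
lemma sg_id [simp]: "sg 0 x = x" by (simp add: sg_def)
lemma sg_sg: "sg i (sg j x) = sg (i + j) x"
  by (simp add: sg_def power_frob_pow distrib_left add.commute)
lemma sg_5: "sg 5 x = x"
proof -
  have "x ^ (q ^ (5 * m)) = x" for m
    by (induction m) (simp_all add: frob_period add.commute[of 5])
  then show ?thesis by (simp add: sg_def mult.commute)
qed
lemma sg_period: "sg (i + 5) x = sg i x" using sg_sg[of i 5 x] by (simp add: sg_5)
lemma sg_comp [simp]:
  "sg (Suc 0) (sg (Suc 0) x) = sg 2 x" "sg (Suc 0) (sg 2 x) = sg 3 x" "sg (Suc 0) (sg 3 x) = sg 4 x" "sg (Suc 0) (sg 4 x) = x"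
  "sg 2 (sg (Suc 0) x) = sg 3 x" "sg 2 (sg 2 x) = sg 4 x" "sg 2 (sg 3 x) = x" "sg 2 (sg 4 x) = sg (Suc 0) x"
  "sg 3 (sg (Suc 0) x) = sg 4 x" "sg 3 (sg 2 x) = x" "sg 3 (sg 3 x) = sg (Suc 0) x" "sg 3 (sg 4 x) = sg 2 x"
  "sg 4 (sg (Suc 0) x) = x" "sg 4 (sg 2 x) = sg (Suc 0) x" "sg 4 (sg 3 x) = sg 2 x" "sg 4 (sg 4 x) = sg 3 x"
  using sg_5[of x] sg_period[of 1 x] sg_period[of 2 x] sg_period[of 3 x] by (simp_all add: sg_sg numeral_eq_Suc)
lemma sg_eq_0 [simp]: "sg i x = 0 \<longleftrightarrow> x = 0" using q_gt_0 by (simp add: sg_def)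
lemma sg_inj [simp]: "sg i x = sg i y \<longleftrightarrow> x = y" by (simp add: sg_def frob_inj)

lemma s_cases: "s = 1 \<or> s = 2 \<or> s = 3 \<or> s = 4" using s_ge s_le by arith

lemma frob_reduce: "(x :: 'a) ^ (q ^ 6) = x ^ q" "(x :: 'a) ^ (q ^ 8) = x ^ (q ^ 3)" "(x :: 'a) ^ (q ^ 9) = x ^ (q ^ 4)"
  "(x :: 'a) ^ (q ^ 12) = x ^ (q ^ 2)" "(x :: 'a) ^ (q ^ 16) = x ^ q"
  using frob_period[of x 1] frob_period[of x 3] frob_period[of x 4] frob_period[of x 7] frob_period[of x 2]
    frob_period[of x 11] frob_period[of x 6] by simp_all

lemma sg_frob:
  "s = 1 \<Longrightarrow> sg 1 x = x ^ q \<and> sg 2 x = x ^ (q ^ 2) \<and> sg 3 x = x ^ (q ^ 3) \<and> sg 4 x = x ^ (q ^ 4)"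
  "s = 2 \<Longrightarrow> sg 1 x = x ^ (q ^ 2) \<and> sg 2 x = x ^ (q ^ 4) \<and> sg 3 x = x ^ q \<and> sg 4 x = x ^ (q ^ 3)"
  "s = 3 \<Longrightarrow> sg 1 x = x ^ (q ^ 3) \<and> sg 2 x = x ^ q \<and> sg 3 x = x ^ (q ^ 4) \<and> sg 4 x = x ^ (q ^ 2)"
  "s = 4 \<Longrightarrow> sg 1 x = x ^ (q ^ 4) \<and> sg 2 x = x ^ (q ^ 3) \<and> sg 3 x = x ^ (q ^ 2) \<and> sg 4 x = x ^ q"
  unfolding sg_def by (simp_all add: frob_reduce)

lemma sg_cases:
  "(\<forall>x. sg 1 x = x ^ q \<and> sg 2 x = x ^ (q ^ 2) \<and> sg 3 x = x ^ (q ^ 3) \<and> sg 4 x = x ^ (q ^ 4)) \<or>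
   (\<forall>x. sg 1 x = x ^ (q ^ 2) \<and> sg 2 x = x ^ (q ^ 4) \<and> sg 3 x = x ^ q \<and> sg 4 x = x ^ (q ^ 3)) \<or>
   (\<forall>x. sg 1 x = x ^ (q ^ 3) \<and> sg 2 x = x ^ q \<and> sg 3 x = x ^ (q ^ 4) \<and> sg 4 x = x ^ (q ^ 2)) \<or>
   (\<forall>x. sg 1 x = x ^ (q ^ 4) \<and> sg 2 x = x ^ (q ^ 3) \<and> sg 3 x = x ^ (q ^ 2) \<and> sg 4 x = x ^ q)"
  using s_cases sg_frob by metis

lemma Fq_sg: "c \<in> Fq q \<Longrightarrow> sg i c = c" by (simp add: sg_def Fq_frob)

lemma sg_fixed_imp_Fq: assumes "sg 1 x = x" shows "x \<in> Fq q"
proof -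
  have "sg i x = x" for i
  proof (induction i)
    case (Suc i)
    then show ?case using sg_sg[of 1 i x] assms by simp
  qed simp
  then show ?thesis using s_cases sg_frob[of x] unfolding Fq_iff by metis
qed

lemma norm_sg: "norm5 q x = x * sg 1 x * sg 2 x * sg 3 x * sg 4 x"
  using sg_cases by (elim disjE) (simp_all add: norm_expand mult_ac)

lemma norm_mult: "norm5 q (x * y) = norm5 q x * norm5 q (y :: 'a)"
  by (simp add: norm5_def power_mult_distrib)
lemma norm_div: "norm5 q (x / y) = norm5 q x / norm5 q (y :: 'a)"
  by (simp add: norm5_def power_divide)
lemma norm_eq_0: "norm5 q x = 0 \<longleftrightarrow> x = (0 :: 'a)"
  using nq_pos by (simp add: norm5_nq)
lemma norm_of_Fq: "c \<in> Fq q \<Longrightarrow> norm5 q c = (c :: 'a) ^ 5"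
  by (simp add: norm_sg Fq_sg numeral_eq_Suc)
lemma norm_minus: "norm5 q (- x) = - norm5 q (x :: 'a)"
  by (simp add: norm_sg)

lemma Fq_mult: "x \<in> Fq q \<Longrightarrow> y \<in> Fq q \<Longrightarrow> x * y \<in> (Fq q :: 'a set)"
  by (simp add: Fq_iff power_mult_distrib)
lemma Fq_div: "x \<in> Fq q \<Longrightarrow> y \<in> Fq q \<Longrightarrow> x / y \<in> (Fq q :: 'a set)"
  by (simp add: Fq_iff power_divide)
lemma Fq_1: "1 \<in> (Fq q :: 'a set)" "0 \<in> (Fq q :: 'a set)" using q_gt_0 by (simp_all add: Fq_iff)
lemma Fq_minus: "x \<in> Fq q \<Longrightarrow> - x \<in> (Fq q :: 'a set)"
  using frob_minus[of x 1] by (simp add: Fq_iff)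

lemma card_Fq: "card (Fq q :: 'a set) = q"
proof -
  have "card (Fq q :: 'a set) = Suc (card (Fq q - {0 :: 'a}))"
    using Fq_1 by (metis card.remove finite)
  then show ?thesis using card_Fq_units q_gt_0 by simp
qed

text \<open>Each fibre of \<open>sg 1 w / w\<close> lies in a coset of the \<open>q - 1\<close>
  units of the subfield, so the image has at least \<open>nq\<close> elements, while at most
  \<open>nq\<close> elements have norm 1.\<close>

lemma hilbert90:
  assumes "norm5 q u = (1 :: 'a)"
  shows "\<exists>w \<noteq> 0. sg 1 w = u * w"
proof -
  let ?U = "UNIV - {0 :: 'a}" let ?f = "\<lambda>w. sg 1 w / w"
  have sub: "?f ` ?U \<subseteq> {x. x ^ nq = 1}"
  proof
    fix y assume "y \<in> ?f ` ?U"
    then obtain w where w: "w \<noteq> 0" "y = sg 1 w / w" by blast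
    have "norm5 q y = 1" using w by (simp add: norm_sg)
    then show "y \<in> {x. x ^ nq = 1}" by (simp add: norm5_nq)
  qed
  have fib: "card {w \<in> ?U. ?f w = y} \<le> q - 1" if y: "y \<in> ?f ` ?U" for y
  proof -
    obtain w0 where w0: "w0 \<noteq> 0" "y = ?f w0" using y by blast
    have "{w \<in> ?U. ?f w = y} \<subseteq> (\<lambda>t. t * w0) ` (Fq q - {0})"
    proof
      fix w assume w: "w \<in> {w \<in> ?U. ?f w = y}"
      then have "w \<noteq> 0" "sg 1 w / w = sg 1 w0 / w0" using w0 by auto
      then have "sg 1 w * w0 = sg 1 w0 * w" using w0 by (metis frac_eq_eq)
      then have "sg 1 (w / w0) = w / w0" using w0 by (simp add: frac_eq_eq mult.commute)
      then have "w / w0 \<in> Fq q - {0}" using sg_fixed_imp_Fq w w0 by simp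
      moreover have "w = w / w0 * w0" using w0 by simp
      ultimately show "w \<in> (\<lambda>t. t * w0) ` (Fq q - {0})" by blast
    qed
    then have "card {w \<in> ?U. ?f w = y} \<le> card (Fq q - {0 :: 'a})"
      by (meson card_image_le card_mono finite finite_imageI le_trans)
    then show ?thesis by (simp add: card_Fq_units)
  qed
  have "(\<Sum>x\<in>?U. 1 :: nat) = (\<Sum>y\<in>?f ` ?U. \<Sum>x\<in>{x \<in> ?U. ?f x = y}. 1)"
    by (rule sum.image_gen) simp
  then have "(q - 1) * nq = (\<Sum>y\<in>?f ` ?U. card {x \<in> ?U. ?f x = y})"
    using card_units by (simp add: mult.commute)
  also have "\<dots> \<le> (\<Sum>y\<in>?f ` ?U. q - 1)" by (intro sum_mono fib)
  finally have "(q - 1) * nq \<le> (q - 1) * card (?f ` ?U)" by (simp add: mult.commute)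
  then have le: "nq \<le> card (?f ` ?U)" using q_ge_2 by simp
  have "?f ` ?U = {x. x ^ nq = 1}"
    by (rule card_seteq) (use sub le card_root_of_unity[OF nq_pos] in auto)
  then have "u \<in> ?f ` ?U" using assms by (simp add: norm5_nq)
  then obtain w where "w \<noteq> 0" "u = sg 1 w / w" by blast
  then show ?thesis by (auto intro!: exI[of _ w])
qed

lemma card_additive_kernel:
  fixes h :: "'a \<Rightarrow> 'a"
  assumes "\<And>x y. h (x + y) = h x + h y"
  shows "q ^ 5 \<le> card (range h) * card {x. h x = 0}"
proof -
  have hd: "h (x - y) = h x - h y" for x y using assms[of "x - y" y] by (simp add: algebra_simps)
  have fib: "card {x. h x = y} \<le> card {x. h x = 0}" if y: "y \<in> range h" for y
  proof -
    obtain x0 where x0: "y = h x0" using y by blast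
    have "{x. h x = y} \<subseteq> (\<lambda>t. t + x0) ` {x. h x = 0}"
    proof
      fix x assume "x \<in> {x. h x = y}"
      then have "h (x - x0) = 0" "x = (x - x0) + x0" using x0 by (simp_all add: hd)
      then show "x \<in> (\<lambda>t. t + x0) ` {x. h x = 0}" by blast
    qed
    then show ?thesis by (meson card_image_le card_mono finite finite_imageI le_trans)
  qed
  have "(\<Sum>x\<in>(UNIV :: 'a set). 1 :: nat) = (\<Sum>y\<in>range h. \<Sum>x\<in>{x \<in> UNIV. h x = y}. 1)"
    by (rule sum.image_gen) simp
  then have "q ^ 5 = (\<Sum>y\<in>range h. card {x. h x = y})" by (simp add: card_field)
  also have "\<dots> \<le> (\<Sum>y\<in>range h. card {x. h x = 0})" by (intro sum_mono fib)
  finally show ?thesis by simp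
qed

lemma sg_kernel_bound:
  assumes "\<not> (b0 = 0 \<and> b1 = 0 \<and> b2 = 0 \<and> b3 = 0 \<and> b4 = 0)"
  shows "card {x. b0 * x + b1 * sg 1 x + b2 * sg 2 x + b3 * sg 3 x + b4 * sg 4 x = 0} \<le> q ^ 4"
  using sg_cases
proof (elim disjE)
  assume "\<forall>x. sg 1 x = x ^ q \<and> sg 2 x = x ^ (q ^ 2) \<and> sg 3 x = x ^ (q ^ 3) \<and> sg 4 x = x ^ (q ^ 4)"
  moreover have "\<not> (b0 = 0 \<and> b1 = 0 \<and> b2 = 0 \<and> b3 = 0 \<and> b4 = 0)" using assms by blast
  ultimately show ?thesis using additive_kernel_bound(1)[of b0 b1 b2 b3 b4] by (simp add: add_ac)
next
  assume "\<forall>x. sg 1 x = x ^ (q ^ 2) \<and> sg 2 x = x ^ (q ^ 4) \<and> sg 3 x = x ^ q \<and> sg 4 x = x ^ (q ^ 3)"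
  moreover have "\<not> (b0 = 0 \<and> b3 = 0 \<and> b1 = 0 \<and> b4 = 0 \<and> b2 = 0)" using assms by blast
  ultimately show ?thesis using additive_kernel_bound(1)[of b0 b3 b1 b4 b2] by (simp add: add_ac)
next
  assume "\<forall>x. sg 1 x = x ^ (q ^ 3) \<and> sg 2 x = x ^ q \<and> sg 3 x = x ^ (q ^ 4) \<and> sg 4 x = x ^ (q ^ 2)"
  moreover have "\<not> (b0 = 0 \<and> b2 = 0 \<and> b4 = 0 \<and> b1 = 0 \<and> b3 = 0)" using assms by blast
  ultimately show ?thesis using additive_kernel_bound(1)[of b0 b2 b4 b1 b3] by (simp add: add_ac)
next
  assume "\<forall>x. sg 1 x = x ^ (q ^ 4) \<and> sg 2 x = x ^ (q ^ 3) \<and> sg 3 x = x ^ (q ^ 2) \<and> sg 4 x = x ^ q"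
  moreover have "\<not> (b0 = 0 \<and> b4 = 0 \<and> b3 = 0 \<and> b2 = 0 \<and> b1 = 0)" using assms by blast
  ultimately show ?thesis using additive_kernel_bound(1)[of b0 b4 b3 b2 b1] by (simp add: add_ac)
qed

text \<open>Whatever \<open>s\<close> is, without the term in \<open>x\<close> the polynomial is one
  in \<open>x ^ q\<close>, and the bound improves by a factor \<open>q\<close>.\<close>

lemma sg_kernel_bound':
  assumes "\<not> (b1 = 0 \<and> b2 = 0 \<and> b3 = 0 \<and> b4 = 0)"
  shows "card {x. b1 * sg 1 x + b2 * sg 2 x + b3 * sg 3 x + b4 * sg 4 x = 0} \<le> q ^ 3"
proof -
  have *: "card {x. c1 * x ^ q + c2 * x ^ (q ^ 2) + c3 * x ^ (q ^ 3) + c4 * x ^ (q ^ 4) = 0} \<le> q ^ 3"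
    if "\<not> (c1 = 0 \<and> c2 = 0 \<and> c3 = 0 \<and> c4 = 0)" for c1 c2 c3 c4 :: 'a
  proof -
    have pow: "(x ^ q) ^ q = x ^ (q ^ 2)" "(x ^ q) ^ (q ^ 2) = x ^ (q ^ 3)" "(x ^ q) ^ (q ^ 3) = x ^ (q ^ 4)" for x :: 'a
      by (simp_all add: numeral_eq_Suc flip: power_mult)
    have "inj_on (\<lambda>x :: 'a. x ^ q) A" for A using frob_inj[of _ 1] by (auto intro: inj_onI)
    then have "card {x. c1 * x ^ q + c2 * x ^ (q ^ 2) + c3 * x ^ (q ^ 3) + c4 * x ^ (q ^ 4) = 0}
      = card ((\<lambda>x. x ^ q) ` {x. c1 * x ^ q + c2 * x ^ (q ^ 2) + c3 * x ^ (q ^ 3) + c4 * x ^ (q ^ 4) = 0})"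
      by (simp add: card_image)
    also have "\<dots> \<le> card {x. c1 * x + c2 * x ^ q + c3 * x ^ (q ^ 2) + c4 * x ^ (q ^ 3) = 0}"
      by (intro card_mono) (auto simp: pow)
    also have "\<dots> \<le> q ^ 3" using additive_kernel_bound(2)[of c1 c2 c3 c4 0] that by blast
    finally show ?thesis .
  qed
  from sg_cases show ?thesis
  proof (elim disjE)
    assume "\<forall>x. sg 1 x = x ^ q \<and> sg 2 x = x ^ (q ^ 2) \<and> sg 3 x = x ^ (q ^ 3) \<and> sg 4 x = x ^ (q ^ 4)"
  moreover have "\<not> (b1 = 0 \<and> b2 = 0 \<and> b3 = 0 \<and> b4 = 0)" using assms by blast
    ultimately show ?thesis using *[of b1 b2 b3 b4] by (simp add: add_ac)
  next
    assume "\<forall>x. sg 1 x = x ^ (q ^ 2) \<and> sg 2 x = x ^ (q ^ 4) \<and> sg 3 x = x ^ q \<and> sg 4 x = x ^ (q ^ 3)"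
  moreover have "\<not> (b3 = 0 \<and> b1 = 0 \<and> b4 = 0 \<and> b2 = 0)" using assms by blast
    ultimately show ?thesis using *[of b3 b1 b4 b2] by (simp add: add_ac)
  next
    assume "\<forall>x. sg 1 x = x ^ (q ^ 3) \<and> sg 2 x = x ^ q \<and> sg 3 x = x ^ (q ^ 4) \<and> sg 4 x = x ^ (q ^ 2)"
  moreover have "\<not> (b2 = 0 \<and> b4 = 0 \<and> b1 = 0 \<and> b3 = 0)" using assms by blast
    ultimately show ?thesis using *[of b2 b4 b1 b3] by (simp add: add_ac)
  next
    assume "\<forall>x. sg 1 x = x ^ (q ^ 4) \<and> sg 2 x = x ^ (q ^ 3) \<and> sg 3 x = x ^ (q ^ 2) \<and> sg 4 x = x ^ q"
  moreover have "\<not> (b4 = 0 \<and> b3 = 0 \<and> b2 = 0 \<and> b1 = 0)" using assms by blast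
    ultimately show ?thesis using *[of b4 b3 b2 b1] by (simp add: add_ac)
  qed
qed

section \<open>Scatteredness and the Pluecker equation\<close>

definition D1 :: "'a \<Rightarrow> 'a \<Rightarrow> 'a" where "D1 x y = x * sg 1 y - sg 1 x * y"
definition D2 :: "'a \<Rightarrow> 'a \<Rightarrow> 'a" where "D2 x y = x * sg 2 y - sg 2 x * y"

text \<open>
  \<open>scat a b t\<close> expresses that the linear set cut out by the functionals vanishing on
  \<open>(a, b, t)\<close>, evaluated at \<open>(x, sg 1 x, sg 2 x)\<close>, is scattered.
\<close>

definition scat :: "'a \<Rightarrow> 'a \<Rightarrow> 'a \<Rightarrow> bool" where
  "scat a b t \<longleftrightarrow> (\<forall>x y. x \<noteq> 0 \<longrightarrow> t * D1 x y - b * D2 x y + a * sg 1 (D1 x y) = 0 \<longrightarrow> (\<exists>c\<in>Fq q. y = c * x))"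

text \<open>\<open>d\<close> and \<open>e\<close> are the Pluecker coordinates of a line over the subfield; the line is
  recovered as the image of the skew matrix of rank 2 that they define.\<close>

lemma pluecker_not_scat:
  assumes d: "d \<noteq> 0" and pl: "d * sg 2 d = e * sg 1 e + sg 3 e * sg 1 d" and f: "t * d - b * e + a * sg 1 d = 0"
  shows "\<not> scat a b t"
proof
  assume sc: "scat a b t"
  \<comment> \<open>If \<open>d = D1 u v\<close> and \<open>e = D2 u v\<close>, the value is
    \<open>u\<close> times the trace of \<open>v * \<theta>\<close> minus \<open>v\<close> times the
    trace of \<open>u * \<theta>\<close>; so the range should be the span of \<open>u\<close> and
    \<open>v\<close> over the subfield.\<close>
  define im where "im \<theta> = d * sg 1 \<theta> + e * sg 2 \<theta> - sg 3 e * sg 3 \<theta> - sg 4 d * sg 4 \<theta>" for \<theta>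
  have Xadd: "im (x + y) = im x + im y" for x y by (simp add: im_def algebra_simps)
  have "sg 4 (d * sg 2 d) = sg 4 (e * sg 1 e + sg 3 e * sg 1 d)" using pl by simp
  then have pl4: "sg 4 d * sg 1 d = sg 4 e * e + sg 2 e * d" by simp
  \<comment> \<open>A space of dimension two satisfies a second order recurrence. It makes
    \<open>D2 x y\<close> and \<open>sg 1 (D1 x y)\<close> the multiples \<open>e / d\<close> and
    \<open>sg 1 d / d\<close> of \<open>D1 x y\<close>, which reduces the form to the hypothesis
    \<open>f\<close>.\<close>
  have rec: "d * sg 2 (im \<theta>) = e * sg 1 (im \<theta>) - sg 1 d * im \<theta>" for \<theta>
    unfolding im_def using pl pl4 by (simp) Groebner_Basis.algebra
  have f0: "t * D1 x y - b * D2 x y + a * sg 1 (D1 x y) = 0" if x: "x = im \<theta>" and y: "y = im \<eta>" for x y \<theta> \<eta>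
  proof -
    have rx: "d * sg 2 x = e * sg 1 x - sg 1 d * x" and ry: "d * sg 2 y = e * sg 1 y - sg 1 d * y"
      using rec x y by simp_all
    have "d * (t * D1 x y - b * D2 x y + a * sg 1 (D1 x y)) = D1 x y * (t * d - b * e + a * sg 1 d)"
      unfolding D1_def D2_def using rx ry by (simp) Groebner_Basis.algebra
    then show ?thesis using f d by simp
  qed
  \<comment> \<open>\<open>im\<close> has no term in \<open>\<theta>\<close> itself, which gives
    \<open>q ^ 3\<close> instead of \<open>q ^ 4\<close>: the range then has at least
    \<open>q ^ 2\<close> elements, more than the multiples of one vector.\<close>
  have ker: "card {\<theta>. im \<theta> = 0} \<le> q ^ 3"
    using sg_kernel_bound'[of d e "- sg 3 e" "- sg 4 d"] d by (simp add: im_def)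
  have "\<exists>\<theta>. im \<theta> \<noteq> 0"
  proof (rule ccontr)
    assume "\<not> ?thesis"
    then have "{\<theta>. im \<theta> = 0} = UNIV" by auto
    then have "q ^ 5 \<le> q ^ 3" using ker card_field by simp
    then show False using q_ge_2 by (simp add: power_increasing_iff)
  qed
  then obtain \<theta> where x0: "im \<theta> \<noteq> 0" by blast
  have "range im \<subseteq> (\<lambda>c. c * im \<theta>) ` Fq q"
    using sc x0 f0 unfolding scat_def by fast
  then have "card (range im) \<le> q" using card_Fq
    by (metis card_image_le card_mono finite finite_imageI le_trans)
  then have "card (range im) * card {x. im x = 0} \<le> q * q ^ 3" using ker by (rule mult_le_mono)
  then have "q ^ 5 \<le> q * q ^ 3" using card_additive_kernel[OF Xadd] by linarith
  then have "q ^ 5 \<le> q ^ 4" by (simp add: numeral_eq_Suc)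
  then show False using q_ge_2 by (simp add: power_increasing_iff)
qed

text \<open>Prescribing the ratio \<open>sg 1 d / d = - x / a\<close> turns the Pluecker relation
  into an equation for \<open>x\<close>; Hilbert 90 recovers \<open>d\<close> because
  \<open>x\<close> has norm \<open>- n\<close>. The conjugates of \<open>\<delta>\<close> are kept
  apart so that the lemma also covers \<open>\<delta>\<close> outside the subfield.\<close>

lemma star_not_scat:
  assumes ab: "a \<noteq> 0" "b \<noteq> 0" and \<delta>: "\<delta> = b * sg 2 a * sg 4 a" and n: "n = norm5 q a"
    and x: "norm5 q x = - n"
    and star: "\<delta> * sg 1 \<delta> / n * sg 1 x - \<delta> * sg 1 \<delta> / (n * sg 3 \<delta>) * (x * sg 1 x * sg 2 x) * (1 - sg 3 x)
      + (1 - x) * (1 - sg 1 x) = 0"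
  shows "\<not> scat a b 1"
proof -
  have n0: "n \<noteq> 0" using ab by (simp add: n norm_eq_0)
  have "norm5 q (- x / a) = 1" using x n0 by (simp add: norm_div norm_minus flip: n)
  then obtain d where d: "d \<noteq> 0" "sg 1 d = - x / a * d" using hilbert90 by blast
  \<comment> \<open>Forced by the linear condition
    \<open>d - b * e + a * sg 1 d = 0\<close>.\<close>
  define e where "e = d * (1 - x) / b"
  define a0 a1 a2 a3 a4 b0 b1 b2 b3 b4 x0 x1 x2 x3 where s:
    "a0 = a" "a1 = sg 1 a" "a2 = sg 2 a" "a3 = sg 3 a" "a4 = sg 4 a" "b0 = b" "b1 = sg 1 b" "b2 = sg 2 b" "b3 = sg 3 b" "b4 = sg 4 b"
    "x0 = x" "x1 = sg 1 x" "x2 = sg 2 x" "x3 = sg 3 x"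
  have nz: "a0 \<noteq> 0" "a1 \<noteq> 0" "a2 \<noteq> 0" "a3 \<noteq> 0" "a4 \<noteq> 0" "b0 \<noteq> 0" "b1 \<noteq> 0" "b3 \<noteq> 0" using ab by (simp_all add: s)
  have d1: "sg 1 d = - x0 / a0 * d" using d by (simp add: s)
  have d1': "sg (Suc 0) d = - x / a * d" using d by simp
  have d2: "sg 2 d = - x1 / a1 * (- x0 / a0 * d)"
  proof -
    have "sg 2 d = sg 1 (sg 1 d)" by simp
    also have "\<dots> = sg 1 (- x0 / a0 * d)" by (simp only: d1)
    also have "\<dots> = - x1 / a1 * (- x0 / a0 * d)" by (simp add: s d1')
    finally show ?thesis .
  qed
  have d3: "sg 3 d = - x2 / a2 * (- x1 / a1 * (- x0 / a0 * d))"
  proof -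
    have "sg 3 d = sg 1 (sg 2 d)" by simp
    also have "\<dots> = sg 1 (- x1 / a1 * (- x0 / a0 * d))" by (simp only: d2)
    also have "\<dots> = - x2 / a2 * (- x1 / a1 * (- x0 / a0 * d))" by (simp add: s d1')
    finally show ?thesis .
  qed
  have e0: "e = d * (1 - x0) / b0" "sg 1 e = sg 1 d * (1 - x1) / b1" "sg 3 e = sg 3 d * (1 - x3) / b3"
    by (simp_all add: e_def s)
  have nn: "n = a0 * a1 * a2 * a3 * a4" by (simp add: n norm_sg s)
  have st: "b0 * a2 * a4 * (b1 * a3 * a0) / n * x1
     - b0 * a2 * a4 * (b1 * a3 * a0) / (n * (b3 * a0 * a2)) * (x0 * x1 * x2) * (1 - x3) + (1 - x0) * (1 - x1) = 0"
    using star by (simp add: \<delta> s mult_ac)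
  have st': "b0 * b1 / a1 * x1 - b0 * b1 / (b3 * (a0 * a1 * a2)) * (x0 * x1 * x2) * (1 - x3) + (1 - x0) * (1 - x1) = 0"
  proof -
    have "b0 * a2 * a4 * (b1 * a3 * a0) / n = b0 * b1 / a1"
      "b0 * a2 * a4 * (b1 * a3 * a0) / (n * (b3 * a0 * a2)) = b0 * b1 / (b3 * (a0 * a1 * a2))"
      using nz by (simp_all add: nn field_simps)
    then show ?thesis using st by simp
  qed
  have "d * sg 2 d - (e * sg 1 e + sg 3 e * sg 1 d) = d * d * x0 / (a0 * b0 * b1)
    * (b0 * b1 / a1 * x1 - b0 * b1 / (b3 * (a0 * a1 * a2)) * (x0 * x1 * x2) * (1 - x3) + (1 - x0) * (1 - x1))"
    unfolding e0(2,3) unfolding e0(1) d1 d2 d3 using nz by (simp add: divide_simps) Groebner_Basis.algebra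
  then have pl: "d * sg 2 d = e * sg 1 e + sg 3 e * sg 1 d" unfolding st' by simp
  have "1 * d - b * e + a * sg 1 d = 0" unfolding d(2) e_def using ab by (simp add: field_simps)
  then show ?thesis using pluecker_not_scat[OF d(1) pl] by blast
qed

end

context quintic_sigma
begin

section \<open>Trace duality\<close>

definition tr :: "'a \<Rightarrow> 'a" where "tr x = x + sg 1 x + sg 2 x + sg 3 x + sg 4 x"

lemma tr_add: "tr (x + y) = tr x + tr y" by (simp add: tr_def)
lemma tr_sg: "tr (sg 1 x) = tr x" "tr (sg 2 x) = tr x" "tr (sg 3 x) = tr x" "tr (sg 4 x) = tr x"
  by (simp_all add: tr_def add_ac)

lemma card_tr_kernel: "card {x. tr x = 0} < q ^ 5"
proof -
  have "card {x. tr x = 0} \<le> q ^ 4" using sg_kernel_bound[of 1 1 1 1 1] by (simp add: tr_def)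
  also have "\<dots> < q ^ 5" using q_ge_2 by (simp add: power_strict_increasing_iff)
  finally show ?thesis .
qed

lemma card_tr_mult: "card {x. tr (x * c) = 0} = (if c = 0 then q ^ 5 else card {x. tr x = 0})"
proof (cases "c = 0")
  case True
  then show ?thesis by (simp add: tr_def card_field)
next
  case False
  have "bij_betw (\<lambda>x. x * c) {x. tr (x * c) = 0} {x. tr x = 0}"
    by (rule bij_betwI[where g = "\<lambda>x. x / c"]) (use False in auto)
  then show ?thesis using False bij_betw_same_card by auto
qed

definition ff :: "'a \<Rightarrow> 'a \<Rightarrow> 'a \<Rightarrow> 'a \<Rightarrow> 'a" where
  "ff a b x y = D1 x y - b * D2 x y + a * sg 1 (D1 x y)"

definition PP :: "'a \<Rightarrow> 'a \<Rightarrow> 'a" where "PP a l = l + sg 4 a * sg 4 l"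

text \<open>\<open>GG a b l x\<close> represents the functional
  \<open>y \<mapsto> tr (l * ff a b x y)\<close> through the trace form. For each \<open>l\<close>
  this is an alternating form on a space of dimension 5 over the subfield, so its rank is 0, 2 or
  4.\<close>

definition GG :: "'a \<Rightarrow> 'a \<Rightarrow> 'a \<Rightarrow> 'a \<Rightarrow> 'a" where
  "GG a b l x = - PP a l * sg 1 x + b * l * sg 2 x - sg 3 (b * l) * sg 3 x + sg 4 (PP a l) * sg 4 x"

lemma tr_ff: "tr (l * ff a b x y) = tr (y * GG a b l x)"
proof -
  have "l * ff a b x y = (l * x) * sg 1 y - l * sg 1 x * y - (l * b * x) * sg 2 y + l * b * sg 2 x * y
     + (l * a * sg 1 x) * sg 2 y - (l * a * sg 2 x) * sg 1 y"
    by (simp add: ff_def D1_def D2_def algebra_simps)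
  moreover have "tr (u * sg 1 y) = tr (sg 4 u * y)" "tr (u * sg 2 y) = tr (sg 3 u * y)" for u
    using tr_sg(4)[of "u * sg 1 y"] tr_sg(3)[of "u * sg 2 y"] by simp_all
  moreover have "tr (u - v) = tr u - tr v" for u v by (simp add: tr_def)
  ultimately have "tr (l * ff a b x y) = tr (sg 4 (l * x) * y - l * sg 1 x * y - sg 3 (l * b * x) * y
     + l * b * sg 2 x * y + sg 3 (l * a * sg 1 x) * y - sg 4 (l * a * sg 2 x) * y)"
    by (simp only: tr_add)
  also have "\<dots> = tr (y * GG a b l x)"
    by (rule arg_cong[where f = tr]) (simp add: GG_def PP_def algebra_simps)
  finally show ?thesis .
qed

text \<open>Double counting of the triples \<open>(x, y, l)\<close> with \<open>tr (l * ff a b x y) = 0\<close>.\<close>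

lemma card_ff_GG: "card {(x, y). ff a b x y = 0} = card {(x, l). GG a b l x = 0}"
proof -
  define k where "k = card {x. tr x = 0}"
  have count: "(\<Sum>p\<in>UNIV. card {t. tr (t * h p) = 0}) + card {p. h p = 0} * k = card {p. h p = 0} * q ^ 5 + (q ^ 5 * q ^ 5) * k"
    for h :: "'a \<times> 'a \<Rightarrow> 'a"
  proof -
    have "(\<Sum>p\<in>UNIV. card {t. tr (t * h p) = 0}) = (\<Sum>p\<in>UNIV. if h p = 0 then q ^ 5 else k)"
      by (simp only: card_tr_mult k_def)
    also have "\<dots> = (\<Sum>p\<in>UNIV \<inter> {p. h p = 0}. q ^ 5) + (\<Sum>p\<in>UNIV \<inter> - {p. h p = 0}. k)"
      by (rule sum.If_cases) simp
    also have "\<dots> = card {p. h p = 0} * q ^ 5 + card {p. h p \<noteq> 0} * k"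
      by (simp only: sum_constant Int_UNIV_left Collect_neg_eq of_nat_id)
    finally have 1: "(\<Sum>p\<in>UNIV. card {t. tr (t * h p) = 0}) = card {p. h p = 0} * q ^ 5 + card {p. h p \<noteq> 0} * k" .
    have "UNIV = {p. h p = 0} \<union> {p. h p \<noteq> 0}" by auto
    then have "card (UNIV :: ('a \<times> 'a) set) = card {p. h p = 0} + card {p. h p \<noteq> 0}"
      by (metis (mono_tags, lifting) card_Un_disjoint disjoint_iff finite mem_Collect_eq)
    moreover have "card (UNIV :: ('a \<times> 'a) set) = q ^ 5 * q ^ 5"
      using card_cartesian_product[of "UNIV :: 'a set" "UNIV :: 'a set"] card_field by simp
    ultimately have "(q ^ 5 * q ^ 5) * k = card {p. h p = 0} * k + card {p. h p \<noteq> 0} * k"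
      by (simp only: add_mult_distrib)
    then show ?thesis unfolding 1 by simp
  qed
  have pairs: "(\<Sum>p\<in>UNIV. g (fst p) (snd p)) = (\<Sum>x\<in>UNIV. \<Sum>y\<in>UNIV. g x y)" for g :: "'a \<Rightarrow> 'a \<Rightarrow> nat"
    by (simp add: sum.cartesian_product split_def)
  have ifs: "card {t. P t} = (\<Sum>t\<in>UNIV. if P t then 1 else 0)" for P :: "'a \<Rightarrow> bool"
    by (simp add: sum.If_cases)
  have swap: "(\<Sum>p\<in>UNIV. card {t. tr (t * ff a b (fst p) (snd p)) = 0}) = (\<Sum>p\<in>UNIV. card {t. tr (t * GG a b (snd p) (fst p)) = 0})"
  proof -
    have "(\<Sum>p\<in>UNIV. card {t. tr (t * ff a b (fst p) (snd p)) = 0}) = (\<Sum>x\<in>UNIV. \<Sum>y\<in>UNIV. card {l. tr (l * ff a b x y) = 0})"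
      by (rule pairs)
    also have "\<dots> = (\<Sum>x\<in>UNIV. \<Sum>y\<in>UNIV. \<Sum>l\<in>UNIV. if tr (y * GG a b l x) = 0 then 1 else 0)"
      by (simp only: ifs tr_ff)
    also have "\<dots> = (\<Sum>x\<in>UNIV. \<Sum>l\<in>UNIV. \<Sum>y\<in>UNIV. if tr (y * GG a b l x) = 0 then 1 else 0)"
      by (rule sum.cong[OF refl], rule sum.swap)
    also have "\<dots> = (\<Sum>x\<in>UNIV. \<Sum>l\<in>UNIV. card {y. tr (y * GG a b l x) = 0})"
      by (simp only: ifs)
    also have "\<dots> = (\<Sum>p\<in>UNIV. card {t. tr (t * GG a b (snd p) (fst p)) = 0})"
      by (rule pairs[symmetric])
    finally show ?thesis .
  qed
  let ?A = "card {p. ff a b (fst p) (snd p) = 0}" and ?B = "card {p. GG a b (snd p) (fst p) = 0}"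
  define S where "S = (\<Sum>p\<in>UNIV. card {t. tr (t * ff a b (fst p) (snd p)) = 0})"
  have S: "S + ?A * k = ?A * q ^ 5 + (q ^ 5 * q ^ 5) * k" "S + ?B * k = ?B * q ^ 5 + (q ^ 5 * q ^ 5) * k"
    unfolding S_def by (rule count) (unfold swap, rule count)
  obtain m where m: "q ^ 5 = k + m" "m > 0"
    using card_tr_kernel unfolding k_def[symmetric] by (metis less_imp_add_positive)
  have "?A * m = ?B * m"
    using S unfolding m(1) by (simp add: distrib_left)
  then have "?A = ?B" using m by simp
  then show ?thesis by (simp add: split_def)
qed

lemma GG_add: "GG a b l (x + y) = GG a b l x + GG a b l y"
  by (simp add: GG_def algebra_simps)

lemma Fq_card_le: assumes "h w = 0" "w \<noteq> 0" "\<And>c. c \<in> Fq q \<Longrightarrow> h (c * w) = c * h w" shows "q \<le> card {x :: 'a. (h x :: 'a) = 0}"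
proof -
  have "card ((\<lambda>c. c * w) ` Fq q) = q"
    using assms card_Fq by (subst card_image) (auto intro: inj_onI)
  moreover have "(\<lambda>c. c * w) ` Fq q \<subseteq> {x. h x = 0}" using assms by auto
  ultimately show ?thesis by (metis card_mono finite)
qed

text \<open>The kernel vector is formed by the Pfaffians of the skew matrix of \<open>GG\<close>.\<close>

definition Pf :: "'a \<Rightarrow> 'a \<Rightarrow> 'a \<Rightarrow> 'a" where
  "Pf a b l = sg 1 (PP a l) * sg 3 (PP a l) - sg 1 (b * l) * sg 2 (b * l) + sg 4 (b * l) * sg 2 (PP a l)"

lemma GG_Pf: "GG a b l (Pf a b l) = 0"
proof -
  define P where "P = PP a l"
  define r where "r = b * l"
  show ?thesis unfolding GG_def Pf_def P_def[symmetric] r_def[symmetric]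
    by simp Groebner_Basis.algebra
qed

text \<open>With \<open>Pf\<close> all its conjugates vanish, that is, all 4 by 4 Pfaffians of the
  form. The rank is then at most two, and the image obeys a recurrence as in
  \<open>pluecker_not_scat\<close>.\<close>

lemma GG_rank_two:
  assumes "Pf a b l = 0"
  shows "PP a l * sg 2 (GG a b l x) + b * l * sg 1 (GG a b l x) + sg 1 (PP a l) * GG a b l x = 0"
proof -
  define P where "P = PP a l"
  define r where "r = b * l"
  have p1: "sg 1 P * sg 3 P - sg 1 r * sg 2 r + sg 4 r * sg 2 P = 0"
    using assms unfolding Pf_def P_def r_def .
  have "sg 4 (sg 1 P * sg 3 P - sg 1 r * sg 2 r + sg 4 r * sg 2 P) = 0" unfolding p1 by simp
  then have p2: "P * sg 2 P - r * sg 1 r + sg 3 r * sg 1 P = 0" by simp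
  have "sg 3 (sg 1 P * sg 3 P - sg 1 r * sg 2 r + sg 4 r * sg 2 P) = 0" unfolding p1 by simp
  then have p3: "sg 4 P * sg 1 P - sg 4 r * r + sg 2 r * P = 0" by simp
  show ?thesis unfolding GG_def P_def[symmetric] r_def[symmetric] using p1 p2 p3
    by simp Groebner_Basis.algebra
qed

text \<open>An alternating form in odd dimension is degenerate. Concretely, a nonzero
  \<open>Pf\<close> lies in the kernel; otherwise the form is zero or the recurrence of
  \<open>GG_rank_two\<close> bounds its range.\<close>

lemma card_ker_GG: "q \<le> card {x. GG a b l x = 0}"
proof (cases "Pf a b l = 0")
  case False
  have "GG a b l (c * w) = c * GG a b l w" if "c \<in> Fq q" for c w
    using Fq_sg[OF that] by (simp add: GG_def algebra_simps)
  then show ?thesis using Fq_card_le[where h = "GG a b l", OF GG_Pf False] by blast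
next
  case True
  show ?thesis
  proof (cases "PP a l = 0")
    case True
    then have "b * l = 0" using \<open>Pf a b l = 0\<close> by (simp add: Pf_def)
    then have "GG a b l x = 0" for x unfolding GG_def True \<open>b * l = 0\<close> by simp
    then have "card {x. GG a b l x = 0} = q ^ 5" using card_field by simp
    then show ?thesis using q_gt_0 self_le_power[of q 5] by simp
  next
    case False
    have "sg 1 (PP a l) * GG a b l x + b * l * sg 1 (GG a b l x) + PP a l * sg 2 (GG a b l x) = 0" for x
      using GG_rank_two[OF True, of x] by (simp only: add_ac)
    then have "range (GG a b l) \<subseteq> {v. sg 1 (PP a l) * v + b * l * sg 1 v + PP a l * sg 2 v = 0}" by blast
    then have "card (range (GG a b l)) \<le> card {v. sg 1 (PP a l) * v + b * l * sg 1 v + PP a l * sg 2 v = 0}"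
      by (intro card_mono) auto
    also have "\<dots> \<le> q ^ 4" using sg_kernel_bound[of "sg 1 (PP a l)" "b * l" "PP a l" 0 0] False by simp
    finally have "card (range (GG a b l)) * card {x. GG a b l x = 0} \<le> q ^ 4 * card {x. GG a b l x = 0}" by simp
    then have "q ^ 5 \<le> q ^ 4 * card {x. GG a b l x = 0}"
      using card_additive_kernel[of "GG a b l", OF GG_add] by linarith
    then have "q ^ 4 * q \<le> q ^ 4 * card {x. GG a b l x = 0}" by (simp add: numeral_eq_Suc mult_ac)
    then show ?thesis using q_gt_0 by simp
  qed
qed

text \<open>Scatteredness bounds the number of pairs with \<open>ff = 0\<close> by
  \<open>q ^ 5 + (q ^ 5 - 1) * q\<close>. By duality this number is the sum of the kernel sizes over
  all \<open>l\<close>; \<open>l = 0\<close> contributes \<open>q ^ 5\<close> and every other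
  \<open>l\<close> at least \<open>q\<close>, so none can contribute more.\<close>

lemma scat_imp_card_ker:
  assumes sc: "scat a b 1" and l: "l \<noteq> 0"
  shows "card {x. GG a b l x = 0} \<le> q"
proof (rule ccontr)
  assume *: "\<not> ?thesis"
  have le: "card {(x, y). ff a b x y = 0} \<le> q ^ 5 + (q ^ 5 - 1) * q"
  proof -
    have "{(x, y). ff a b x y = 0} \<subseteq> ({0} \<times> UNIV) \<union> (\<lambda>(x, c). (x, c * x)) ` ((UNIV - {0}) \<times> Fq q)"
      using sc unfolding scat_def ff_def by force
    then have "card {(x, y). ff a b x y = 0} \<le> card (({0 :: 'a} \<times> (UNIV :: 'a set)) \<union> (\<lambda>(x, c). (x, c * x)) ` ((UNIV - {0}) \<times> Fq q))"
      by (intro card_mono) auto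
    also have "\<dots> \<le> card ({0 :: 'a} \<times> (UNIV :: 'a set)) + card ((\<lambda>(x, c). (x, c * x)) ` ((UNIV - {0 :: 'a}) \<times> (Fq q :: 'a set)))"
      by (rule card_Un_le)
    also have "\<dots> \<le> q ^ 5 + card ((UNIV - {0 :: 'a}) \<times> (Fq q :: 'a set))"
      using card_image_le[of "(UNIV - {0 :: 'a}) \<times> (Fq q :: 'a set)" "\<lambda>(x, c). (x, c * x)"]
      by (simp add: card_cartesian_product card_field)
    also have "\<dots> = q ^ 5 + (q ^ 5 - 1) * q"
      by (simp add: card_cartesian_product card_Fq card_field card_Diff_singleton)
    finally show ?thesis .
  qed
  let ?k = "\<lambda>l. card {x. GG a b l x = 0}"
  have "card {(x, l). GG a b l x = 0} = (\<Sum>l\<in>UNIV. ?k l)"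
  proof -
    have "{(x, l). GG a b l x = 0} = (\<lambda>(l, x). (x, l)) ` (SIGMA l:UNIV. {x. GG a b l x = 0})" by auto
    also have "card \<dots> = card (SIGMA l:UNIV. {x. GG a b l x = 0})"
      by (intro card_image) (auto intro: inj_onI)
    also have "\<dots> = (\<Sum>l\<in>UNIV. ?k l)" by (intro card_SigmaI) auto
    finally show ?thesis .
  qed
  also have "\<dots> = ?k 0 + (\<Sum>m\<in>UNIV - {0}. ?k m)" by (subst sum.remove[of _ 0]) auto
  also have "(\<Sum>m\<in>UNIV - {0}. ?k m) = ?k l + (\<Sum>m\<in>UNIV - {0} - {l}. ?k m)" by (subst sum.remove[of _ l]) (use l in auto)
  also have "?k 0 = q ^ 5" by (simp add: GG_def PP_def card_field)
  finally have eq: "card {(x, l). GG a b l x = 0} = q ^ 5 + (?k l + (\<Sum>m\<in>UNIV - {0} - {l}. ?k m))" .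
  have "(\<Sum>m\<in>UNIV - {0} - {l}. q) \<le> (\<Sum>m\<in>UNIV - {0} - {l}. ?k m)" by (intro sum_mono card_ker_GG)
  moreover have "card (UNIV - {0 :: 'a} - {l}) = q ^ 5 - 2"
    using l by (simp add: card_Diff_singleton card_field)
  ultimately have "(q ^ 5 - 2) * q \<le> (\<Sum>m\<in>UNIV - {0} - {l}. ?k m)" by simp
  then have "q ^ 5 + (q + 1 + (q ^ 5 - 2) * q) \<le> q ^ 5 + (q ^ 5 - 1) * q"
    using * le eq card_ff_GG[of a b] by linarith
  moreover have "q + (q ^ 5 - 2) * q = (q ^ 5 - 1) * q"
  proof -
    have "2 \<le> q ^ 5" using q_ge_2 self_le_power[of q 5] by simp
    then obtain m where "q ^ 5 = m + 2" by (metis add.commute le_Suc_ex)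
    then show ?thesis by simp
  qed
  ultimately show False by linarith
qed

text \<open>Hilbert 90 provides \<open>l\<close> with \<open>PP a l = 0\<close>, and for
  \<open>b = 0\<close> the whole form \<open>GG\<close> then vanishes.\<close>

lemma LP_norm_one_not_scat:
  assumes "norm5 q (- a) = 1"
  shows "\<not> scat a 0 1"
proof
  assume sc: "scat a 0 1"
  obtain l where l: "l \<noteq> 0" "sg 1 l = - a * l" using hilbert90[OF assms] by blast
  have "sg 4 (sg 1 l) = sg 4 (- a * l)" using l by simp
  then have "PP a l = 0" by (simp add: PP_def eq_neg_iff_add_eq_0)
  then have "GG a 0 l x = 0" for x by (simp add: GG_def)
  then have "card {x. GG a 0 l x = 0} = q ^ 5" using card_field by simp
  then have "q ^ 5 \<le> q" using scat_imp_card_ker[OF sc l(1)] by simp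
  then show False using q_ge_2 power_increasing_iff[of q 5 1] by simp
qed

text \<open>Under \<open>sg 1 l = a * z * l\<close> the vanishing of \<open>Pf\<close> becomes the
  equation of \<open>curve_point\<close>, whose norm condition is the one Hilbert 90 asks for. The
  form then has rank at most two: for \<open>s = 1\<close> the recurrence has degree
  \<open>q ^ 2\<close>, which leaves a kernel of at least \<open>q ^ 3\<close> elements.\<close>

lemma curve_not_scat_1:
  assumes s1: "s = 1" and ab: "a \<noteq> 0" and \<delta>: "b * sg 2 a * sg 4 a \<notin> Fq q"
  shows "\<not> scat a b 1"
proof
  assume sc: "scat a b 1"
  define \<delta>' n where dn: "\<delta>' = b * sg 2 a * sg 4 a" "n = norm5 q a"
  have n0: "n \<noteq> 0" using ab by (simp add: dn norm_eq_0)
  have "n \<in> Fq q" using norm_Fq by (simp add: dn)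
  then obtain z where N: "n * norm5 q z = 1" and
    Q: "(1 + z) * (1 + z ^ (q ^ 2)) + \<delta>' ^ (q ^ 4) * z * z ^ (q ^ 2) * z ^ (q ^ 3) * (1 + z ^ q)
      = \<delta>' ^ q * \<delta>' ^ (q ^ 2) / n * z"
    using curve_point[of \<delta>' n] \<delta> n0 by (auto simp: dn)
  have "norm5 q (a * z) = 1" using N by (simp add: norm_mult dn)
  then obtain l where l: "l \<noteq> 0" "sg 1 l = a * z * l" using hilbert90 by blast
  define a0 a1 a2 a3 a4 b1 b2 b4 z0 z1 z2 z3 where s:
    "a0 = a" "a1 = sg 1 a" "a2 = sg 2 a" "a3 = sg 3 a" "a4 = sg 4 a" "b1 = sg 1 b" "b2 = sg 2 b" "b4 = sg 4 b"
    "z0 = z" "z1 = sg 1 z" "z2 = sg 2 z" "z3 = sg 3 z"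
  have nz: "a0 \<noteq> 0" "a1 \<noteq> 0" "a2 \<noteq> 0" "a3 \<noteq> 0" "a4 \<noteq> 0" using ab by (simp_all add: s)
  have l1': "sg (Suc 0) l = a * z * l" using l by simp
  have l1: "sg 1 l = a0 * z0 * l" using l by (simp add: s)
  have l2: "sg 2 l = a1 * z1 * (a0 * z0 * l)"
  proof -
    have "sg 2 l = sg 1 (sg 1 l)" by simp
    also have "\<dots> = sg 1 (a0 * z0 * l)" by (simp only: l1)
    finally show ?thesis by (simp add: s l1')
  qed
  have l3: "sg 3 l = a2 * z2 * (a1 * z1 * (a0 * z0 * l))"
  proof -
    have "sg 3 l = sg 1 (sg 2 l)" by simp
    also have "\<dots> = sg 1 (a1 * z1 * (a0 * z0 * l))" by (simp only: l2)
    finally show ?thesis by (simp add: s l1')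
  qed
  have l4: "sg 4 l = a3 * z3 * (a2 * z2 * (a1 * z1 * (a0 * z0 * l)))"
  proof -
    have "sg 4 l = sg 1 (sg 3 l)" by simp
    also have "\<dots> = sg 1 (a2 * z2 * (a1 * z1 * (a0 * z0 * l)))" by (simp only: l3)
    finally show ?thesis by (simp add: s l1')
  qed
  have Q': "(1 + z0) * (1 + z2) + (b4 * a1 * a3) * z0 * z2 * z3 * (1 + z1) = (b1 * a3 * a0) * (b2 * a4 * a1) / n * z0"
  proof -
    have "x ^ q = sg 1 x" "x ^ (q ^ 2) = sg 2 x" "x ^ (q ^ 3) = sg 3 x" "x ^ (q ^ 4) = sg 4 x" for x
      using sg_frob(1)[OF s1] by simp_all
    then have "(1 + z) * (1 + sg 2 z) + sg 4 \<delta>' * z * sg 2 z * sg 3 z * (1 + sg 1 z) = sg 1 \<delta>' * sg 2 \<delta>' / n * z"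
      using Q by simp
    then show ?thesis by (simp add: s dn(1) mult_ac)
  qed
  have nn: "n = a0 * a1 * a2 * a3 * a4" by (simp add: dn norm_sg s)
  have r: "(b1 * a3 * a0) * (b2 * a4 * a1) / n = b1 * b2 / a2" using nz by (simp add: nn field_simps)
  have "a2 * ((1 + z0) * (1 + z2) + (b4 * a1 * a3) * z0 * z2 * z3 * (1 + z1)) = a2 * (b1 * b2 / a2 * z0)"
    using Q' unfolding r by simp
  then have Q2: "a2 * ((1 + z0) * (1 + z2)) + a2 * ((b4 * a1 * a3) * z0 * z2 * z3 * (1 + z1)) = b1 * b2 * z0"
    using nz by (simp add: distrib_left[of a2])
  have P: "sg 1 (PP a l) = sg 1 l + a0 * l" "sg 2 (PP a l) = sg 2 l + a1 * sg 1 l" "sg 3 (PP a l) = sg 3 l + a2 * sg 2 l"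
    by (simp_all add: PP_def s)
  have "Pf a b l = a0 * l * (a1 * z1 * (a0 * z0 * l))
    * (a2 * ((1 + z0) * (1 + z2)) + a2 * ((b4 * a1 * a3) * z0 * z2 * z3 * (1 + z1)) - b1 * b2 * z0)"
  proof -
    have "Pf a b l = (sg 1 l + a0 * l) * (sg 3 l + a2 * sg 2 l) - (b1 * sg 1 l) * (b2 * sg 2 l) + (b4 * sg 4 l) * (sg 2 l + a1 * sg 1 l)"
      unfolding Pf_def P by (simp add: s)
    then show ?thesis unfolding l1 l2 l3 l4 by Groebner_Basis.algebra
  qed
  then have pf: "Pf a b l = 0" using Q2 by simp
  have z0: "z \<noteq> 0" using N by (auto simp: norm5_def)
  have PP0: "PP a l \<noteq> 0"
  proof
    assume P0: "PP a l = 0"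
    then have "b * l = 0" using pf by (simp add: Pf_def)
    then have "b = 0" using l by simp
    then show False using \<delta> Fq_1 by simp
  qed
  have sgq: "sg 1 v = v ^ q" "sg 2 v = v ^ (q ^ 2)" for v using sg_frob(1)[OF s1, of v] by simp_all
  have "sg 1 (PP a l) * GG a b l x + b * l * sg 1 (GG a b l x) + PP a l * sg 2 (GG a b l x) = 0" for x
    using GG_rank_two[OF pf, of x] by (simp only: add_ac)
  then have "range (GG a b l) \<subseteq> {v. sg 1 (PP a l) * v + b * l * sg 1 v + PP a l * sg 2 v = 0}" by blast
  then have "range (GG a b l) \<subseteq> {v. sg 1 (PP a l) * v + b * l * v ^ q + PP a l * v ^ (q ^ 2) = 0}"
    unfolding sgq(2) by (simp add: sgq(1)[simplified])
  then have "card (range (GG a b l)) \<le> card {v. sg 1 (PP a l) * v + b * l * v ^ q + PP a l * v ^ (q ^ 2) = 0}"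
    by (intro card_mono) auto
  also have "\<dots> \<le> q ^ 2" using additive_kernel_bound(3)[of "sg 1 (PP a l)" "b * l" "PP a l" 0 0] PP0 by simp
  finally have "card (range (GG a b l)) * card {x. GG a b l x = 0} \<le> q ^ 2 * q"
    using scat_imp_card_ker[OF sc l(1)] by (rule mult_le_mono)
  then have "q ^ 5 \<le> q ^ 2 * q" using card_additive_kernel[of "GG a b l", OF GG_add] by linarith
  then have "q ^ 5 \<le> q ^ 3" by (simp add: numeral_eq_Suc)
  then show False using q_ge_2 by (simp add: power_increasing_iff)
qed

text \<open>Here \<open>x \<mapsto> x ^ q\<close> is \<open>sg 2\<close>, and one application of
  \<open>sg 1\<close> turns the equation of \<open>curve_point\<close> directly into the Pluecker
  equation of \<open>star_not_scat\<close>.\<close>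

lemma curve_not_scat_3:
  assumes s3: "s = 3" and ab: "a \<noteq> 0" and \<delta>: "b * sg 2 a * sg 4 a \<notin> Fq q"
  shows "\<not> scat a b 1"
proof -
  define \<delta>' n where dn: "\<delta>' = b * sg 2 a * sg 4 a" "n = norm5 q a"
  define e0 e1 e2 e3 e4 where e: "e0 = \<delta>'" "e1 = sg 1 \<delta>'" "e2 = sg 2 \<delta>'" "e3 = sg 3 \<delta>'" "e4 = sg 4 \<delta>'"
  have "\<delta>' \<notin> Fq q" using \<delta> by (simp add: dn)
  then have "\<delta>' \<noteq> 0" using Fq_1 by auto
  then have ez: "e0 \<noteq> 0" "e1 \<noteq> 0" "e2 \<noteq> 0" "e3 \<noteq> 0" "e4 \<noteq> 0" by (simp_all add: e)
  have b0: "b \<noteq> 0" using \<open>\<delta>' \<noteq> 0\<close> by (auto simp: dn)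
  have n0: "n \<noteq> 0" using ab by (simp add: dn norm_eq_0)
  have nF: "n \<in> Fq q" using norm_Fq by (simp add: dn)
  \<comment> \<open>The parameter of the curve for which, with \<open>1 / n\<close> for
    \<open>n\<close> and \<open>- z\<close> for \<open>x\<close>, the coefficients
    \<open>sg 4 w\<close> and \<open>sg 3 w * w * n\<close> are those of
    \<open>star_not_scat\<close>.\<close>
  define w where "w = e1 * e2 / (n * e4)"
  have wn: "w \<notin> Fq q"
  proof
    assume "w \<in> Fq q"
    then have "sg 1 w = w" by (rule Fq_sg)
    then have "e2 * e3 / (n * e0) = e1 * e2 / (n * e4)" by (simp add: w_def e Fq_sg[OF nF])
    then have h: "e3 * e4 = e1 * e0" using ez n0 by (simp add: frac_eq_eq mult_ac)
    then have "sg 1 (e3 * e4) = sg 1 (e1 * e0)" by simp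
    then have "e4 * e0 = e2 * e1" by (simp add: e)
    then have "sg 1 (e4 * e0) = sg 1 (e2 * e1)" by simp
    then have "e0 * e1 = e3 * e2" by (simp add: e)
    with h have "e4 = e2" using ez by (metis mult.commute mult_left_cancel)
    then have "sg 1 e4 = sg 1 e2" "sg 3 e4 = sg 3 e2" by simp_all
    then have "e0 = e3" "e2 = e0" by (simp_all add: e)
    then have "e3 = e4" using \<open>e4 = e2\<close> by simp
    then have "sg 2 e3 = sg 2 e4" by simp
    then have "sg 1 \<delta>' = \<delta>'" by (simp add: e)
    then show False using sg_fixed_imp_Fq \<open>\<delta>' \<notin> Fq q\<close> by blast
  qed
  have n1: "1 / n \<in> Fq q" using Fq_div[OF Fq_1(1) nF] .
  obtain z where N: "1 / n * norm5 q z = 1" and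
    Q: "(1 + z) * (1 + z ^ (q ^ 2)) + w ^ (q ^ 4) * z * z ^ (q ^ 2) * z ^ (q ^ 3) * (1 + z ^ q)
      = w ^ q * w ^ (q ^ 2) / (1 / n) * z"
    using curve_point[OF wn n1] n0 by auto
  have f: "x ^ q = sg 2 x" "x ^ (q ^ 2) = sg 4 x" "x ^ (q ^ 3) = sg 1 x" "x ^ (q ^ 4) = sg 3 x" for x
    using sg_frob(3)[OF s3] by simp_all
  have Q2: "(1 + z) * (1 + sg 4 z) + sg 3 w * z * sg 4 z * sg 1 z * (1 + sg 2 z) = sg 2 w * sg 4 w * n * z"
    using Q by (simp add: f)
  have "sg 1 ((1 + z) * (1 + sg 4 z) + sg 3 w * z * sg 4 z * sg 1 z * (1 + sg 2 z)) = sg 1 (sg 2 w * sg 4 w * n * z)"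
    using Q2 by simp
  then have Q3: "(1 + sg 1 z) * (1 + z) + sg 4 w * sg 1 z * z * sg 2 z * (1 + sg 3 z) = sg 3 w * w * n * sg 1 z"
    by (simp add: Fq_sg[OF nF])
  have w4: "sg 4 w = e0 * e1 / (n * e3)" "sg 3 w * w * n = e0 * e1 / n"
    using ez n0 by (simp_all add: w_def e Fq_sg[OF nF] field_simps)
  have "norm5 q (- z) = - n" using N n0 by (simp add: norm_minus field_simps)
  moreover have "\<delta>' * sg 1 \<delta>' / n * sg 1 (- z) - \<delta>' * sg 1 \<delta>' / (n * sg 3 \<delta>') * (- z * sg 1 (- z) * sg 2 (- z)) * (1 - sg 3 (- z))
      + (1 - - z) * (1 - sg 1 (- z)) = 0"
    using Q3 unfolding w4 by (simp add: e algebra_simps)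
  ultimately show ?thesis
    using star_not_scat[OF ab b0 dn, of "- z"] by blast
qed

end

section \<open>Kernels with a zero coordinate, the inverse generator and the two
  factorisations\<close>

context quintic_sigma
begin

text \<open>A power of Frobenius carries the equation of a generator to that of its inverse; so
  \<open>pentagon_point\<close> settles \<open>s = 1\<close> and \<open>s = 4\<close>, and
  \<open>pentagram_point\<close> settles \<open>s = 2\<close> and \<open>s = 3\<close>.\<close>

lemma sigma_pentagon_point:
  assumes b: "\<beta> \<in> Fq q" "\<beta> \<noteq> 0"
  shows "\<exists>x. \<beta> ^ 2 * norm5 q x = 1 \<and> sg 1 x * (1 + \<beta> * x * sg 2 x) = 1"
proof -
  have bf: "\<beta> ^ (q ^ i) = \<beta>" for i using Fq_frob[OF b(1)] .
  obtain z where z: "\<beta> ^ 2 * norm5 q z = 1" "z ^ q * (1 + \<beta> * z * z ^ (q ^ 2)) = 1"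
    using pentagon_point[OF b] by blast
  obtain u where u: "\<beta> ^ 4 * norm5 q u = 1"
    "1 + \<beta> ^ 5 * u * (u ^ q) ^ 2 * (u ^ (q ^ 2)) ^ 2 * u ^ (q ^ 3) = \<beta> ^ 2 * u ^ q * u ^ (q ^ 2)"
    using pentagram_point[OF b] by blast
  define x where "x = \<beta> ^ 2 * u * u ^ q * u ^ (q ^ 2)"
  have b2: "(\<beta> ^ 2) ^ (q ^ i) = \<beta> ^ 2" for i by (metis bf power_mult mult.commute)
  have fr: "(y ^ q) ^ (q ^ i) = y ^ (q ^ (Suc i))" "(y ^ (q ^ j)) ^ (q ^ i) = y ^ (q ^ (j + i))" for y :: 'a and i j
    using power_frob_pow[of y q 1 i] power_frob_pow[of y q j i] by simp_all
  have x1: "x ^ q = \<beta> ^ 2 * u ^ q * u ^ (q ^ 2) * u ^ (q ^ 3)"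
    using fr(1)[of u 1] fr(2)[of u 2 1] b2[of 1] by (simp add: x_def power_mult_distrib numeral_eq_Suc)
  have x3: "x ^ (q ^ 3) = \<beta> ^ 2 * u ^ (q ^ 3) * u ^ (q ^ 4) * u"
    using fr(1)[of u 3] fr(2)[of u 2 3] b2[of 3] power_field[of u] by (simp add: x_def power_mult_distrib)
  have xN: "\<beta> ^ 2 * norm5 q x = 1"
  proof -
    have "norm5 q (y ^ (q ^ i)) = norm5 q y" for y :: 'a and i
      using Fq_frob[OF norm_Fq[of y], of i] unfolding norm5_nq by (simp add: mult.commute flip: power_mult)
    from this[of u 1] this[of u 2] have "norm5 q x = norm5 q (\<beta> ^ 2) * norm5 q u ^ 3"
      by (simp add: x_def norm_mult power3_eq_cube)
    also have "norm5 q (\<beta> ^ 2) = \<beta> ^ 10"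
      using norm_of_Fq[of "\<beta> ^ 2"] b2[of 1] by (simp add: Fq_iff flip: power_mult)
    finally have "\<beta> ^ 2 * norm5 q x = (\<beta> ^ 4 * norm5 q u) ^ 3" by (simp add: power_mult_distrib flip: power_mult power_add)
    then show ?thesis using u by simp
  qed
  have x0: "x ^ (q ^ 3) * (1 + \<beta> * x * x ^ q) = 1"
  proof -
    have "1 + \<beta> * x * x ^ q = 1 + \<beta> ^ 5 * u * (u ^ q) ^ 2 * (u ^ (q ^ 2)) ^ 2 * u ^ (q ^ 3)"
      unfolding x1 by (simp add: x_def algebra_simps numeral_eq_Suc)
    then have "x ^ (q ^ 3) * (1 + \<beta> * x * x ^ q) = \<beta> ^ 2 * u ^ (q ^ 3) * u ^ (q ^ 4) * u * (\<beta> ^ 2 * u ^ q * u ^ (q ^ 2))"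
      unfolding x3 u(2) by simp
    also have "\<dots> = \<beta> ^ 4 * norm5 q u" by (simp add: norm_expand algebra_simps numeral_eq_Suc)
    finally show ?thesis using u by simp
  qed
  from sg_cases show ?thesis
  proof (elim disjE)
    assume "\<forall>x. sg 1 x = x ^ q \<and> sg 2 x = x ^ (q ^ 2) \<and> sg 3 x = x ^ (q ^ 3) \<and> sg 4 x = x ^ (q ^ 4)"
    then show ?thesis using z by (intro exI[of _ z]) simp
  next
    assume *: "\<forall>x. sg 1 x = x ^ (q ^ 2) \<and> sg 2 x = x ^ (q ^ 4) \<and> sg 3 x = x ^ q \<and> sg 4 x = x ^ (q ^ 3)"
    have "(x ^ (q ^ 3) * (1 + \<beta> * x * x ^ q)) ^ (q ^ 4) = 1" using x0 by simp
    then have "x ^ (q ^ 7) * (1 + \<beta> * x ^ (q ^ 4) * x ^ (q ^ 5)) = 1"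
      by (simp add: power_mult_distrib frob_add bf fr(2) fr(1) del: fr(1)) (simp add: fr(1))
    then have "x ^ (q ^ 2) * (1 + \<beta> * x * x ^ (q ^ 4)) = 1"
      using frob_period[of x 2] power_field[of x] by (simp add: mult_ac)
    then show ?thesis using xN * by (intro exI[of _ x]) simp
  next
    assume "\<forall>x. sg 1 x = x ^ (q ^ 3) \<and> sg 2 x = x ^ q \<and> sg 3 x = x ^ (q ^ 4) \<and> sg 4 x = x ^ (q ^ 2)"
    then show ?thesis using xN x0 by (intro exI[of _ x]) simp
  next
    assume *: "\<forall>x. sg 1 x = x ^ (q ^ 4) \<and> sg 2 x = x ^ (q ^ 3) \<and> sg 3 x = x ^ (q ^ 2) \<and> sg 4 x = x ^ q"
    have "(z ^ q * (1 + \<beta> * z * z ^ (q ^ 2))) ^ (q ^ 3) = 1" using z by simp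
    then have "z ^ (q ^ 4) * (1 + \<beta> * z ^ (q ^ 3) * z ^ (q ^ 5)) = 1"
      using fr(1)[of z 3] fr(2)[of z 2 3] by (simp add: power_mult_distrib frob_add bf)
    then show ?thesis using z * power_field[of z] by (intro exI[of _ z]) (simp add: mult_ac)
  qed
qed

text \<open>The linear condition gives \<open>e = d / b\<close>. The ratio
  \<open>sg 1 d / d = x / (sg 4 b * b)\<close> absorbs the conjugates of \<open>b\<close>, and the
  Pluecker relation becomes the pentagon equation, with the norm of \<open>b\<close> as its only
  parameter.\<close>

lemma binomial_not_scat:
  assumes b: "b \<noteq> 0"
  shows "\<not> scat 0 b 1"
proof -
  define \<beta> where "\<beta> = - 1 / norm5 q b"
  have nb: "norm5 q b \<noteq> 0" using b by (simp add: norm_eq_0)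
  have "\<beta> \<in> Fq q" unfolding \<beta>_def by (intro Fq_div Fq_minus Fq_1 norm_Fq)
  moreover have "\<beta> \<noteq> 0" using nb by (simp add: \<beta>_def)
  ultimately obtain x where x: "\<beta> ^ 2 * norm5 q x = 1" "sg 1 x * (1 + \<beta> * x * sg 2 x) = 1"
    using sigma_pentagon_point by blast
  have "norm5 q (x / (sg 4 b * b)) = 1"
  proof -
    have "norm5 q (sg 4 b) = norm5 q b" by (simp add: norm_sg mult_ac)
    then have "norm5 q (x / (sg 4 b * b)) = norm5 q x / norm5 q b ^ 2" by (simp add: norm_div norm_mult power2_eq_square)
    also have "\<dots> = \<beta> ^ 2 * norm5 q x" using nb by (simp add: \<beta>_def field_simps)
    finally show ?thesis using x by simp
  qed
  then obtain d where d: "d \<noteq> 0" "sg 1 d = x / (sg 4 b * b) * d" using hilbert90 by blast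
  define b0 b1 b2 b3 b4 x0 x1 x2 where s:
    "b0 = b" "b1 = sg 1 b" "b2 = sg 2 b" "b3 = sg 3 b" "b4 = sg 4 b" "x0 = x" "x1 = sg 1 x" "x2 = sg 2 x"
  have nz: "b0 \<noteq> 0" "b1 \<noteq> 0" "b2 \<noteq> 0" "b3 \<noteq> 0" "b4 \<noteq> 0" using b by (simp_all add: s)
  have d1: "sg 1 d = x0 / (b4 * b0) * d" using d by (simp add: s)
  have d1': "sg (Suc 0) d = x / (sg 4 b * b) * d" using d by simp
  have d2: "sg 2 d = x1 / (b0 * b1) * (x0 / (b4 * b0) * d)"
  proof -
    have "sg 2 d = sg 1 (sg 1 d)" by simp
    also have "\<dots> = sg 1 (x0 / (b4 * b0) * d)" by (simp only: d1)
    finally show ?thesis by (simp add: s d1')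
  qed
  have d3: "sg 3 d = x2 / (b1 * b2) * (x1 / (b0 * b1) * (x0 / (b4 * b0) * d))"
  proof -
    have "sg 3 d = sg 1 (sg 2 d)" by simp
    also have "\<dots> = sg 1 (x1 / (b0 * b1) * (x0 / (b4 * b0) * d))" by (simp only: d2)
    finally show ?thesis by (simp add: s d1')
  qed
  define e where "e = d / b"
  have e: "e = d / b0" "sg 1 e = sg 1 d / b1" "sg 3 e = sg 3 d / b3" by (simp_all add: e_def s)
  have eq: "x1 * (b0 * b1 * b2 * b3 * b4) - x0 * x1 * x2 = b0 * b1 * b2 * b3 * b4"
  proof -
    have "x1 * (1 + (- 1 / (b0 * b1 * b2 * b3 * b4)) * x0 * x2) = 1"
      using x(2) by (simp add: \<beta>_def norm_sg s)
    then show ?thesis using nz by (simp add: divide_simps) Groebner_Basis.algebra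
  qed
  have pl: "d * sg 2 d = e * sg 1 e + sg 3 e * sg 1 d"
    unfolding e(2,3) unfolding e(1) d1 d2 d3 using nz eq by (simp add: divide_simps) Groebner_Basis.algebra
  have "1 * d - b * e + 0 * sg 1 d = 0" using b by (simp add: e_def)
  then show ?thesis using pluecker_not_scat[OF d(1) pl] by blast
qed

text \<open>As for the kernel \<open>(0, b, 1)\<close>, now with \<open>e = (a / b) * sg 1 d\<close>
  and the inverse ratio; the Pluecker relation matches the pentagon equation after one use of the
  norm condition.\<close>

lemma binomial_not_scat':
  assumes ab: "a \<noteq> 0" "b \<noteq> 0"
  shows "\<not> scat a b 0"
proof -
  define B where "B = a / b"
  have B: "B \<noteq> 0" using ab by (simp add: B_def)
  define \<beta> where "\<beta> = - norm5 q B"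
  have nb: "norm5 q B \<noteq> 0" using B by (simp add: norm_eq_0)
  have "\<beta> \<in> Fq q" unfolding \<beta>_def by (intro Fq_minus norm_Fq)
  moreover have "\<beta> \<noteq> 0" using nb by (simp add: \<beta>_def)
  ultimately obtain x where x: "\<beta> ^ 2 * norm5 q x = 1" "sg 1 x * (1 + \<beta> * x * sg 2 x) = 1"
    using sigma_pentagon_point by blast
  have x0: "x \<noteq> 0" using x by auto
  have "norm5 q (1 / (B * sg 1 B * x)) = 1"
  proof -
    have "norm5 q (sg 1 B) = norm5 q B" by (simp add: norm_sg mult_ac)
    then have "norm5 q (B * sg 1 B * x) = \<beta> ^ 2 * norm5 q x" by (simp add: norm_mult power2_eq_square \<beta>_def)
    moreover have "norm5 q (1 :: 'a) = 1" by (simp add: norm5_def)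
    ultimately show ?thesis using x by (simp add: norm_div)
  qed
  then obtain d where d: "d \<noteq> 0" "sg 1 d = 1 / (B * sg 1 B * x) * d" using hilbert90 by blast
  define B0 B1 B2 B3 B4 x0 x1 x2 x3 where s:
    "B0 = B" "B1 = sg 1 B" "B2 = sg 2 B" "B3 = sg 3 B" "B4 = sg 4 B" "x0 = x" "x1 = sg 1 x" "x2 = sg 2 x" "x3 = sg 3 x"
  have nz: "B0 \<noteq> 0" "B1 \<noteq> 0" "B2 \<noteq> 0" "B3 \<noteq> 0" "B4 \<noteq> 0" "x0 \<noteq> 0" "x1 \<noteq> 0" "x2 \<noteq> 0" "x3 \<noteq> 0"
    using B \<open>x \<noteq> 0\<close> by (simp_all add: s)
  have d1: "sg 1 d = 1 / (B0 * B1 * x0) * d" using d by (simp add: s)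
  have d1': "sg (Suc 0) d = 1 / (B * sg 1 B * x) * d" using d by simp
  have d2: "sg 2 d = 1 / (B1 * B2 * x1) * (1 / (B0 * B1 * x0) * d)"
  proof -
    have "sg 2 d = sg 1 (sg 1 d)" by simp
    also have "\<dots> = sg 1 (1 / (B0 * B1 * x0) * d)" by (simp only: d1)
    finally show ?thesis by (simp add: s d1')
  qed
  have d3: "sg 3 d = 1 / (B2 * B3 * x2) * (1 / (B1 * B2 * x1) * (1 / (B0 * B1 * x0) * d))"
  proof -
    have "sg 3 d = sg 1 (sg 2 d)" by simp
    also have "\<dots> = sg 1 (1 / (B1 * B2 * x1) * (1 / (B0 * B1 * x0) * d))" by (simp only: d2)
    finally show ?thesis by (simp add: s d1')
  qed
  have d4: "sg 4 d = 1 / (B3 * B4 * x3) * (1 / (B2 * B3 * x2) * (1 / (B1 * B2 * x1) * (1 / (B0 * B1 * x0) * d)))"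
  proof -
    have "sg 4 d = sg 1 (sg 3 d)" by simp
    also have "\<dots> = sg 1 (1 / (B2 * B3 * x2) * (1 / (B1 * B2 * x1) * (1 / (B0 * B1 * x0) * d)))" by (simp only: d3)
    finally show ?thesis by (simp add: s d1')
  qed
  define e where "e = B * sg 1 d"
  have e: "e = B0 * sg 1 d" "sg 1 e = B1 * sg 2 d" "sg 3 e = B3 * sg 4 d" by (simp_all add: e_def s)
  have nB: "norm5 q B = B0 * B1 * B2 * B3 * B4" by (simp add: norm_sg s)
  have nx: "(B0 * B1 * B2 * B3 * B4) ^ 2 * (x0 * x1 * x2 * x3 * sg 4 x) = 1"
    using x(1) by (simp add: \<beta>_def nB) (simp add: norm_sg s)
  have eq4: "x0 * (1 - B0 * B1 * B2 * B3 * B4 * sg 4 x * x1) = 1"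
  proof -
    have "sg 4 (sg 1 x * (1 + \<beta> * x * sg 2 x)) = sg 4 1" using x(2) by simp
    moreover have "sg 4 \<beta> = \<beta>" using Fq_sg[OF \<open>\<beta> \<in> Fq q\<close>] .
    ultimately have "x * (1 + \<beta> * sg 4 x * sg 1 x) = 1" by simp
    then show ?thesis by (simp add: \<beta>_def nB s(6,7))
  qed
  have eq: "(x0 - 1) * (B0 * B1 * B2 * B3 * B4) * x2 * x3 = 1"
    using eq4 nx nz by Groebner_Basis.algebra
  have pl: "d * sg 2 d = e * sg 1 e + sg 3 e * sg 1 d"
    unfolding e(2,3) unfolding e(1) d1 d2 d4 using nz eq by (simp add: divide_simps) Groebner_Basis.algebra
  have "0 * d - b * e + a * sg 1 d = 0" using ab by (simp add: e_def B_def)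
  then show ?thesis using pluecker_not_scat[OF d(1) pl] by blast
qed

text \<open>Replacing \<open>s\<close> by \<open>5 - s\<close> inverts the generator, which reverses
  the triple \<open>(x, sg 1 x, sg 2 x)\<close> and with it the kernel: \<open>(a, b, 1)\<close>
  becomes \<open>(1, b, a)\<close>, rescaled by \<open>1 / a\<close>.\<close>

lemma scat_mirror:
  assumes sc: "scat a b 1" and a: "a \<noteq> 0"
  shows "quintic_sigma.scat q (5 - s) (1 / a) (b / a) 1"
proof -
  interpret m: quintic_sigma q TYPE_a "5 - s" by unfold_locales (use s_ge s_le in auto)
  have inv: "sg i (m.sg i x) = x" for i x
  proof -
    have "(5 - s) * i + s * i = 5 * i" using s_le by (simp flip: add_mult_distrib)
    then have "sg i (m.sg i x) = x ^ (q ^ (5 * i))" by (simp add: sg_def m.sg_def power_frob_pow)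
    also have "\<dots> = x"
    proof (induction i)
      case (Suc i)
      then show ?case using frob_period[of x "5 * i"] by (simp add: add.commute)
    qed simp
    finally show ?thesis .
  qed
  have inv1: "sg 1 (m.sg 2 x) = m.sg 1 x" for x
    using inv[of 1 "m.sg 1 x"] by simp
  show ?thesis unfolding m.scat_def
  proof (intro allI impI)
    fix \<xi> \<eta> assume \<xi>: "\<xi> \<noteq> 0" and f: "1 * m.D1 \<xi> \<eta> - b / a * m.D2 \<xi> \<eta> + 1 / a * m.sg 1 (m.D1 \<xi> \<eta>) = 0"
    define x y where xy: "x = m.sg 2 \<xi>" "y = m.sg 2 \<eta>"
    have xs: "sg 1 x = m.sg 1 \<xi>" "sg 2 x = \<xi>" "sg 1 y = m.sg 1 \<eta>" "sg 2 y = \<eta>"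
      by (simp_all only: xy inv inv1)
    have D: "D1 x y = - m.sg 1 (m.D1 \<xi> \<eta>)" "D2 x y = - m.D2 \<xi> \<eta>" "sg 1 (D1 x y) = - m.D1 \<xi> \<eta>"
    proof -
      have "D1 x y = x * m.sg 1 \<eta> - m.sg 1 \<xi> * y" by (simp only: D1_def xs)
      then show "D1 x y = - m.sg 1 (m.D1 \<xi> \<eta>)" unfolding m.D1_def xy by simp
      have "D2 x y = x * \<eta> - \<xi> * y" by (simp only: D2_def xs)
      then show "D2 x y = - m.D2 \<xi> \<eta>" unfolding m.D2_def xy by simp
      have "sg 1 (D1 x y) = sg 1 x * sg 2 y - sg 2 x * sg 1 y" by (simp add: D1_def)
      then show "sg 1 (D1 x y) = - m.D1 \<xi> \<eta>" unfolding xs m.D1_def by simp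
    qed
    have "1 * D1 x y - b * D2 x y + a * sg 1 (D1 x y) = - a * (1 * m.D1 \<xi> \<eta> - b / a * m.D2 \<xi> \<eta> + 1 / a * m.sg 1 (m.D1 \<xi> \<eta>))"
      unfolding D(3) unfolding D(1,2) using a by (simp add: field_simps)
    then have "1 * D1 x y - b * D2 x y + a * sg 1 (D1 x y) = 0" using f by simp
    moreover have "x \<noteq> 0" using \<xi> xy by simp
    ultimately obtain c where c: "c \<in> Fq q" "y = c * x" using sc unfolding scat_def by blast
    then have "sg 2 y = sg 2 (c * x)" by simp
    then have "\<eta> = c * \<xi>" using xs Fq_sg[OF c(1)] by simp
    then show "\<exists>c\<in>Fq q. \<eta> = c * \<xi>" using c by blast
  qed
qed

lemma scat_imp_delta_Fq:
  assumes sc: "scat a b 1" and a: "a \<noteq> 0"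
  shows "b * sg 2 a * sg 4 a \<in> Fq q"
proof (rule ccontr)
  assume \<delta>: "b * sg 2 a * sg 4 a \<notin> Fq q"
  interpret m: quintic_sigma q TYPE_a "5 - s" by unfold_locales (use s_ge s_le in auto)
  have msg: "m.sg 2 x = sg 3 x" "m.sg 4 x = sg 1 x" for x
    using s_cases sg_frob[of x] m.sg_frob[of x] by auto
  \<comment> \<open>The inverse generator divides the invariant by \<open>norm5 q a\<close>, which
    lies in the subfield.\<close>
  have m\<delta>: "b / a * m.sg 2 (1 / a) * m.sg 4 (1 / a) \<notin> Fq q"
  proof
    assume *: "b / a * m.sg 2 (1 / a) * m.sg 4 (1 / a) \<in> Fq q"
    have "b / a * m.sg 2 (1 / a) * m.sg 4 (1 / a) * norm5 q a = b * sg 2 a * sg 4 a"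
      unfolding msg norm_sg using a by (simp add: field_simps)
    then show False using \<delta> Fq_mult[OF * norm_Fq[of a]] by simp
  qed
  have msc: "m.scat (1 / a) (b / a) 1" by (rule scat_mirror[OF sc a])
  from s_cases show False
  proof (elim disjE)
    assume "s = 1" then show False using curve_not_scat_1[OF _ a \<delta>] sc by blast
  next
    assume "s = 3" then show False using curve_not_scat_3[OF _ a \<delta>] sc by blast
  next
    assume "s = 4"
    then show False using m.curve_not_scat_1[OF _ _ m\<delta>] msc a by simp
  next
    assume "s = 2"
    then show False using m.curve_not_scat_3[OF _ _ m\<delta>] msc a by simp
  qed
qed

text \<open>The kernel \<open>(\<nu> * sg 1 \<nu>, sg 1 \<nu>, 1)\<close> is annihilated by the
  functional \<open>y - \<nu> * sg 1 y\<close> and by its image under \<open>sg 1\<close>, which is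
  the pseudoregulus form.\<close>

lemma pseudoregulus_factor:
  assumes a: "a \<noteq> 0" and \<delta>: "\<delta> = b * sg 2 a * sg 4 a" "\<delta> \<in> Fq q" "\<delta> ^ 2 = norm5 q a"
  shows "\<exists>\<nu>. a = \<nu> * sg 1 \<nu> \<and> b = sg 1 \<nu>"
proof -
  define \<nu> where "\<nu> = \<delta> / (sg 1 a * sg 3 a)"
  have nu1: "sg 1 \<nu> = \<delta> / (sg 2 a * sg 4 a)" by (simp add: \<nu>_def Fq_sg[OF \<delta>(2)])
  have "\<nu> * sg 1 \<nu> = \<delta> ^ 2 / (sg 1 a * sg 3 a * (sg 2 a * sg 4 a))" unfolding nu1 by (simp add: \<nu>_def power2_eq_square)
  also have "\<dots> = a" unfolding \<delta>(3) norm_sg using a by (simp add: field_simps)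
  finally have "a = \<nu> * sg 1 \<nu>" by simp
  moreover have "b = sg 1 \<nu>" unfolding nu1 \<delta>(1) using a by simp
  ultimately show ?thesis by blast
qed

text \<open>The cubic curve \<open>\<delta>\<^sup>3 + (1 - 3 \<delta>) n + n\<^sup>2 = 0\<close> is rational with the parametrisation
  \<open>\<delta> = - m - m\<^sup>2\<close>, \<open>n = m\<^sup>3\<close>.\<close>

lemma LP_factor:
  assumes a: "a \<noteq> 0" and \<delta>: "\<delta> = b * sg 2 a * sg 4 a" "\<delta> \<in> Fq q" "\<delta> \<noteq> 0" and n: "n = norm5 q a"
    and ne: "\<delta> ^ 2 \<noteq> n" and cubic: "\<delta> ^ 3 + (1 - 3 * \<delta>) * n + n ^ 2 = 0"
  shows "\<exists>c. c \<noteq> 0 \<and> norm5 q (- c) \<noteq> 1 \<and> a * (c * sg 1 c * sg 4 c) = 1 \<and> b = - (sg 3 c + a / sg 2 c)"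
proof -
  have nz: "n \<noteq> 0" using a by (simp add: n norm_eq_0)
  have nF: "n \<in> Fq q" using norm_Fq by (simp add: n)
  define u where "u = \<delta> ^ 2 - n"
  have u0: "u \<noteq> 0" using ne by (simp add: u_def)
  \<comment> \<open>On the parametrised cubic
    \<open>\<delta> ^ 2 - n = m ^ 2 * (1 + m + m ^ 2)\<close> and
    \<open>n * (1 - \<delta>) = m ^ 3 * (1 + m + m ^ 2)\<close>, so the parameter is this
    quotient.\<close>
  define m where "m = n * (1 - \<delta>) / u"
  have mu: "m * u = n * (1 - \<delta>)" using u0 by (simp add: m_def)
  have mF: "sg i m = m" for i using Fq_sg[OF nF, of i] Fq_sg[OF \<delta>(2), of i] by (simp add: m_def u_def)
  have m3: "m ^ 3 = n"
  proof -
    have "u ^ 3 * m ^ 3 = (n * (1 - \<delta>)) ^ 3" unfolding mu[symmetric] by (simp add: power_mult_distrib mult.commute)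
    also have "\<dots> = n * u ^ 3" unfolding u_def using cubic by Groebner_Basis.algebra
    finally show ?thesis using u0 by simp
  qed
  have m\<delta>: "\<delta> = - m - m ^ 2"
  proof -
    have "u ^ 2 * (\<delta> + m + m ^ 2) = \<delta> * u ^ 2 + (m * u) * u + (m * u) ^ 2" by (simp add: algebra_simps power2_eq_square)
    also have "\<dots> = 0" unfolding mu unfolding u_def using cubic by Groebner_Basis.algebra
    finally have "\<delta> + m + m ^ 2 = 0" using u0 by simp
    then show ?thesis by (simp add: algebra_simps eq_neg_iff_add_eq_0)
  qed
  have m0: "m \<noteq> 0" using m3 nz by auto
  \<comment> \<open>Chosen so that \<open>a * (c * sg 1 c * sg 4 c)\<close> collapses to
    \<open>m ^ 3 / n\<close>.\<close>
  define c where "c = m / (sg 1 a * sg 4 a)"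
  have c: "sg 1 c = m / (sg 2 a * a)" "sg 2 c = m / (sg 3 a * sg 1 a)" "sg 3 c = m / (sg 4 a * sg 2 a)" "sg 4 c = m / (a * sg 3 a)"
    by (simp_all add: c_def mF)
  have nn: "m ^ 3 = a * sg 1 a * sg 2 a * sg 3 a * sg 4 a" using m3 by (simp add: n norm_sg)
  have nza: "sg i a \<noteq> 0" for i using a by simp
  have 1: "a * (c * sg 1 c * sg 4 c) = 1"
  proof -
    have "a * (c * sg 1 c * sg 4 c) = m ^ 3 / (a * sg 1 a * sg 2 a * sg 3 a * sg 4 a)"
      unfolding c unfolding c_def using nza[of 0] by (simp add: field_simps power3_eq_cube)
    then show ?thesis using m3 nz nn by simp
  qed
  have 2: "b = - (sg 3 c + a / sg 2 c)"
  proof -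
    have "a / sg 2 c = m ^ 2 / (sg 4 a * sg 2 a)"
    proof -
      have "a / sg 2 c = a * sg 1 a * sg 3 a / m" unfolding c by (simp add: mult_ac)
      also have "\<dots> = (a * sg 1 a * sg 2 a * sg 3 a * sg 4 a) / (m * (sg 4 a * sg 2 a))" using nza by simp
      also have "\<dots> = m ^ 2 / (sg 4 a * sg 2 a)" unfolding nn[symmetric] using m0 by (simp add: power3_eq_cube power2_eq_square)
      finally show ?thesis .
    qed
    then have "- (sg 3 c + a / sg 2 c) = \<delta> / (sg 4 a * sg 2 a)" unfolding c m\<delta> by (simp add: diff_divide_distrib add_divide_distrib)
    also have "\<dots> = b" unfolding \<delta>(1) using nza by simp
    finally show ?thesis by simp
  qed
  \<comment> \<open>The norm of \<open>c\<close> is \<open>1 / m\<close>, so norm 1 for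
    \<open>- c\<close> would mean \<open>m = -1\<close> and hence
    \<open>\<delta> = 0\<close>.\<close>
  have 3: "norm5 q (- c) \<noteq> 1"
  proof
    assume *: "norm5 q (- c) = 1"
    have "norm5 q c = m ^ 5 / (m ^ 3) ^ 2"
      unfolding norm_sg[of c] c nn unfolding c_def using nza[of 0] by (simp add: field_simps numeral_eq_Suc)
    then have "norm5 q c * m = 1" using m0 by (simp add: field_simps numeral_eq_Suc)
    moreover have "norm5 q c = - 1" using * by (metis add.inverse_inverse norm_minus)
    ultimately have "m = - 1" by (simp add: minus_equation_iff)
    then show False using m\<delta> \<delta>(3) by simp
  qed
  have "c \<noteq> 0" using m0 nza by (simp add: c_def)
  then show ?thesis using 1 2 3 by blast
qed

end

section \<open>Projections and coordinates\<close>

lemma linear_cartI: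
  fixes f :: "'a::field ^ 'n \<Rightarrow> 'a ^ 'm"
  assumes "\<And>x y. f (x + y) = f x + f y" "\<And>c x. f (c *s x) = c *s f x"
  shows "Vector_Spaces.linear (*s) (*s) f"
  using assms by (simp add: Vector_Spaces.linear_iff vec.vector_space_axioms)

lemma linear_cartD:
  fixes f :: "'a::field ^ 'n \<Rightarrow> 'a ^ 'm"
  assumes "Vector_Spaces.linear (*s) (*s) f"
  shows "f (x + y) = f x + f y" "f (c *s x) = c *s f x" "f 0 = 0" "f (x - y) = f x - f y"
proof -
  show 1: "f (x + y) = f x + f y" and 2: "f (c *s x) = c *s f x" for x y c
    using assms by (simp_all add: Vector_Spaces.linear_iff)
  show "f 0 = 0" using 2[of 0 0] by simp
  show "f (x - y) = f x - f y" using 1[of "x - y" y] by (simp add: algebra_simps)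
qed

lemma additive_sum:
  fixes h :: "'b::ab_group_add \<Rightarrow> 'c::ab_group_add"
  assumes "\<And>x y. h (x + y) = h x + h y"
  shows "h (\<Sum>i\<in>S. g i) = (\<Sum>i\<in>S. h (g i))"
proof -
  have "h 0 = 0" using assms[of 0 0] by simp
  then show ?thesis by (induction S rule: infinite_finite_induct) (simp_all add: assms)
qed

lemma semilinear_image_span:
  fixes f :: "'a::field ^ 'n \<Rightarrow> 'a ^ 'm"
  assumes "\<And>c x. f (c *s x) = \<theta> c *s f x" "surj \<theta>"
  shows "f ` vec.span {v} = vec.span {f v}"
proof -
  have "f ` vec.span {v} = range (\<lambda>k. \<theta> k *s f v)" by (simp add: vec.span_singleton image_image assms(1))
  also have "\<dots> = range (\<lambda>k. k *s f v)" 
  proof (intro equalityI subsetI)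
    fix w assume "w \<in> range (\<lambda>k. k *s f v)"
    then obtain k where k: "w = k *s f v" by blast
    moreover obtain l where "k = \<theta> l" using assms(2) by (metis surjD)
    ultimately show "w \<in> range (\<lambda>k. \<theta> k *s f v)" by blast
  qed blast
  finally show ?thesis by (simp add: vec.span_singleton)
qed

lemma linear_image_span:
  fixes f :: "'a::field ^ 'n \<Rightarrow> 'a ^ 'm"
  assumes "Vector_Spaces.linear (*s) (*s) f"
  shows "f ` vec.span {v} = vec.span {f v}"
  by (rule semilinear_image_span[where \<theta> = "\<lambda>x. x"]) (simp_all add: linear_cartD(2)[OF assms])

lemma span_singleton_eq:
  fixes v w :: "'a::field ^ 'n"
  assumes "w \<in> vec.span {v}" "w \<noteq> 0"
  shows "vec.span {w} = vec.span {v}"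
proof -
  obtain k where k: "w = k *s v" using assms(1) by (auto simp: vec.span_singleton)
  then have "k \<noteq> 0" using assms(2) by auto
  then have v: "v = (1 / k) *s w" using k by simp
  have "w \<in> vec.span {v}" "v \<in> vec.span {w}" using assms(1) v by (auto simp: vec.span_singleton)
  then show ?thesis by (simp add: vec.span_eq)
qed

lemma pg_pointI: "v \<noteq> 0 \<Longrightarrow> vec.span {v} \<in> pg_points"
  by (auto simp: pg_points_def)

lemma induced_span:
  assumes "Vector_Spaces.linear (*s) (*s) f" "v \<noteq> 0"
  shows "induced f (vec.span {v}) = vec.span {f v}"
  using assms by (simp add: induced_def pg_pointI linear_image_span)

lemma PGL_imp_PGammaL: "PGL \<subseteq> (PGammaL :: (('a::field ^ 'n) set \<Rightarrow> _) set)"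
proof
  fix g :: "('a ^ 'n) set \<Rightarrow> _" assume "g \<in> PGL"
  then obtain f where f: "g = induced f" "Vector_Spaces.linear (*s) (*s) f" "bij f" by (auto simp: PGL_def)
  have "semilinear (\<lambda>x. x) f"
    unfolding semilinear_def field_automorphism_def using linear_cartD[OF f(2)] by (auto simp: bij_def)
  then show "g \<in> PGammaL" using f by (auto simp: PGammaL_def has_companion_def)
qed

lemma PGL_equivalent_imp: "PGL_equivalent L M \<Longrightarrow> PGammaL_equivalent L M"
  using PGL_imp_PGammaL unfolding PGL_equivalent_def PGammaL_equivalent_def by blast

lemma vector2_eq: "(vector [a, b] :: 'a::field ^ 2) = vector [c, d] \<longleftrightarrow> a = c \<and> b = d"
  by (simp add: vec_eq_iff forall_2)

lemma vector2_add: "(vector [a, b] :: 'a::field ^ 2) + vector [c, d] = vector [a + c, b + d]"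
  by (simp add: vec_eq_iff forall_2)

lemma vector2_scale: "k *s (vector [a, b] :: 'a::field ^ 2) = vector [k * a, k * b]"
  by (simp add: vec_eq_iff forall_2)

lemma vector2_zero: "(vector [a, b] :: 'a::field ^ 2) = 0 \<longleftrightarrow> a = 0 \<and> b = 0"
  by (simp add: vec_eq_iff forall_2)

text \<open>Any linear \<open>\<pi>\<close> whose kernel is the centre realises the projection. The
  choice of the axis disappears because \<open>\<pi>\<close> is injective on it, so that
  \<open>\<pi>\<close> after \<open>e\<close> is a projectivity of the line.\<close>

lemma projection_PGL_equivalent:
  fixes W :: "('a::{field,finite} ^ 5) set" and \<pi> :: "'a ^ 5 \<Rightarrow> 'a ^ 2" and S :: "('a ^ 5) set"
  assumes W: "\<Gamma> = {P \<in> pg_points. P \<subseteq> W}"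
    and \<pi>: "Vector_Spaces.linear (*s) (*s) \<pi>" and ker: "\<And>v. \<pi> v = 0 \<longleftrightarrow> v \<in> W"
    and S: "0 \<notin> S" and disj: "\<Gamma> \<inter> {vec.span {v} | v. v \<in> S} = {}"
    and \<Lambda>: "\<Lambda> \<inter> \<Gamma> = {}" and e: "line_coordinates e \<Lambda>"
    and L: "L = {Q \<in> pg_points. e ` Q \<in> projection \<Gamma> \<Lambda> {vec.span {v} | v. v \<in> S}}"
  shows "\<forall>v\<in>S. \<pi> v \<noteq> 0" and "PGL_equivalent L {vec.span {\<pi> v} | v. v \<in> S}"
proof -
  note lin = linear_cartD[OF \<pi>]
  have e_lin: "Vector_Spaces.linear (*s) (*s) e" and e_inj: "inj e" and e_img: "\<Lambda> = image e ` pg_points"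
    using e by (auto simp: line_coordinates_def)
  note el = linear_cartD[OF e_lin]
  have inW: "vec.span {v} \<in> \<Gamma>" if "v \<in> W" "v \<noteq> 0" for v
  proof -
    have "k *s v \<in> W" for k using that(1) ker[of v] ker[of "k *s v"] lin(2)[of k v] by simp
    then have "vec.span {v} \<subseteq> W" unfolding vec.span_singleton by blast
    then show ?thesis using that by (simp add: W pg_pointI)
  qed
  show nz: "\<forall>v\<in>S. \<pi> v \<noteq> 0"
  proof
    fix v assume v: "v \<in> S"
    then have "v \<noteq> 0" using S by auto
    show "\<pi> v \<noteq> 0"
    proof
      assume "\<pi> v = 0"
      then have "vec.span {v} \<in> \<Gamma>" using inW ker \<open>v \<noteq> 0\<close> by blast
      then show False using disj v by blast
    qed
  qed
  define M where "M u = \<pi> (e u)" for u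
  have M_lin: "Vector_Spaces.linear (*s) (*s) M"
    by (rule linear_cartI) (simp_all add: M_def el lin)
  note Ml = linear_cartD[OF M_lin]
  have M0: "u = 0" if "M u = 0" for u
  proof (rule ccontr)
    assume u: "u \<noteq> 0"
    have "e u \<in> W" using that by (simp add: M_def ker)
    moreover have "e u \<noteq> 0" using u e_inj el(3) by (metis injD)
    ultimately have "vec.span {e u} \<in> \<Gamma>" using inW by blast
    moreover have "vec.span {e u} \<in> \<Lambda>"
      using u by (auto simp: e_img linear_image_span[OF e_lin, symmetric] pg_pointI)
    ultimately show False using \<Lambda> by blast
  qed
  have "inj M"
  proof (rule injI)
    fix x y assume "M x = M y"
    then have "M (x - y) = 0" by (simp add: Ml)
    then show "x = y" using M0 by fastforce
  qed
  then have "bij M" by (simp add: bij_def finite_UNIV_inj_surj)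
  have H: "z \<in> vec.span (\<Union> (insert (vec.span {w}) \<Gamma>)) \<longleftrightarrow> (\<exists>k. \<pi> z = k *s \<pi> w)" for z w
  proof
    let ?T = "{z. \<exists>k. \<pi> z = k *s \<pi> w}"
    have "vec.subspace ?T"
    proof (rule vec.subspaceI)
      show "0 \<in> ?T" by (auto simp: lin intro: exI[of _ 0])
      fix x y assume "x \<in> ?T" "y \<in> ?T"
      then obtain k l where "\<pi> x = k *s \<pi> w" "\<pi> y = l *s \<pi> w" by blast
      then have "\<pi> (x + y) = (k + l) *s \<pi> w" by (simp add: lin vec.scale_left_distrib)
      then show "x + y \<in> ?T" by blast
    next
      fix c x assume "x \<in> ?T"
      then obtain k where "\<pi> x = k *s \<pi> w" by blast
      then have "\<pi> (c *s x) = (c * k) *s \<pi> w" by (simp add: lin)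
      then show "c *s x \<in> ?T" by blast
    qed
    moreover have "\<Union> (insert (vec.span {w}) \<Gamma>) \<subseteq> ?T"
    proof
      fix x assume "x \<in> \<Union> (insert (vec.span {w}) \<Gamma>)"
      then consider "x \<in> vec.span {w}" | "x \<in> W" using W by auto
      then show "x \<in> ?T"
      proof cases
        case 1 then show ?thesis by (auto simp: vec.span_singleton lin)
      next
        case 2 then have "\<pi> x = 0 *s \<pi> w" using ker by simp
        then show ?thesis by blast
      qed
    qed
    ultimately have "vec.span (\<Union> (insert (vec.span {w}) \<Gamma>)) \<subseteq> ?T" by (rule vec.span_minimal[rotated])
    then show "z \<in> vec.span (\<Union> (insert (vec.span {w}) \<Gamma>)) \<Longrightarrow> \<exists>k. \<pi> z = k *s \<pi> w" by blast
    assume "\<exists>k. \<pi> z = k *s \<pi> w"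
    then obtain k where "\<pi> (z - k *s w) = 0" by (auto simp: lin)
    then have "z - k *s w \<in> W" by (simp add: ker)
    then have "z - k *s w \<in> vec.span (\<Union> (insert (vec.span {w}) \<Gamma>))"
    proof (cases "z - k *s w = 0")
      case True then show ?thesis by (simp add: vec.span_zero)
    next
      case False
      then have "vec.span {z - k *s w} \<in> \<Gamma>" using inW \<open>z - k *s w \<in> W\<close> by blast
      moreover have "z - k *s w \<in> vec.span {z - k *s w}" by (simp add: vec.span_base)
      ultimately have "z - k *s w \<in> \<Union> (insert (vec.span {w}) \<Gamma>)" by blast
      then show ?thesis by (rule vec.span_base)
    qed
    moreover have "k *s w \<in> vec.span (\<Union> (insert (vec.span {w}) \<Gamma>))"
      by (intro vec.span_scale vec.span_base) (auto simp: vec.span_base)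
    ultimately have "(z - k *s w) + k *s w \<in> vec.span (\<Union> (insert (vec.span {w}) \<Gamma>))" by (rule vec.span_add)
    then show "z \<in> vec.span (\<Union> (insert (vec.span {w}) \<Gamma>))" by simp
  qed
  define u0 where "u0 w = inv_into UNIV M (\<pi> w)" for w
  have Mu0: "M (u0 w) = \<pi> w" for w using \<open>bij M\<close> by (simp add: u0_def bij_is_surj surj_f_inv_f)
  have meet: "pg_span (insert (vec.span {w}) \<Gamma>) \<inter> \<Lambda> = {e ` vec.span {u0 w}}" if w: "w \<in> S" for w
  proof -
    have w0: "\<pi> w \<noteq> 0" using nz w by blast
    then have u0: "u0 w \<noteq> 0" using Mu0[of w] Ml(3) by metis
    show ?thesis
    proof (intro equalityI subsetI)
      fix R assume "R \<in> pg_span (insert (vec.span {w}) \<Gamma>) \<inter> \<Lambda>"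
      then obtain u where u: "u \<noteq> 0" "R = e ` vec.span {u}" and sub: "R \<subseteq> vec.span (\<Union> (insert (vec.span {w}) \<Gamma>))"
        by (auto simp: pg_span_def e_img pg_points_def)
      have "e u \<in> R" using u by (simp add: vec.span_base)
      then obtain k where "M u = k *s \<pi> w" using sub H unfolding M_def by blast
      then have "M u = M (k *s u0 w)" by (simp add: Ml Mu0)
      then have "u = k *s u0 w" using \<open>inj M\<close> by (simp add: inj_eq)
      then have "u \<in> vec.span {u0 w}" by (auto simp: vec.span_singleton)
      then show "R \<in> {e ` vec.span {u0 w}}" using span_singleton_eq u by auto
    next
      fix R assume "R \<in> {e ` vec.span {u0 w}}"
      then have R: "R = e ` vec.span {u0 w}" by simp
      then have "R \<in> \<Lambda>" using u0 by (auto simp: e_img pg_pointI)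
      moreover have "R = vec.span {e (u0 w)}" using R linear_image_span[OF e_lin] by simp
      moreover have "e (u0 w) \<noteq> 0" using u0 e_inj el(3) by (metis injD)
      moreover have "e (u0 w) \<in> vec.span (\<Union> (insert (vec.span {w}) \<Gamma>))"
        using H Mu0[of w] unfolding M_def by (metis vec.scale_one)
      ultimately show "R \<in> pg_span (insert (vec.span {w}) \<Gamma>) \<inter> \<Lambda>"
        by (auto simp: pg_span_def pg_pointI intro: vec.span_minimal[THEN subsetD])
    qed
  qed
  have u0_nz: "u0 v \<noteq> 0" if "v \<in> S" for v using Mu0[of v] Ml(3) nz that by metis
  have Leq: "L = {vec.span {u0 v} | v. v \<in> S}"
  proof (intro equalityI subsetI)
    fix Q assume "Q \<in> L"
    then obtain w where w: "w \<in> S" "pg_span (insert (vec.span {w}) \<Gamma>) \<inter> \<Lambda> = {e ` Q}"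
      unfolding L projection_def by blast
    then have "e ` Q = e ` vec.span {u0 w}" using meet by simp
    then have "Q = vec.span {u0 w}" using e_inj by (simp add: inj_image_eq_iff)
    then show "Q \<in> {vec.span {u0 v} | v. v \<in> S}" using w by blast
  next
    fix Q assume "Q \<in> {vec.span {u0 v} | v. v \<in> S}"
    then obtain w where w: "w \<in> S" "Q = vec.span {u0 w}" by blast
    then have "Q \<in> pg_points" using u0_nz by (simp add: pg_pointI)
    moreover have "e ` Q \<in> projection \<Gamma> \<Lambda> {vec.span {v} | v. v \<in> S}"
      unfolding projection_def using meet[OF w(1)] w by blast
    ultimately show "Q \<in> L" by (simp add: L)
  qed
  have "induced M ` L = {vec.span {\<pi> v} | v. v \<in> S}"
  proof -
    have "induced M (vec.span {u0 v}) = vec.span {\<pi> v}" if "v \<in> S" for v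
      using induced_span[OF M_lin u0_nz[OF that]] Mu0 by simp
    then have "induced M ` {vec.span {u0 v} | v. v \<in> S} = {vec.span {\<pi> v} | v. v \<in> S}"
      by (auto simp: image_iff)
    then show ?thesis by (simp add: Leq)
  qed
  then show "PGL_equivalent L {vec.span {\<pi> v} | v. v \<in> S}"
    unfolding PGL_equivalent_def PGL_def using M_lin \<open>bij M\<close> by blast
qed

section \<open>Coordinates in a basis formed by an orbit of the generator\<close>

definition comb5 :: "(nat \<Rightarrow> 'a::field ^ 'n) \<Rightarrow> 'a \<Rightarrow> 'a \<Rightarrow> 'a \<Rightarrow> 'a \<Rightarrow> 'a \<Rightarrow> 'a ^ 'n" where
  "comb5 B c0 c1 c2 c3 c4 = c0 *s B 0 + c1 *s B 1 + c2 *s B 2 + c3 *s B 3 + c4 *s B 4"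

lemma span3_iff:
  fixes a b c v :: "'a::field ^ 'n"
  shows "v \<in> vec.span {a, b, c} \<longleftrightarrow> (\<exists>k l m. v = k *s a + l *s b + m *s c)"
proof -
  have "v \<in> vec.span {a, b, c} \<longleftrightarrow> (\<exists>k l m. v - k *s a - l *s b = m *s c)"
    by (simp add: vec.span_insert vec.span_singleton image_iff)
  also have "\<dots> \<longleftrightarrow> (\<exists>k l m. v = k *s a + l *s b + m *s c)" by (simp add: algebra_simps)
  finally show ?thesis .
qed

lemma comb5_surj:
  fixes B :: "nat \<Rightarrow> 'a::field ^ 'n"
  assumes "vec.span {B 0, B 1, B 2, B 3, B 4} = UNIV"
  shows "\<exists>c0 c1 c2 c3 c4. v = comb5 B c0 c1 c2 c3 c4"
proof -
  have "v \<in> vec.span {B 0, B 1, B 2, B 3, B 4}" using assms by simp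
  then have "\<exists>c0 c1. v - c0 *s B 0 - c1 *s B 1 \<in> vec.span {B 2, B 3, B 4}"
    by (simp add: vec.span_insert[of _ "insert _ (insert _ (insert _ _))"])
  then obtain c0 c1 k l m where "v - c0 *s B 0 - c1 *s B 1 = k *s B 2 + l *s B 3 + m *s B 4"
    by (auto simp: span3_iff)
  then have "v = comb5 B c0 c1 k l m" by (simp add: comb5_def algebra_simps)
  then show ?thesis by blast
qed

lemma comb5_inj:
  fixes B :: "nat \<Rightarrow> 'a::{field,finite} ^ 5"
  assumes "vec.span {B 0, B 1, B 2, B 3, B 4} = UNIV"
    and eq: "comb5 B c0 c1 c2 c3 c4 = comb5 B d0 d1 d2 d3 d4"
  shows "c0 = d0 \<and> c1 = d1 \<and> c2 = d2 \<and> c3 = d3 \<and> c4 = d4"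
proof -
  define f where "f = (\<lambda>(c0, c1, c2, c3, c4). comb5 B c0 c1 c2 c3 c4)"
  have "v \<in> range f" for v
  proof -
    obtain c0 c1 c2 c3 c4 where "v = comb5 B c0 c1 c2 c3 c4" using comb5_surj[OF assms(1)] by blast
    then have "v = f (c0, c1, c2, c3, c4)" by (simp add: f_def)
    then show ?thesis by blast
  qed
  then have "range f = UNIV" by blast
  moreover have "CARD('a ^ 5) = CARD('a \<times> 'a \<times> 'a \<times> 'a \<times> 'a)"
    by (simp add: numeral_eq_Suc flip: UNIV_Times_UNIV)
  ultimately have "inj f" by (simp add: eq_card_imp_inj_on)
  moreover have "f (c0, c1, c2, c3, c4) = f (d0, d1, d2, d3, d4)" using eq by (simp add: f_def)
  ultimately show ?thesis by (simp add: inj_eq)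
qed

lemma comb5_add:
  "comb5 B c0 c1 c2 c3 c4 + comb5 B d0 d1 d2 d3 d4 = comb5 B (c0 + d0) (c1 + d1) (c2 + d2) (c3 + d3) (c4 + d4)"
  by (simp add: comb5_def vec.scale_left_distrib)

lemma comb5_scale: "k *s comb5 B c0 c1 c2 c3 c4 = comb5 B (k * c0) (k * c1) (k * c2) (k * c3) (k * c4)"
  by (simp add: comb5_def vec.scale_right_distrib)

text \<open>Modulo \<open>B 0\<close> and \<open>B 1\<close> the plane is a single point; its last
  three coordinates become the kernel vector of the projection.\<close>

lemma plane_coordinates:
  fixes B :: "nat \<Rightarrow> 'a::{field,finite} ^ 5"
  assumes B: "vec.span {B 0, B 1, B 2, B 3, B 4} = UNIV"
    and W: "vec.subspace W" "vec.dim W = 3" "B 0 \<in> W" "B 1 \<in> W"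
  shows "\<exists>b2 b3 b4. (b2, b3, b4) \<noteq> (0, 0, 0) \<and>
    (\<forall>c0 c1 c2 c3 c4. comb5 B c0 c1 c2 c3 c4 \<in> W \<longleftrightarrow> (\<exists>k. c2 = k * b2 \<and> c3 = k * b3 \<and> c4 = k * b4))"
proof -
  note inj = comb5_inj[OF B]
  have dim2: "vec.dim {B 0, B 1} \<le> 2"
  proof -
    have "vec.dim {B 0, B 1} \<le> card {B 0, B 1}" by (rule vec.dim_le_card') simp
    also have "\<dots> \<le> 2" by (simp add: card_insert_if)
    finally show ?thesis .
  qed
  have "\<not> W \<subseteq> vec.span {B 0, B 1}"
  proof
    assume "W \<subseteq> vec.span {B 0, B 1}"
    then have "vec.dim W \<le> vec.dim (vec.span {B 0, B 1})" by (rule vec.dim_subset)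
    then show False using dim2 W(2) by simp
  qed
  then obtain e where e: "e \<in> W" "e \<notin> vec.span {B 0, B 1}" by blast
  obtain e0 e1 b2 b3 b4 where ee: "e = comb5 B e0 e1 b2 b3 b4" using comb5_surj[OF B] by blast
  have nz: "(b2, b3, b4) \<noteq> (0, 0, 0)"
  proof
    assume "(b2, b3, b4) = (0, 0, 0)"
    then have "e = e0 *s B 0 + e1 *s B 1" using ee by (simp add: comb5_def)
    then have "e \<in> vec.span {B 0, B 1}" by (simp add: vec.span_add vec.span_scale vec.span_base)
    then show False using e by simp
  qed
  have "B 0 \<noteq> 0"
  proof
    assume "B 0 = 0"
    then have "comb5 B 1 0 0 0 0 = comb5 B 0 0 0 0 0" by (simp add: comb5_def)
    from inj[OF this] show False by simp
  qed
  moreover have "B 0 \<notin> vec.span {B 1}"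
  proof
    assume "B 0 \<in> vec.span {B 1}"
    then obtain k where "B 0 = k *s B 1" by (auto simp: vec.span_singleton)
    then have "comb5 B 1 0 0 0 0 = comb5 B 0 k 0 0 0" by (simp add: comb5_def)
    from inj[OF this] show False by simp
  qed
  moreover have "B 1 \<noteq> 0"
  proof
    assume "B 1 = 0"
    then have "comb5 B 0 1 0 0 0 = comb5 B 0 0 0 0 0" by (simp add: comb5_def)
    from inj[OF this] show False by simp
  qed
  ultimately have ind: "vec.independent {e, B 0, B 1}" "card {e, B 0, B 1} = 3"
  proof -
    assume *: "B 0 \<noteq> 0" "B 0 \<notin> vec.span {B 1}" "B 1 \<noteq> 0"
    have "vec.independent {B 1}" using *(3) by simp
    then have "vec.independent {B 0, B 1}" using *(2) by (simp add: vec.independent_insertI)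
    then show "vec.independent {e, B 0, B 1}" using e(2) by (simp add: vec.independent_insertI)
    have "e \<noteq> B 0" "e \<noteq> B 1" "B 0 \<noteq> B 1" using e(2) *(2) by (auto simp: vec.span_base)
    then show "card {e, B 0, B 1} = 3" by simp
  qed
  have "W \<subseteq> vec.span {e, B 0, B 1}"
    by (rule vec.card_ge_dim_independent) (use ind e W in auto)
  moreover have "vec.span {e, B 0, B 1} \<subseteq> W"
    by (rule vec.span_minimal) (use e W in auto)
  ultimately have W': "v \<in> W \<longleftrightarrow> (\<exists>k l m. v = k *s e + l *s B 0 + m *s B 1)" for v
    using span3_iff[of v] by blast
  have comb: "k *s e + l *s B 0 + m *s B 1 = comb5 B (k * e0 + l) (k * e1 + m) (k * b2) (k * b3) (k * b4)" for k l m
    unfolding ee by (simp add: comb5_scale) (simp add: comb5_def algebra_simps)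
  have "comb5 B c0 c1 c2 c3 c4 \<in> W \<longleftrightarrow> (\<exists>k. c2 = k * b2 \<and> c3 = k * b3 \<and> c4 = k * b4)" for c0 c1 c2 c3 c4
  proof
    assume "comb5 B c0 c1 c2 c3 c4 \<in> W"
    then show "\<exists>k. c2 = k * b2 \<and> c3 = k * b3 \<and> c4 = k * b4"
      unfolding W' comb using inj by blast
  next
    assume "\<exists>k. c2 = k * b2 \<and> c3 = k * b3 \<and> c4 = k * b4"
    then obtain k where "c2 = k * b2" "c3 = k * b3" "c4 = k * b4" by blast
    then have "comb5 B c0 c1 c2 c3 c4 = k *s e + (c0 - k * e0) *s B 0 + (c1 - k * e1) *s B 1"
      unfolding comb by simp
    then show "comb5 B c0 c1 c2 c3 c4 \<in> W" unfolding W' by blast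
  qed
  then show ?thesis using nz by blast
qed

context quintic_sigma
begin

definition tau :: "nat \<Rightarrow> 'a ^ 'n \<Rightarrow> 'a ^ 'n" where "tau i u = (\<chi> j. sg i (u $ j))"

lemma tau_add: "tau i (u + v) = tau i u + tau i v" by (simp add: tau_def vec_eq_iff)
lemma tau_scale: "tau i (c *s u) = sg i c *s tau i u" by (simp add: tau_def vec_eq_iff)
lemma tau_tau: "tau i (tau j u) = tau (i + j) u" by (simp add: tau_def vec_eq_iff sg_sg)
lemma tau_0: "tau 0 u = u" by (simp add: tau_def vec_eq_iff)
lemma tau_5: "tau 5 u = u" by (simp add: tau_def vec_eq_iff sg_5)
lemma tau_nonzero: "tau i u = 0 \<longleftrightarrow> u = 0" by (simp add: tau_def vec_eq_iff)

lemma tau_fixed_iff: "tau 1 u = u \<longleftrightarrow> (\<forall>i. u $ i \<in> Fq q)"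
proof
  assume "tau 1 u = u"
  then have "sg 1 (u $ i) = u $ i" for i by (metis tau_def vec_lambda_beta)
  then show "\<forall>i. u $ i \<in> Fq q" using sg_fixed_imp_Fq by blast
qed (simp add: tau_def vec_eq_iff Fq_sg)

text \<open>Frame argument: each unit vector is fixed up to a scalar \<open>k i\<close>, and the
  all-ones vector forces these scalars to agree.\<close>

lemma subgeometry_stabilizer:
  fixes h f :: "'a ^ 'n \<Rightarrow> 'a ^ 'n"
  assumes h: "\<And>x y. h (x + y) = h x + h y" "\<And>c x. h (c *s x) = sg 1 c *s h x" "inj h"
    and f: "Vector_Spaces.linear (*s) (*s) f" "inj f"
    and fixd: "\<And>v. v \<noteq> 0 \<Longrightarrow> (\<forall>i. v $ i \<in> Fq q) \<Longrightarrow> h ` vec.span {f v} = vec.span {f v}"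
  shows "\<exists>\<kappa>. \<kappa> \<noteq> 0 \<and> (\<forall>u. h (f u) = \<kappa> *s f (tau 1 u))"
proof -
  note fl = linear_cartD[OF f(1)]
  have ex: "\<exists>k. h (f v) = k *s f v" if "v \<noteq> 0" "\<forall>i. v $ i \<in> Fq q" for v :: "'a ^ 'n"
  proof -
    have "h (f v) \<in> h ` vec.span {f v}" by (simp add: vec.span_base)
    then show ?thesis using fixd[OF that] by (auto simp: vec.span_singleton)
  qed
  have Fq01: "0 \<in> Fq q" "1 \<in> Fq q" using q_gt_0 by (auto simp: Fq_def)
  let ?e = "\<lambda>i. axis i (1::'a) :: 'a ^ 'n"
  have "\<exists>k. h (f (?e i)) = k *s f (?e i)" for i
    by (rule ex) (auto simp: axis_def vec_eq_iff Fq01)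
  then obtain k where k: "\<And>i. h (f (?e i)) = k i *s f (?e i)" by metis
  have expand: "h (f u) = f (\<chi> i. k i * sg 1 (u $ i))" for u
  proof -
    have "h (f u) = h (f (\<Sum>i\<in>UNIV. (u $ i) *s ?e i))" by (simp add: basis_expansion)
    also have "\<dots> = (\<Sum>i\<in>UNIV. sg 1 (u $ i) *s (k i *s f (?e i)))"
      by (simp only: additive_sum[of f, OF fl(1)] additive_sum[of h, OF h(1)] fl(2) h(2) k)
    also have "\<dots> = f (\<Sum>i\<in>UNIV. ((\<chi> i. k i * sg 1 (u $ i)) $ i) *s ?e i)"
      by (simp add: additive_sum[of f, OF fl(1)] fl(2) mult.commute)
    also have "\<dots> = f (\<chi> i. k i * sg 1 (u $ i))" by (simp only: basis_expansion)
    finally show ?thesis .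
  qed
  let ?one = "(\<chi> i. 1) :: 'a ^ 'n"
  have "\<exists>\<kappa>. h (f ?one) = \<kappa> *s f ?one" by (rule ex) (auto simp: vec_eq_iff Fq01)
  then obtain \<kappa> where "h (f ?one) = \<kappa> *s f ?one" by blast
  then have "f (\<chi> i. k i) = f (\<kappa> *s ?one)" using expand[of ?one] by (simp add: fl)
  then have "(\<chi> i. k i) = \<kappa> *s ?one" using f(2) by (simp add: inj_eq)
  then have k\<kappa>: "k i = \<kappa>" for i by (simp add: vec_eq_iff)
  have main: "h (f u) = \<kappa> *s f (tau 1 u)" for u
  proof -
    have "(\<chi> i. k i * sg 1 (u $ i)) = \<kappa> *s tau 1 u" by (simp add: vec_eq_iff tau_def k\<kappa>)
    then show ?thesis using expand[of u] fl(2) by metis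
  qed
  have "\<kappa> \<noteq> 0"
  proof
    assume "\<kappa> = 0"
    then have "h (f ?one) = h (f 0)" using main by simp
    then have "?one = 0" using h(3) f(2) by (metis injD)
    then show False by (simp add: vec_eq_iff)
  qed
  then show ?thesis using main by blast
qed

text \<open>The two rows of functionals stay arbitrary because each type of linear set is later
  recognised through a different choice of functionals with the same kernel.\<close>

lemma projection_normal_form:
  fixes \<Sigma> \<Gamma> \<Lambda> :: "('a ^ 5) set set" and e :: "'a ^ 2 \<Rightarrow> 'a ^ 5"
  assumes can: "canonical_subgeometry q \<Sigma>"
    and \<Gamma>: "pg_subspace 2 \<Gamma>" "\<Gamma> \<inter> \<Sigma> = {}" and \<Lambda>: "\<Lambda> \<inter> \<Gamma> = {}" "line_coordinates e \<Lambda>"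
    and L: "L = {Q \<in> pg_points. e ` Q \<in> projection \<Gamma> \<Lambda> \<Sigma>}"
    and stab: "\<forall>P\<in>\<Sigma>. \<sigma> P = P" and comp: "has_companion \<sigma> (\<lambda>x. x ^ (q ^ s))"
    and A: "\<Gamma> \<inter> image (\<sigma> ^^ 4) \<Gamma> = {A}" "point_rank \<sigma> A = 5"
  shows "\<exists>b2 b3 b4. (b2, b3, b4) \<noteq> (0, 0, 0) \<and> (\<forall>r1 r2 r3 t1 t2 t3.
    (\<forall>c2 c3 c4. r1 * c2 + r2 * c3 + r3 * c4 = 0 \<and> t1 * c2 + t2 * c3 + t3 * c4 = 0 \<longleftrightarrow>
      (\<exists>k. c2 = k * b2 \<and> c3 = k * b3 \<and> c4 = k * b4)) \<longrightarrow>
    (\<forall>y. r1 * y + r2 * sg 1 y + r3 * sg 2 y = 0 \<and> t1 * y + t2 * sg 1 y + t3 * sg 2 y = 0 \<longrightarrow> y = 0) \<and>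
    PGL_equivalent L {vec.span {vector [r1 * y + r2 * sg 1 y + r3 * sg 2 y, t1 * y + t2 * sg 1 y + t3 * sg 2 y]} | y. y \<noteq> 0})"
proof -
  obtain W where W: "vec.subspace W" "vec.dim W = 3" "\<Gamma> = {P \<in> pg_points. P \<subseteq> W}"
    using \<Gamma>(1) by (auto simp: pg_subspace_def)
  obtain f where f: "Vector_Spaces.linear (*s) (*s) f" "bij f"
    and \<Sigma>0: "\<Sigma> = induced f ` {vec.span {v} | v. v \<noteq> 0 \<and> (\<forall>i. v $ i \<in> Fq q)}"
    using can by (auto simp: canonical_subgeometry_def PGL_def)
  note fl = linear_cartD[OF f(1)]
  have finj: "inj f" using f(2) by (simp add: bij_is_inj)
  have f0: "f u = 0 \<longleftrightarrow> u = 0" for u using finj fl(3) by (metis injD)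
  have \<Sigma>1: "\<Sigma> = {vec.span {f v} | v. v \<noteq> 0 \<and> tau 1 v = v}"
  proof -
    have "induced f (vec.span {v}) = vec.span {f v}" if "v \<noteq> 0" for v using induced_span[OF f(1) that] .
    then show ?thesis unfolding \<Sigma>0 tau_fixed_iff by (auto simp: image_iff)
  qed
  obtain h where h: "semilinear (\<lambda>x. x ^ (q ^ s)) h" "bij h" "\<sigma> = induced h"
    using comp by (auto simp: has_companion_def)
  have sg1: "sg 1 = (\<lambda>x. x ^ (q ^ s))" by (rule ext) (simp add: sg_def)
  have hl: "h (x + y) = h x + h y" "h (c *s x) = sg 1 c *s h x" for x y c
    using h(1) unfolding sg1 by (auto simp: semilinear_def)
  have surj1: "surj (sg 1)" using h(1) unfolding sg1 by (auto simp: semilinear_def field_automorphism_def bij_def)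
  have \<sigma>_span: "\<sigma> (vec.span {v}) = vec.span {h v}" if "v \<noteq> 0" for v
    using semilinear_image_span[of h "sg 1", OF hl(2) surj1] that by (simp add: h(3) induced_def pg_pointI)
  have "\<exists>\<kappa>. \<kappa> \<noteq> 0 \<and> (\<forall>u. h (f u) = \<kappa> *s f (tau 1 u))"
  proof (rule subgeometry_stabilizer[OF hl bij_is_inj[OF h(2)] f(1) finj])
    fix v :: "'a ^ 5" assume v: "v \<noteq> 0" "\<forall>i. v $ i \<in> Fq q"
    then have "vec.span {f v} \<in> \<Sigma>" unfolding \<Sigma>1 tau_fixed_iff by blast
    then have "\<sigma> (vec.span {f v}) = vec.span {f v}" using stab by blast
    then show "h ` vec.span {f v} = vec.span {f v}"
      using v(1) by (simp add: h(3) induced_def pg_pointI f0)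
  qed
  then obtain \<kappa> where \<kappa>: "\<kappa> \<noteq> 0" "\<And>u. h (f u) = \<kappa> *s f (tau 1 u)" by blast
  have \<sigma>_f: "\<sigma> (vec.span {f u}) = vec.span {f (tau 1 u)}" if "u \<noteq> 0" for u
  proof -
    have "vec.span {\<kappa> *s f (tau 1 u)} = vec.span {f (tau 1 u)}"
      by (rule span_singleton_eq) (use \<kappa>(1) that in \<open>auto simp: vec.span_singleton f0 tau_nonzero\<close>)
    then show ?thesis using \<sigma>_span[of "f u"] that by (simp add: f0 \<kappa>(2))
  qed
  have \<sigma>_pow: "(\<sigma> ^^ i) (vec.span {f u}) = vec.span {f (tau i u)}" if "u \<noteq> 0" for i u
    by (induction i) (use that in \<open>simp_all add: tau_0 \<sigma>_f tau_nonzero tau_tau\<close>)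
  have "A \<in> image (\<sigma> ^^ 4) \<Gamma>" "A \<in> \<Gamma>" using A(1) by blast+
  \<comment> \<open>As \<open>\<sigma> ^^ 5\<close> acts trivially, \<open>P\<close> is the image of
    \<open>A\<close> under \<open>\<sigma>\<close>; so \<open>\<Gamma>\<close> contains both of
    these points, which become \<open>B 0\<close> and \<open>B 1\<close>.\<close>
  then obtain P where P: "P \<in> \<Gamma>" "A = (\<sigma> ^^ 4) P" by blast
  then obtain p' where p': "p' \<noteq> 0" "P = vec.span {p'}" using W(3) by (auto simp: pg_points_def)
  obtain p where p: "p' = f p" using f(2) by (metis bij_pointE)
  then have "p \<noteq> 0" using p'(1) f0 by simp
  define \<alpha> where "\<alpha> = tau 4 p"
  have \<alpha>: "\<alpha> \<noteq> 0" "A = vec.span {f \<alpha>}" "P = vec.span {f (tau 1 \<alpha>)}"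
    using \<open>p \<noteq> 0\<close> P(2) p'(2) p \<sigma>_pow[of p 4] by (simp_all add: \<alpha>_def tau_nonzero tau_tau tau_5)
  define B where "B i = f (tau i \<alpha>)" for i
  have BW: "B 0 \<in> W" "B 1 \<in> W"
    using \<open>A \<in> \<Gamma>\<close> P(1) \<alpha> W(3) by (auto simp: B_def tau_0 vec.span_base subset_iff)
  have "(\<Union>i\<in>{0..4}. (\<sigma> ^^ i) A) = (\<Union>i\<in>{0..4}. vec.span {B i})"
    using \<alpha> \<sigma>_pow by (simp add: B_def)
  also have "\<dots> \<subseteq> vec.span {B 0, B 1, B 2, B 3, B 4}"
  proof
    fix x assume "x \<in> (\<Union>i\<in>{0..4}. vec.span {B i})"
    then obtain i where i: "i \<le> 4" "x \<in> vec.span {B i}" by auto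
    then have "i = 0 \<or> i = 1 \<or> i = 2 \<or> i = 3 \<or> i = 4" by auto
    then have "{B i} \<subseteq> {B 0, B 1, B 2, B 3, B 4}" by auto
    then show "x \<in> vec.span {B 0, B 1, B 2, B 3, B 4}" using i(2) vec.span_mono by blast
  qed
  finally have "vec.dim (\<Union>i\<in>{0..4}. (\<sigma> ^^ i) A) \<le> vec.dim (vec.span {B 0, B 1, B 2, B 3, B 4})"
    by (rule vec.dim_subset)
  then have "5 \<le> vec.dim {B 0, B 1, B 2, B 3, B 4}" using A(2) by (simp add: point_rank_def)
  moreover have "vec.dim {B 0, B 1, B 2, B 3, B 4} \<le> vec.dimension TYPE('a) TYPE(5)" by (rule vec.dim_subset_UNIV)
  moreover have "vec.dimension TYPE('a) TYPE(5) = 5" by (simp add: vec.dimension_def card_cart_basis)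
  ultimately have B: "vec.span {B 0, B 1, B 2, B 3, B 4} = UNIV" using vec.dim_eq_full by fastforce
  note inj = comb5_inj[OF B] and surj = comb5_surj[OF B]
  \<comment> \<open>In the orbit basis \<open>tau 1\<close> shifts coordinates cyclically while
    applying \<open>sg 1\<close>, so its nonzero fixed vectors are the \<open>w x\<close> with
    \<open>x\<close> nonzero.\<close>
  define w where "w x = comb5 B x (sg 1 x) (sg 2 x) (sg 3 x) (sg 4 x)" for x
  have comb_f: "comb5 B c0 c1 c2 c3 c4 = f (comb5 (\<lambda>i. tau i \<alpha>) c0 c1 c2 c3 c4)" for c0 c1 c2 c3 c4
    by (simp add: comb5_def B_def fl)
  have tau_comb: "tau 1 (comb5 (\<lambda>i. tau i \<alpha>) c0 c1 c2 c3 c4) =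
      comb5 (\<lambda>i. tau i \<alpha>) (sg 1 c4) (sg 1 c0) (sg 1 c1) (sg 1 c2) (sg 1 c3)" for c0 c1 c2 c3 c4
    using tau_5[of \<alpha>] by (simp add: comb5_def tau_add tau_scale tau_tau tau_0 numeral_eq_Suc)
  have w_rat: "(\<exists>v. z = f v \<and> v \<noteq> 0 \<and> tau 1 v = v) \<longleftrightarrow> (\<exists>x. x \<noteq> 0 \<and> z = w x)" for z
  proof
    assume "\<exists>v. z = f v \<and> v \<noteq> 0 \<and> tau 1 v = v"
    then obtain v where v: "z = f v" "v \<noteq> 0" "tau 1 v = v" by blast
    obtain c0 c1 c2 c3 c4 where c: "z = comb5 B c0 c1 c2 c3 c4" using surj by blast
    then have v': "v = comb5 (\<lambda>i. tau i \<alpha>) c0 c1 c2 c3 c4" using v(1) finj by (simp add: comb_f inj_eq)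
    then have "comb5 B c0 c1 c2 c3 c4 = comb5 B (sg 1 c4) (sg 1 c0) (sg 1 c1) (sg 1 c2) (sg 1 c3)"
      using v(3) tau_comb unfolding comb_f by metis
    from inj[OF this] have eqs: "c1 = sg 1 c0" "c2 = sg 1 c1" "c3 = sg 1 c2" "c4 = sg 1 c3" by blast+
    then have "z = w c0" using c by (simp add: w_def)
    moreover have "c0 \<noteq> 0" using eqs v' v(2) by (auto simp: comb5_def)
    ultimately show "\<exists>x. x \<noteq> 0 \<and> z = w x" by blast
  next
    assume "\<exists>x. x \<noteq> 0 \<and> z = w x"
    then obtain x where x: "x \<noteq> 0" "z = w x" by blast
    define v where "v = comb5 (\<lambda>i. tau i \<alpha>) x (sg 1 x) (sg 2 x) (sg 3 x) (sg 4 x)"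
    have "z = f v" using x(2) by (simp add: w_def comb_f v_def)
    moreover have "v \<noteq> 0"
    proof
      assume "v = 0"
      then have "comb5 B x (sg 1 x) (sg 2 x) (sg 3 x) (sg 4 x) = comb5 B 0 0 0 0 0"
        unfolding comb_f v_def[symmetric] by (simp add: comb5_def)
      from inj[OF this] show False using x by simp
    qed
    moreover have "tau 1 v = v" unfolding v_def tau_comb by simp
    ultimately show "\<exists>v. z = f v \<and> v \<noteq> 0 \<and> tau 1 v = v" by blast
  qed
  define S where "S = {w x | x. x \<noteq> 0}"
  have \<Sigma>S: "\<Sigma> = {vec.span {v} | v. v \<in> S}"
  proof -
    have "z \<in> S \<longleftrightarrow> (\<exists>v. z = f v \<and> v \<noteq> 0 \<and> tau 1 v = v)" for z
      unfolding w_rat by (auto simp: S_def)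
    then show ?thesis unfolding \<Sigma>1 by auto
  qed
  have S0: "0 \<notin> S"
  proof
    assume "0 \<in> S"
    then have "\<exists>x. x \<noteq> 0 \<and> 0 = w x" by (auto simp: S_def)
    from w_rat[THEN iffD2, OF this] obtain v where v: "0 = f v" "v \<noteq> 0" by (elim exE conjE)
    from v(1)[symmetric] v(2) show False by (simp only: f0)
  qed
  from plane_coordinates[OF B W(1,2) BW] obtain b2 b3 b4 where b: "(b2, b3, b4) \<noteq> (0, 0, 0)"
    "\<And>c0 c1 c2 c3 c4. comb5 B c0 c1 c2 c3 c4 \<in> W \<longleftrightarrow> (\<exists>k. c2 = k * b2 \<and> c3 = k * b3 \<and> c4 = k * b4)"
    by (elim exE conjE) simp
  have "\<exists>k. \<forall>v. v = comb5 B (k v (0::nat)) (k v 1) (k v 2) (k v 3) (k v 4)"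
  proof (rule choice, rule allI)
    fix v
    obtain c0 c1 c2 c3 c4 where c: "v = comb5 B c0 c1 c2 c3 c4" using surj by blast
    let ?c = "\<lambda>i::nat. if i = 0 then c0 else if i = 1 then c1 else if i = 2 then c2 else if i = 3 then c3 else c4"
    have "v = comb5 B (?c 0) (?c 1) (?c 2) (?c 3) (?c 4)" using c by simp
    then show "\<exists>k. v = comb5 B (k (0::nat)) (k 1) (k 2) (k 3) (k 4)" by (rule exI[of _ ?c])
  qed
  then obtain co where co: "\<And>v. v = comb5 B (co v (0::nat)) (co v 1) (co v 2) (co v 3) (co v 4)" by blast
  have co_comb: "co (comb5 B c0 c1 c2 c3 c4) 2 = c2" "co (comb5 B c0 c1 c2 c3 c4) 3 = c3"
    "co (comb5 B c0 c1 c2 c3 c4) 4 = c4" for c0 c1 c2 c3 c4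
    using inj[OF co[of "comb5 B c0 c1 c2 c3 c4"]] by simp_all
  have goal: "(\<forall>y. r1 * y + r2 * sg 1 y + r3 * sg 2 y = 0 \<and> t1 * y + t2 * sg 1 y + t3 * sg 2 y = 0 \<longrightarrow> y = 0) \<and>
    PGL_equivalent L {vec.span {vector [r1 * y + r2 * sg 1 y + r3 * sg 2 y, t1 * y + t2 * sg 1 y + t3 * sg 2 y]} | y. y \<noteq> 0}"
    if rows: "\<forall>c2 c3 c4. r1 * c2 + r2 * c3 + r3 * c4 = 0 \<and> t1 * c2 + t2 * c3 + t3 * c4 = 0 \<longleftrightarrow>
      (\<exists>k. c2 = k * b2 \<and> c3 = k * b3 \<and> c4 = k * b4)" for r1 r2 r3 t1 t2 t3
  proof -
    define \<pi> :: "'a ^ 5 \<Rightarrow> 'a ^ 2" where "\<pi> v = vector [r1 * co v 2 + r2 * co v 3 + r3 * co v 4,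
      t1 * co v 2 + t2 * co v 3 + t3 * co v 4]" for v
    have \<pi>_comb: "\<pi> (comb5 B c0 c1 c2 c3 c4) = vector [r1 * c2 + r2 * c3 + r3 * c4, t1 * c2 + t2 * c3 + t3 * c4]"
      for c0 c1 c2 c3 c4 by (simp add: \<pi>_def co_comb)
    have lin: "Vector_Spaces.linear (*s) (*s) \<pi>"
    proof (rule linear_cartI)
      fix x y c
      obtain c0 c1 c2 c3 c4 where x: "x = comb5 B c0 c1 c2 c3 c4" using surj by blast
      obtain d0 d1 d2 d3 d4 where y: "y = comb5 B d0 d1 d2 d3 d4" using surj by blast
      show "\<pi> (x + y) = \<pi> x + \<pi> y"
        unfolding x y comb5_add \<pi>_comb vector2_add vector2_eq by (simp add: algebra_simps)
      show "\<pi> (c *s x) = c *s \<pi> x"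
        unfolding x comb5_scale \<pi>_comb vector2_scale vector2_eq by (simp add: algebra_simps)
    qed
    have ker: "\<pi> v = 0 \<longleftrightarrow> v \<in> W" for v
    proof -
      obtain c0 c1 c2 c3 c4 where v: "v = comb5 B c0 c1 c2 c3 c4" using surj by blast
      show ?thesis unfolding v \<pi>_comb vector2_zero b(2) using rows by blast
    qed
    \<comment> \<open>The last three coordinates of \<open>w x\<close> begin with
      \<open>sg 2 x\<close>; the parameter \<open>y = sg 2 x\<close>, with inverse
      \<open>x = sg 3 y\<close>, gives the triple \<open>(y, sg 1 y, sg 2 y)\<close>.\<close>
    have \<pi>w: "\<pi> (w x) = vector [r1 * sg 2 x + r2 * sg 1 (sg 2 x) + r3 * sg 2 (sg 2 x),
        t1 * sg 2 x + t2 * sg 1 (sg 2 x) + t3 * sg 2 (sg 2 x)]" for x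
      unfolding w_def \<pi>_comb by simp
    have disj: "\<Gamma> \<inter> {vec.span {v} | v. v \<in> S} = {}" using \<Gamma>(2) unfolding \<Sigma>S .
    have L': "L = {Q \<in> pg_points. e ` Q \<in> projection \<Gamma> \<Lambda> {vec.span {v} | v. v \<in> S}}"
      using L unfolding \<Sigma>S .
    note pr1 = projection_PGL_equivalent(1)[OF W(3) lin ker S0 disj \<Lambda> L']
      and pr2 = projection_PGL_equivalent(2)[OF W(3) lin ker S0 disj \<Lambda> L']
    have "{vec.span {\<pi> v} | v. v \<in> S} =
      {vec.span {vector [r1 * y + r2 * sg 1 y + r3 * sg 2 y, t1 * y + t2 * sg 1 y + t3 * sg 2 y]} | y. y \<noteq> 0}" (is "?M = ?N")
    proof (intro equalityI subsetI)
      fix Q assume "Q \<in> ?M"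
      then obtain x where "x \<noteq> 0" "Q = vec.span {\<pi> (w x)}" by (auto simp: S_def)
      then show "Q \<in> ?N" unfolding \<pi>w using sg_eq_0 by blast
    next
      fix Q assume "Q \<in> ?N"
      then obtain y where y: "y \<noteq> 0"
        "Q = vec.span {vector [r1 * y + r2 * sg 1 y + r3 * sg 2 y, t1 * y + t2 * sg 1 y + t3 * sg 2 y]}" by blast
      have "Q = vec.span {\<pi> (w (sg 3 y))}" unfolding y(2) \<pi>w by simp
      moreover have "w (sg 3 y) \<in> S" using y(1) unfolding S_def using sg_eq_0 by blast
      ultimately show "Q \<in> ?M" by blast
    qed
    moreover have "y = 0" if "r1 * y + r2 * sg 1 y + r3 * sg 2 y = 0" "t1 * y + t2 * sg 1 y + t3 * sg 2 y = 0" for y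
    proof (rule ccontr)
      assume "y \<noteq> 0"
      then have "w (sg 3 y) \<in> S" unfolding S_def using sg_eq_0 by blast
      then have "\<pi> (w (sg 3 y)) \<noteq> 0" using pr1 by blast
      moreover have "\<pi> (w (sg 3 y)) = 0" unfolding \<pi>w vector2_zero using that by simp
      ultimately show False by blast
    qed
    ultimately show ?thesis using pr2 by metis
  qed
  show ?thesis
    by (rule exI[of _ b2], rule exI[of _ b3], rule exI[of _ b4], rule conjI[OF b(1)], intro allI impI, rule goal)
qed

end

section \<open>Maximum scattered linear sets\<close>

lemma PGL_equivalent_card:
  assumes "PGL_equivalent L M" "L \<subseteq> pg_points"
  shows "card M = card L"
proof -
  obtain f where f: "bij f" "M = induced f ` L" using assms(1) by (auto simp: PGL_equivalent_def PGL_def)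
  have "inj_on (induced f) L"
  proof (rule inj_onI)
    fix P Q assume "P \<in> L" "Q \<in> L" "induced f P = induced f Q"
    then have "f ` P = f ` Q" using assms(2) by (simp add: induced_def subset_iff)
    then show "P = Q" using f(1) by (simp add: bij_is_inj inj_image_eq_iff)
  qed
  then show ?thesis using f(2) by (simp add: card_image)
qed

lemma span_vector2_eq:
  fixes a b c d :: "'a::field"
  assumes "\<not> (a = 0 \<and> b = 0)" "\<not> (c = 0 \<and> d = 0)" "a * d = b * c"
  shows "vec.span {vector [a, b] :: 'a ^ 2} = vec.span {vector [c, d]}"
proof -
  have "\<exists>k. a = k * c \<and> b = k * d"
  proof (cases "c = 0")
    case True
    then have "a = (b / d) * c \<and> b = (b / d) * d" using assms by auto
    then show ?thesis by blast
  next
    case False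
    then have "a = (a / c) * c \<and> b = (a / c) * d" using assms(3) by (simp add: field_simps)
    then show ?thesis by blast
  qed
  then obtain k where k: "a = k * c" "b = k * d" by blast
  have "vector [a, b] \<in> vec.span {vector [c, d] :: 'a ^ 2}"
    by (auto simp: vec.span_singleton k simp flip: vector2_scale)
  then show ?thesis using assms(1) by (intro span_singleton_eq) (simp_all add: vector2_zero)
qed

context quintic_sigma
begin

text \<open>Every point comes from at least \<open>q - 1\<close> parameters, the multiples of one of
  them by units of the subfield. The number of points leaves room for no others.\<close>

lemma maximum_scattered_imp_proportional:
  assumes L: "L \<subseteq> pg_points" "card L = (q ^ 5 - 1) div (q - 1)"
    and eqv: "PGL_equivalent L {vec.span {vector [f y, g y] :: 'a ^ 2} | y. y \<noteq> 0}"
    and f: "\<And>c y. c \<in> Fq q \<Longrightarrow> f (c * y) = c * f y" and g: "\<And>c y. c \<in> Fq q \<Longrightarrow> g (c * y) = c * g y"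
    and ker: "\<forall>y. f y = 0 \<and> g y = 0 \<longrightarrow> y = 0"
    and x: "x \<noteq> 0" and det: "f x * g y = g x * f y"
  shows "\<exists>c\<in>Fq q. y = c * x"
proof (cases "y = 0")
  case True
  moreover have "0 \<in> Fq q" using q_gt_0 by (simp add: Fq_def)
  ultimately show ?thesis by (metis mult_zero_left)
next
  case y: False
  define \<Phi> where "\<Phi> y = vec.span {vector [f y, g y] :: 'a ^ 2}" for y
  define M where "M = \<Phi> ` (UNIV - {0})"
  have Meq: "M = {vec.span {vector [f y, g y] :: 'a ^ 2} | y. y \<noteq> 0}" by (auto simp: M_def \<Phi>_def)
  have "card M = (q ^ 5 - 1) div (q - 1)" using PGL_equivalent_card[OF eqv L(1)] L(2) Meq by simp
  moreover have "(q - 1) dvd (q ^ 5 - 1)"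
  proof -
    obtain m where "q = Suc m" using q_gt_0 gr0_implies_Suc by blast
    then have "q ^ 5 - 1 = (q - 1) * (1 + q + q ^ 2 + q ^ 3 + q ^ 4)"
      by (simp add: eval_nat_numeral algebra_simps)
    then show ?thesis by (rule dvdI)
  qed
  ultimately have cM: "card M * (q - 1) = q ^ 5 - 1" by simp
  show ?thesis
  proof (rule ccontr)
    assume no: "\<not> (\<exists>c\<in>Fq q. y = c * x)"
    define F where "F m = {z. z \<noteq> 0 \<and> \<Phi> z = m}" for m
    have unit: "(\<lambda>c. c * z) ` (Fq q - {0}) \<subseteq> F (\<Phi> z)" if "z \<noteq> 0" for z
    proof
      fix w assume "w \<in> (\<lambda>c. c * z) ` (Fq q - {0})"
      then obtain c where c: "c \<in> Fq q" "c \<noteq> 0" "w = c * z" by blast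
      have fg: "f w = c * f z" "g w = c * g z" using f g c by simp_all
      have "\<not> (f z = 0 \<and> g z = 0)" using ker that by blast
      then have "\<Phi> w = \<Phi> z" unfolding \<Phi>_def using c(2)
        by (intro span_vector2_eq) (simp_all add: fg)
      then show "w \<in> F (\<Phi> z)" using c that by (simp add: F_def)
    qed
    have cu: "card ((\<lambda>c. c * z) ` (Fq q - {0})) = q - 1" if "z \<noteq> 0" for z :: 'a
      using that card_image[of "\<lambda>c. c * z" "Fq q - {0}"] card_Fq_units by (simp add: inj_on_def)
    have ge: "q - 1 \<le> card (F m)" if m: "m \<in> M" for m
    proof -
      obtain z where z: "z \<noteq> 0" "m = \<Phi> z" using m by (auto simp: M_def)
      show ?thesis using card_mono[OF _ unit[OF z(1)]] cu[OF z(1)] z(2) by simp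
    qed
    have "\<not> (f x = 0 \<and> g x = 0)" "\<not> (f y = 0 \<and> g y = 0)" using ker x y by blast+
    then have "\<Phi> y = \<Phi> x" unfolding \<Phi>_def using det by (intro span_vector2_eq) (simp_all add: mult.commute)
    then have "y \<in> F (\<Phi> x)" using y by (simp add: F_def)
    moreover have "y \<notin> (\<lambda>c. c * x) ` (Fq q - {0})" using no by blast
    ultimately have "(\<lambda>c. c * x) ` (Fq q - {0}) \<subset> F (\<Phi> x)" using unit[OF x] by blast
    then have "card ((\<lambda>c. c * x) ` (Fq q - {0})) < card (F (\<Phi> x))" by (intro psubset_card_mono) simp_all
    then have gt: "q - 1 < card (F (\<Phi> x))" by (simp only: cu[OF x])
    have "card M * (q - 1) = (\<Sum>m\<in>M. q - 1)" by simp
    also have "\<dots> < (\<Sum>m\<in>M. card (F m))"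
    proof (rule sum_strict_mono_ex1)
      have "\<Phi> x \<in> M" using x by (simp add: M_def)
      then show "\<exists>m\<in>M. q - 1 < card (F m)" using gt by blast
    qed (use ge in \<open>simp_all add: M_def\<close>)
    also have "\<dots> = card (\<Union>m\<in>M. F m)"
      by (rule card_UN_disjoint[symmetric]) (auto simp: F_def)
    also have "(\<Union>m\<in>M. F m) = UNIV - {0}" by (auto simp: F_def M_def)
    also have "card (UNIV - {0 :: 'a}) = q ^ 5 - 1" by (simp add: card_Diff_subset card_field)
    finally show False using cM by simp
  qed
qed

section \<open>Recognising the two known types\<close>

lemma additive_bij:
  fixes h :: "'a \<Rightarrow> 'a"
  assumes "\<And>x y. h (x - y) = h x - h y" "\<And>y. h y = 0 \<Longrightarrow> y = 0"
  shows "bij h"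
proof -
  have "inj h" using assms by (metis injI right_minus_eq)
  then show ?thesis by (simp add: bij_def finite_UNIV_inj_surj)
qed

lemma frob_mod: "(x :: 'a) ^ (q ^ (m mod 5)) = x ^ (q ^ m)"
proof -
  have "x ^ (q ^ (r + 5 * j)) = x ^ (q ^ r)" for r j
    by (induction j) (simp_all add: frob_period add.assoc[symmetric] add.commute[of 5])
  from this[of "m mod 5" "m div 5"] show ?thesis by simp
qed

lemma reparametrise_bij:
  fixes h :: "'a \<Rightarrow> 'a"
  assumes "bij h" "h 0 = 0"
  shows "{G (h y) | y. y \<noteq> 0} = {G x | x. x \<noteq> 0}"
proof -
  have "h y = 0 \<longleftrightarrow> y = 0" for y using assms by (metis bij_pointE)
  then show ?thesis using assms(1) by (auto, metis bij_pointE)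
qed

lemma pseudoregulus_typeI:
  fixes h :: "'a \<Rightarrow> 'a"
  assumes eqv: "PGL_equivalent L {vec.span {vector [h y, sg i (h y)] :: 'a ^ 2} | y. y \<noteq> 0}"
    and i: "1 \<le> i" "i \<le> 4" and h: "bij h" "h 0 = 0"
  shows "pseudoregulus_type q L"
proof -
  have "i = 1 \<or> i = 2 \<or> i = 3 \<or> i = 4" using i by arith
  then have "gcd (s * i) 5 = 1" using s_cases by (elim disjE) (simp_all add: gcd_non_0_nat)
  moreover have "PGammaL_equivalent L {vec.span {vector [x, x ^ (q ^ (s * i))] :: 'a ^ 2} | x. x \<noteq> 0}"
    using PGL_equivalent_imp[OF eqv] reparametrise_bij[OF h, of "\<lambda>x. vec.span {vector [x, sg i x] :: 'a ^ 2}"]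
    by (simp add: sg_def)
  ultimately show ?thesis unfolding pseudoregulus_type_def by (intro exI[of _ "s * i"] conjI)
qed

lemma LP_typeI:
  fixes h :: "'a \<Rightarrow> 'a"
  assumes eqv: "PGL_equivalent L {vec.span {vector [h y, sg i (h y) + d * sg (5 - i) (h y)] :: 'a ^ 2} | y. y \<noteq> 0}"
    and i: "1 \<le> i" "i \<le> 4" and h: "bij h" "h 0 = 0" and d: "d \<noteq> 0" "norm5 q d \<noteq> 1"
  shows "LP_type q L"
proof -
  \<comment> \<open>Reduced because \<open>LP_type\<close> asks for an exponent below 5.\<close>
  define t where "t = (s * i) mod 5"
  have "i = 1 \<or> i = 2 \<or> i = 3 \<or> i = 4" using i by arith
  then have t: "t < 5" "gcd t 5 = 1" "5 - t = (s * (5 - i)) mod 5"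
    using s_cases unfolding t_def by (elim disjE; simp add: gcd_non_0_nat)+
  have "x ^ (q ^ t) = sg i x" "x ^ (q ^ (5 - t)) = sg (5 - i) x" for x
    unfolding t(3) unfolding t_def by (simp_all only: frob_mod sg_def)
  then have "PGammaL_equivalent L {vec.span {vector [x, x ^ (q ^ t) + d * x ^ (q ^ (5 - t))] :: 'a ^ 2} | x. x \<noteq> 0}"
    using PGL_equivalent_imp[OF eqv]
      reparametrise_bij[OF h, of "\<lambda>x. vec.span {vector [x, sg i x + d * sg (5 - i) x] :: 'a ^ 2}"] by simp
  moreover have "norm5 q d \<notin> {0, 1}" using d by (simp add: norm_eq_0)
  ultimately show ?thesis unfolding LP_type_def using t(1,2) by (intro exI[of _ t] exI[of _ d] conjI)
qed

text \<open>Every degenerate kernel contradicts either \<open>scat\<close> or one of the excluded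
  types. The two negated existentials are shaped to meet the conclusions of
  \<open>pseudoregulus_factor\<close> and \<open>LP_factor\<close>.\<close>

lemma normal_form_coefficients:
  fixes b2 b3 b4 :: 'a
  assumes L: "L \<subseteq> pg_points" "card L = (q ^ 5 - 1) div (q - 1)"
    and types: "\<not> pseudoregulus_type q L" "\<not> LP_type q L"
    and b: "(b2, b3, b4) \<noteq> (0, 0, 0)"
    and nf: "\<And>r1 r2 r3 t1 t2 t3.
      (\<And>c2 c3 c4. r1 * c2 + r2 * c3 + r3 * c4 = 0 \<and> t1 * c2 + t2 * c3 + t3 * c4 = 0 \<longleftrightarrow>
        (\<exists>k. c2 = k * b2 \<and> c3 = k * b3 \<and> c4 = k * b4)) \<Longrightarrow>
      (\<forall>y. r1 * y + r2 * sg 1 y + r3 * sg 2 y = 0 \<and> t1 * y + t2 * sg 1 y + t3 * sg 2 y = 0 \<longrightarrow> y = 0) \<and>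
      PGL_equivalent L {vec.span {vector [r1 * y + r2 * sg 1 y + r3 * sg 2 y, t1 * y + t2 * sg 1 y + t3 * sg 2 y]} | y. y \<noteq> 0}"
  shows "\<exists>a b. a \<noteq> 0 \<and> b \<noteq> 0 \<and> scat a b 1 \<and>
    PGL_equivalent L {vec.span {vector [y - a * sg 2 y, sg 1 y - b * sg 2 y]} | y. y \<noteq> 0} \<and>
    \<not> (\<exists>\<nu>. a = \<nu> * sg 1 \<nu> \<and> b = sg 1 \<nu>) \<and>
    \<not> (\<exists>c. c \<noteq> 0 \<and> norm5 q (- c) \<noteq> 1 \<and> a * (c * sg 1 c * sg 4 c) = 1 \<and> b = - (sg 3 c + a / sg 2 c))"
proof -
  note proportional = maximum_scattered_imp_proportional[OF L]
  have bij_sg: "bij (sg i)" for i by (rule additive_bij) simp_all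
  have bij_id: "bij (\<lambda>y::'a. y)" by (simp add: bij_def)
  have "b4 \<noteq> 0"
  proof
    assume b4: "b4 = 0"
    show False
    proof (cases "b2 = 0 \<or> b3 = 0")
      case True
      then consider "b2 = 0" "b3 \<noteq> 0" | "b3 = 0" "b2 \<noteq> 0" using b b4 by auto
      then show False
      proof cases
        case 1
        have "PGL_equivalent L {vec.span {vector [1 * y + 0 * sg 1 y + 0 * sg 2 y, 0 * y + 0 * sg 1 y + 1 * sg 2 y]} | y. y \<noteq> 0}"
          by (rule nf[THEN conjunct2]) (use 1 b4 in \<open>auto intro: exI[of _ "_ / b3"]\<close>)
        then have "pseudoregulus_type q L" using pseudoregulus_typeI[where h = "\<lambda>y. y" and i = 2, OF _ _ _ bij_id] by simp
        then show False using types by simp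
      next
        case 2
        have "PGL_equivalent L {vec.span {vector [0 * y + 1 * sg 1 y + 0 * sg 2 y, 0 * y + 0 * sg 1 y + 1 * sg 2 y]} | y. y \<noteq> 0}"
          by (rule nf[THEN conjunct2]) (use 2 b4 in \<open>auto intro: exI[of _ "_ / b2"]\<close>)
        then have "pseudoregulus_type q L" using pseudoregulus_typeI[where h = "sg 1" and i = 1, OF _ _ _ bij_sg] by simp
        then show False using types by simp
      qed
    next
      case False
      have rows: "0 * c2 + 0 * c3 + 1 * c4 = 0 \<and> b3 * c2 + (- b2) * c3 + 0 * c4 = 0 \<longleftrightarrow>
        (\<exists>k. c2 = k * b2 \<and> c3 = k * b3 \<and> c4 = k * b4)" for c2 c3 c4
      proof
        assume *: "0 * c2 + 0 * c3 + 1 * c4 = 0 \<and> b3 * c2 + (- b2) * c3 + 0 * c4 = 0"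
        then have "c2 = (c2 / b2) * b2 \<and> c3 = (c2 / b2) * b3 \<and> c4 = (c2 / b2) * b4"
          using False b4 by (simp add: field_simps)
        then show "\<exists>k. c2 = k * b2 \<and> c3 = k * b3 \<and> c4 = k * b4" by blast
      qed (use b4 in auto)
      note n = nf[of 0 0 1 b3 "- b2" 0, OF rows]
      have "scat b2 b3 0" unfolding scat_def
      proof (intro allI impI)
        fix x y assume x: "x \<noteq> 0" and D: "0 * D1 x y - b3 * D2 x y + b2 * sg 1 (D1 x y) = 0"
        show "\<exists>c\<in>Fq q. y = c * x"
        proof (rule proportional[OF n[THEN conjunct2] _ _ n[THEN conjunct1] x])
          show "(0 * x + 0 * sg 1 x + 1 * sg 2 x) * (b3 * y + (- b2) * sg 1 y + 0 * sg 2 y) =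
            (b3 * x + (- b2) * sg 1 x + 0 * sg 2 x) * (0 * y + 0 * sg 1 y + 1 * sg 2 y)"
            using D by (simp add: D1_def D2_def algebra_simps)
        qed (simp_all add: Fq_sg algebra_simps)
      qed
      then show False using binomial_not_scat' False by blast
    qed
  qed
  define a b where "a = b2 / b4" and "b = b3 / b4"
  have b23: "b2 = b4 * a" "b3 = b4 * b" using \<open>b4 \<noteq> 0\<close> by (simp_all add: a_def b_def)
  have K: "(\<exists>k. c2 = k * b2 \<and> c3 = k * b3 \<and> c4 = k * b4) \<longleftrightarrow> c2 = a * c4 \<and> c3 = b * c4" for c2 c3 c4
  proof
    assume "c2 = a * c4 \<and> c3 = b * c4"
    then have "c2 = (c4 / b4) * b2 \<and> c3 = (c4 / b4) * b3 \<and> c4 = (c4 / b4) * b4"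
      using \<open>b4 \<noteq> 0\<close> by (simp add: b23)
    then show "\<exists>k. c2 = k * b2 \<and> c3 = k * b3 \<and> c4 = k * b4" by blast
  qed (auto simp: b23 algebra_simps)
  note nf' = nf[unfolded K]
  have rows: "1 * c2 + 0 * c3 + (- a) * c4 = 0 \<and> 0 * c2 + 1 * c3 + (- b) * c4 = 0 \<longleftrightarrow> c2 = a * c4 \<and> c3 = b * c4" for c2 c3 c4
    by auto
  note n = nf'[of 1 0 "- a" 0 1 "- b", OF rows]
  have sc: "scat a b 1" unfolding scat_def
  proof (intro allI impI)
    fix x y assume x: "x \<noteq> 0" and D: "1 * D1 x y - b * D2 x y + a * sg 1 (D1 x y) = 0"
    show "\<exists>c\<in>Fq q. y = c * x"
    proof (rule proportional[OF n[THEN conjunct2] _ _ n[THEN conjunct1] x])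
      show "(1 * x + 0 * sg 1 x + (- a) * sg 2 x) * (0 * y + 1 * sg 1 y + (- b) * sg 2 y) =
        (0 * x + 1 * sg 1 x + (- b) * sg 2 x) * (1 * y + 0 * sg 1 y + (- a) * sg 2 y)"
        using D by (simp add: D1_def D2_def algebra_simps)
    qed (simp_all add: Fq_sg algebra_simps)
  qed
  have "\<not> (a = 0 \<and> b = 0)"
  proof
    assume ab: "a = 0 \<and> b = 0"
    then have "PGL_equivalent L {vec.span {vector [y, sg 1 y]} | y. y \<noteq> 0}" using n by simp
    then have "pseudoregulus_type q L" using pseudoregulus_typeI[where h = "\<lambda>y. y" and i = 1, OF _ _ _ bij_id] by simp
    then show False using types by simp
  qed
  moreover have "\<not> (a = 0 \<and> b \<noteq> 0)" using sc binomial_not_scat by blast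
  ultimately have a0: "a \<noteq> 0" by blast
  have "b \<noteq> 0"
  proof
    assume b0: "b = 0"
    \<comment> \<open>For \<open>b = 0\<close> the functionals \<open>sg 1 y\<close> and
      \<open>sg 2 y - y / a\<close> serve: \<open>y\<close> is the image of \<open>sg 1 y\<close>
      under \<open>sg 4\<close>, so this is the LP form with coefficient
      \<open>- 1 / a\<close>.\<close>
    have "0 * c2 + 1 * c3 + 0 * c4 = 0 \<and> (- 1 / a) * c2 + 0 * c3 + 1 * c4 = 0 \<longleftrightarrow> c2 = a * c4 \<and> c3 = b * c4" for c2 c3 c4
      using a0 b0 by (auto simp: field_simps)
    from nf'[OF this] have "PGL_equivalent L {vec.span {vector [sg 1 y, sg 1 (sg 1 y) + (- 1 / a) * sg (5 - 1) (sg 1 y)]} | y. y \<noteq> 0}"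
      by (simp add: add.commute)
    from LP_typeI[OF this _ _ bij_sg] have "norm5 q (- 1 / a) = 1" using types a0 by auto
    moreover have "norm5 q (- 1 / a) = norm5 q 1 / norm5 q (- a)" by (simp flip: norm_div)
    ultimately have "norm5 q (- a) = 1" by (simp add: norm5_def[of q 1])
    then show False using LP_norm_one_not_scat sc b0 by blast
  qed
  moreover have "\<not> (\<exists>\<nu>. a = \<nu> * sg 1 \<nu> \<and> b = sg 1 \<nu>)"
  proof
    assume "\<exists>\<nu>. a = \<nu> * sg 1 \<nu> \<and> b = sg 1 \<nu>"
    then obtain \<nu> where \<nu>: "a = \<nu> * sg 1 \<nu>" "b = sg 1 \<nu>" by blast
    have "1 * c2 + (- \<nu>) * c3 + 0 * c4 = 0 \<and> 0 * c2 + 1 * c3 + (- b) * c4 = 0 \<longleftrightarrow> c2 = a * c4 \<and> c3 = b * c4" for c2 c3 c4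
      unfolding \<nu> by auto
    note m = nf'[OF this]
    define h where "h y = y - \<nu> * sg 1 y" for y
    have h: "1 * y + (- \<nu>) * sg 1 y + 0 * sg 2 y = h y" "0 * y + 1 * sg 1 y + (- b) * sg 2 y = sg 1 (h y)" for y
      by (simp_all add: h_def \<nu>)
    note m = m[unfolded h]
    have "bij h"
    proof (rule additive_bij)
      show "h (x - y) = h x - h y" for x y by (simp add: h_def algebra_simps)
      show "y = 0" if "h y = 0" for y using m that by simp
    qed
    moreover have "h 0 = 0" by (simp add: h_def)
    ultimately have "pseudoregulus_type q L" using pseudoregulus_typeI[OF m[THEN conjunct2]] by simp
    then show False using types by simp
  qed
  moreover have "\<not> (\<exists>c. c \<noteq> 0 \<and> norm5 q (- c) \<noteq> 1 \<and> a * (c * sg 1 c * sg 4 c) = 1 \<and> b = - (sg 3 c + a / sg 2 c))"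
  proof
    assume "\<exists>c. c \<noteq> 0 \<and> norm5 q (- c) \<noteq> 1 \<and> a * (c * sg 1 c * sg 4 c) = 1 \<and> b = - (sg 3 c + a / sg 2 c)"
    then obtain c where c: "c \<noteq> 0" "norm5 q (- c) \<noteq> 1" "a * (c * sg 1 c * sg 4 c) = 1" "b = - (sg 3 c + a / sg 2 c)" by blast
    have a: "a = 1 / (c * sg 1 c * sg 4 c)" using c(1,3) by (simp add: field_simps)
    have "(1 / sg 2 c) * c2 + 1 * c3 + sg 3 c * c4 = 0 \<and> (- c * sg 1 c) * c2 + 0 * c3 + (1 / sg 4 c) * c4 = 0 \<longleftrightarrow>
      c2 = a * c4 \<and> c3 = b * c4" for c2 c3 c4
    proof -
      have "(- c * sg 1 c) * c2 + 0 * c3 + (1 / sg 4 c) * c4 = 0 \<longleftrightarrow> c2 = a * c4"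
        unfolding a using c(1) by (auto simp: field_simps)
      moreover have "(1 / sg 2 c) * c2 + 1 * c3 + sg 3 c * c4 = 0 \<longleftrightarrow> c3 = b * c4" if "c2 = a * c4"
      proof -
        have "(1 / sg 2 c) * c2 + 1 * c3 + sg 3 c * c4 = c3 - b * c4"
          unfolding that c(4) by (simp add: algebra_simps)
        then show ?thesis by (simp only: right_minus_eq)
      qed
      ultimately show ?thesis by blast
    qed
    note m = nf'[OF this]
    \<comment> \<open>The second functional is \<open>sg 2 (h y) - c * sg 3 (h y)\<close>; the
      coefficients of \<open>h\<close> are such that its terms in \<open>sg 3 y\<close> and
      \<open>sg 4 y\<close> cancel.\<close>
    define h where "h y = (1 / sg 2 c) * y + 1 * sg 1 y + sg 3 c * sg 2 y" for y
    have h: "(- c * sg 1 c) * y + 0 * sg 1 y + (1 / sg 4 c) * sg 2 y = sg 2 (h y) + (- c) * sg (5 - 2) (h y)" for y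
      using c(1) by (simp add: h_def field_simps)
    note m = m[unfolded h h_def[symmetric]]
    have "bij h"
    proof (rule additive_bij)
      show "h (x - y) = h x - h y" for x y by (simp add: h_def algebra_simps diff_divide_distrib)
      show "y = 0" if "h y = 0" for y using m that by simp
    qed
    moreover have "h 0 = 0" by (simp add: h_def)
    ultimately have "LP_type q L" using LP_typeI[OF m[THEN conjunct2]] c(1,2) by simp
    then show False using types by simp
  qed
  moreover have "PGL_equivalent L {vec.span {vector [y - a * sg 2 y, sg 1 y - b * sg 2 y]} | y. y \<noteq> 0}"
    using n by simp
  ultimately show ?thesis using a0 sc by blast
qed

end

theorem theorem4p9:
  fixes q s :: nat
    and \<Sigma> \<Gamma> \<Lambda> :: "('a::{field,finite} ^ 5) set set"
    and \<sigma> :: "('a ^ 5) set \<Rightarrow> ('a ^ 5) set"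
    and A :: "('a ^ 5) set"
    and e :: "'a ^ 2 \<Rightarrow> 'a ^ 5"
    and L :: "('a ^ 2) set set"
  assumes "primepow q" and "CARD('a) = q ^ 5"
    and "canonical_subgeometry q \<Sigma>"
    and "pg_subspace 2 \<Gamma>" and "\<Gamma> \<inter> \<Sigma> = {}"
    and "pg_subspace 1 \<Lambda>" and "\<Lambda> \<inter> \<Gamma> = {}"
    and "line_coordinates e \<Lambda>"
    and "L = {Q \<in> pg_points. e ` Q \<in> projection \<Gamma> \<Lambda> \<Sigma>}"
    and "maximum_scattered q L"
    and "\<not> pseudoregulus_type q L" and "\<not> LP_type q L"
    and "generate (BijGroup pg_points) {\<sigma>} = pointwise_stabilizer \<Sigma>"
    and "1 \<le> s" and "s \<le> 4"
    and "has_companion \<sigma> (\<lambda>x. x ^ (q ^ s))"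
    and "\<Gamma> \<inter> image (\<sigma> ^^ 4) \<Gamma> = {A}"
    and "point_rank \<sigma> A = 5"
  shows "\<exists>k \<delta>. k \<noteq> 0 \<and> \<delta> \<in> Fq q \<and>
    PGL_equivalent L
      {vec.span {vector [x - inverse k * x ^ (q ^ (2 * s)),
                         x ^ (q ^ s) - \<delta> * k ^ (q ^ (4 * s) + q ^ (2 * s)) * x ^ (q ^ (2 * s))]}
       | x. x \<noteq> 0} \<and>
    (let \<epsilon> = norm5 q k in
       \<delta> ^ 2 * \<epsilon> \<noteq> 1 \<and>
       \<delta> ^ 3 * \<epsilon> ^ 2 + (1 - 3 * \<delta>) * \<epsilon> + 1 \<noteq> 0 \<and>
       \<not> (\<exists>x. \<epsilon> * norm5 q x = - 1 \<and>
             \<delta> ^ 2 * \<epsilon> * x ^ (q ^ s)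
             - \<delta> * \<epsilon> * x ^ (q ^ (2 * s) + q ^ s + 1) * (1 - x) ^ (q ^ (3 * s))
             + (1 - x) ^ (q ^ s + 1) = 0))"
proof -
  interpret quintic_sigma q "TYPE('a)" s using assms(1,2,14,15) by unfold_locales auto
  have "\<sigma> \<in> pointwise_stabilizer \<Sigma>" unfolding assms(13)[symmetric] by (simp add: generate.incl)
  then have stab: "\<forall>P\<in>\<Sigma>. \<sigma> P = P" by (simp add: pointwise_stabilizer_def)
  obtain b2 b3 b4 where b: "(b2, b3, b4) \<noteq> (0, 0, 0)" and nf: "\<forall>r1 r2 r3 t1 t2 t3.
    (\<forall>c2 c3 c4. r1 * c2 + r2 * c3 + r3 * c4 = 0 \<and> t1 * c2 + t2 * c3 + t3 * c4 = 0 \<longleftrightarrow>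
      (\<exists>k. c2 = k * b2 \<and> c3 = k * b3 \<and> c4 = k * b4)) \<longrightarrow>
    (\<forall>y. r1 * y + r2 * sg 1 y + r3 * sg 2 y = 0 \<and> t1 * y + t2 * sg 1 y + t3 * sg 2 y = 0 \<longrightarrow> y = 0) \<and>
    PGL_equivalent L {vec.span {vector [r1 * y + r2 * sg 1 y + r3 * sg 2 y, t1 * y + t2 * sg 1 y + t3 * sg 2 y]} | y. y \<noteq> 0}"
    using projection_normal_form[OF assms(3-5,7-9) stab assms(16-18)] by (elim exE conjE)
  have Lpg: "L \<subseteq> pg_points" using assms(9) by auto
  have card: "card L = (q ^ 5 - 1) div (q - 1)" using assms(10) by (simp add: maximum_scattered_def)
  have "\<exists>a b. a \<noteq> 0 \<and> b \<noteq> 0 \<and> scat a b 1 \<and>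
    PGL_equivalent L {vec.span {vector [y - a * sg 2 y, sg 1 y - b * sg 2 y]} | y. y \<noteq> 0} \<and>
    \<not> (\<exists>\<nu>. a = \<nu> * sg 1 \<nu> \<and> b = sg 1 \<nu>) \<and>
    \<not> (\<exists>c. c \<noteq> 0 \<and> norm5 q (- c) \<noteq> 1 \<and> a * (c * sg 1 c * sg 4 c) = 1 \<and> b = - (sg 3 c + a / sg 2 c))"
    by (rule normal_form_coefficients[OF Lpg card assms(11,12) b], rule nf[rule_format])
  then obtain a b where ab: "a \<noteq> 0" "b \<noteq> 0" and sc: "scat a b 1"
    and eqv: "PGL_equivalent L {vec.span {vector [y - a * sg 2 y, sg 1 y - b * sg 2 y]} | y. y \<noteq> 0}"
    and pse: "\<not> (\<exists>\<nu>. a = \<nu> * sg 1 \<nu> \<and> b = sg 1 \<nu>)"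
    and lp: "\<not> (\<exists>c. c \<noteq> 0 \<and> norm5 q (- c) \<noteq> 1 \<and> a * (c * sg 1 c * sg 4 c) = 1 \<and> b = - (sg 3 c + a / sg 2 c))"
    by (elim exE conjE)
  define k \<delta> n where "k = inverse a" and "\<delta> = b * sg 2 a * sg 4 a" and "n = norm5 q a"
  have \<delta>: "\<delta> \<in> Fq q" "\<delta> \<noteq> 0" using scat_imp_delta_Fq[OF sc ab(1)] ab by (simp_all add: \<delta>_def)
  have n0: "n \<noteq> 0" using ab by (simp add: n_def norm_eq_0)
  have \<epsilon>: "norm5 q k = 1 / n" unfolding k_def n_def norm5_def by (simp only: power_inverse flip: inverse_eq_divide)
  have ks: "\<delta> * k ^ (q ^ (4 * s) + q ^ (2 * s)) = b"
  proof -
    have "k ^ (q ^ (4 * s) + q ^ (2 * s)) = sg 4 k * sg 2 k" by (simp add: sg_def power_add mult.commute)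
    then show ?thesis using ab by (simp add: k_def \<delta>_def field_simps)
  qed
  have sgs: "x ^ (q ^ s) = sg 1 x" "x ^ (q ^ (2 * s)) = sg 2 x" "x ^ (q ^ (3 * s)) = sg 3 x" for x :: 'a
    by (simp_all add: sg_def mult.commute)
  show ?thesis
  proof (rule exI[of _ k], rule exI[of _ \<delta>], unfold Let_def, intro conjI notI)
    show "k = 0 \<Longrightarrow> False" using ab by (simp add: k_def)
    show "\<delta> \<in> Fq q" by (rule \<delta>)
    show "PGL_equivalent L
      {vec.span {vector [x - inverse k * x ^ (q ^ (2 * s)),
                         x ^ (q ^ s) - \<delta> * k ^ (q ^ (4 * s) + q ^ (2 * s)) * x ^ (q ^ (2 * s))]}
       | x. x \<noteq> 0}"
      using eqv unfolding ks unfolding sgs by (simp add: k_def)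
    show 1: False if "\<delta> ^ 2 * norm5 q k = 1"
    proof -
      have "\<delta> ^ 2 = norm5 q a" using that n0 unfolding \<epsilon> by (simp add: field_simps n_def)
      then show False using pseudoregulus_factor[OF ab(1) \<delta>_def \<delta>(1)] pse by blast
    qed
    show False if "\<delta> ^ 3 * (norm5 q k) ^ 2 + (1 - 3 * \<delta>) * norm5 q k + 1 = 0"
    proof -
      \<comment> \<open>The factor \<open>n ^ 2\<close> turns the condition on the norm of
        \<open>k\<close> into the cubic of \<open>LP_factor\<close>.\<close>
      have "n ^ 2 * (\<delta> ^ 3 * (1 / n) ^ 2 + (1 - 3 * \<delta>) * (1 / n) + 1) = 0" using that unfolding \<epsilon> by simp
      then have cubic: "\<delta> ^ 3 + (1 - 3 * \<delta>) * n + n ^ 2 = 0"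
        using n0 by (simp add: distrib_left power_divide power2_eq_square mult.commute)
      have "\<delta> ^ 2 \<noteq> n"
      proof
        assume "\<delta> ^ 2 = n"
        then show False using 1 n0 unfolding \<epsilon> by simp
      qed
      then show False using LP_factor[OF ab(1) \<delta>_def \<delta> n_def _ cubic] lp by blast
    qed
    assume "\<exists>x. norm5 q k * norm5 q x = - 1 \<and>
             \<delta> ^ 2 * norm5 q k * x ^ (q ^ s)
             - \<delta> * norm5 q k * x ^ (q ^ (2 * s) + q ^ s + 1) * (1 - x) ^ (q ^ (3 * s))
             + (1 - x) ^ (q ^ s + 1) = 0"
    then obtain x where x: "norm5 q k * norm5 q x = - 1" and
      st: "\<delta> ^ 2 * norm5 q k * x ^ (q ^ s)
             - \<delta> * norm5 q k * x ^ (q ^ (2 * s) + q ^ s + 1) * (1 - x) ^ (q ^ (3 * s))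
             + (1 - x) ^ (q ^ s + 1) = 0" by blast
    have nx: "norm5 q x = - n" using x n0 unfolding \<epsilon> by (simp add: field_simps)
    \<comment> \<open>With \<open>\<delta>\<close> in the subfield its conjugates coincide, and the
      excluded equation is the one of \<open>star_not_scat\<close>.\<close>
    have "\<delta> * sg 1 \<delta> / n * sg 1 x - \<delta> * sg 1 \<delta> / (n * sg 3 \<delta>) * (x * sg 1 x * sg 2 x) * (1 - sg 3 x)
      + (1 - x) * (1 - sg 1 x) = 0"
      using st \<delta>(2) unfolding \<epsilon> power_add power_one_right sgs Fq_sg[OF \<delta>(1)]
      by (simp add: power2_eq_square mult_ac)
    then show False using star_not_scat[OF ab \<delta>_def n_def nx] sc by blast
  qed
qed

end
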